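(* For every real $\varepsilon>0$, let $A_\varepsilon$ be the universal unital $C^*$-algebra generated by a pair of unitaries $u,v$ subject to the relation $\|uv-vu\|\le\varepsilon$. Then $A_\varepsilon$ is residually finite dimensional, i.e. it admits a separating family of finite dimensional representations: for every nonzero $a\in A_\varepsilon$ there is a representation $\pi$ of $A_\varepsilon$ on a finite dimensional Hilbert space with $\pi(a)\neq 0$.
   Context: For $\varepsilon\ge 0$, $A_\varepsilon$ is the universal unital $C^*$-algebra with generators $u,v$ and relations $uu^*=u^*u=1$, $vv^*=v^*v=1$, $\|uv-vu\|\le\varepsilon$. That is, $A_\varepsilon$ is a unital $C^*$-algebra generated by elements $u,v$ satisfying these relations, and for any unital $C^*$-algebra $D$ and any $U,V\in D$ satisfying the same relations there is a unique unital $*$-homomorphism $A_\varepsilon\to D$ with $u\mapsto U$, $v\mapsto V$. A representation of a $C^*$-algebra is a $*$-homomorphism into the bounded operators on a Hilbert space; it is finite dimensional if the Hilbert space is. *)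

theory Defs
  imports "HOL-Analysis.Analysis" "Jordan_Normal_Form.VS_Connect"
begin

text \<open>
  Normed structures are given by an explicit carrier. The metric is cut off outside the carrier
  because \<^locale>\<open>Metric_space\<close> demands symmetry and nonnegativity on the whole type.
\<close>

definition norm_dist :: "('a, 'm) ring_scheme \<Rightarrow> ('a \<Rightarrow> real) \<Rightarrow> 'a \<Rightarrow> 'a \<Rightarrow> real" where
  "norm_dist R N x y = (if x \<in> carrier R \<and> y \<in> carrier R then N (x \<ominus>\<^bsub>R\<^esub> y) else 0)"


lemma minus_swap:
  fixes V :: "(complex, 'a, 'm) module_scheme" (structure)
  assumes "vectorspace class_ring V" "x \<in> carrier V" "y \<in> carrier V"
  shows "x \<ominus> y = (-1) \<odot> (y \<ominus> x)"
proof -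
  interpret vs: vectorspace class_ring V by (rule assms(1))
  have m: "\<ominus> z = (-1) \<odot> z" if "z \<in> carrier V" for z
    using vs.smult_l_minus[of 1 z] that vs.smult_one[of z] by (simp add: class_ring_simps)
  have "x \<ominus> y = \<ominus> (y \<ominus> x)"
    using assms by (simp add: vs.M.minus_eq vs.M.minus_add vs.M.a_comm)
  also have "\<dots> = (-1) \<odot> (y \<ominus> x)"
    using assms by (intro m) simp
  finally show ?thesis .
qed

lemma minus_split:
  fixes V :: "(complex, 'a, 'm) module_scheme" (structure)
  assumes "vectorspace class_ring V" "x \<in> carrier V" "y \<in> carrier V" "z \<in> carrier V"
  shows "x \<ominus> z = (x \<ominus> y) \<oplus> (y \<ominus> z)"
proof -
  interpret vs: vectorspace class_ring V by (rule assms(1))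
  show ?thesis using assms by (simp add: vs.M.minus_eq vs.M.a_assoc vs.M.r_neg1)
qed

lemma Metric_space_norm_dist:
  fixes V :: "(complex, 'a, 'm) module_scheme" (structure)
  assumes V: "vectorspace class_ring V"
    and nonneg: "\<And>x. x \<in> carrier V \<Longrightarrow> 0 \<le> N x"
    and zero: "\<And>x. x \<in> carrier V \<Longrightarrow> N x = 0 \<longleftrightarrow> x = \<zero>"
    and triangle: "\<And>x y. \<lbrakk>x \<in> carrier V; y \<in> carrier V\<rbrakk> \<Longrightarrow> N (x \<oplus> y) \<le> N x + N y"
    and smult: "\<And>c x. x \<in> carrier V \<Longrightarrow> N (c \<odot> x) = cmod c * N x"
  shows "Metric_space (carrier V) (norm_dist V N)"
proof
  interpret vs: vectorspace class_ring V by (rule V)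
  show "0 \<le> norm_dist V N x y" for x y by (simp add: norm_dist_def nonneg)
  show "norm_dist V N x y = norm_dist V N y x" for x y
    using minus_swap[OF V, of x y] by (simp add: norm_dist_def smult)
  show "norm_dist V N x y = 0 \<longleftrightarrow> x = y" if "x \<in> carrier V" "y \<in> carrier V" for x y
    using that by (simp add: norm_dist_def zero)
  show "norm_dist V N x z \<le> norm_dist V N x y + norm_dist V N y z"
    if "x \<in> carrier V" "y \<in> carrier V" "z \<in> carrier V" for x y z
    using that triangle[of "x \<ominus> y" "y \<ominus> z"] minus_split[OF V that] by (simp add: norm_dist_def)
qed


section \<open>Unital C*-algebras\<close>

record 'a normed_star_algebra = "(complex, 'a) module" +
  star :: "'a \<Rightarrow> 'a"
  anorm :: "'a \<Rightarrow> real"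

abbreviation alg_dist :: "'a normed_star_algebra \<Rightarrow> 'a \<Rightarrow> 'a \<Rightarrow> real" where
  "alg_dist A \<equiv> norm_dist A (anorm A)"

text \<open>The zero algebra, where \<open>\<one> = \<zero>\<close>, is not excluded.\<close>

locale unital_cstar_algebra =
  fixes A :: "'a normed_star_algebra" (structure)
  assumes ring: "ring A"
    and vectorspace: "vectorspace class_ring A"
    and smult_mult_left: "\<lbrakk>x \<in> carrier A; y \<in> carrier A\<rbrakk> \<Longrightarrow> (c \<odot> x) \<otimes> y = c \<odot> (x \<otimes> y)"
    and smult_mult_right: "\<lbrakk>x \<in> carrier A; y \<in> carrier A\<rbrakk> \<Longrightarrow> x \<otimes> (c \<odot> y) = c \<odot> (x \<otimes> y)"
    and star_closed: "x \<in> carrier A \<Longrightarrow> star A x \<in> carrier A"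
    and star_star: "x \<in> carrier A \<Longrightarrow> star A (star A x) = x"
    and star_add: "\<lbrakk>x \<in> carrier A; y \<in> carrier A\<rbrakk> \<Longrightarrow> star A (x \<oplus> y) = star A x \<oplus> star A y"
    and star_smult: "x \<in> carrier A \<Longrightarrow> star A (c \<odot> x) = cnj c \<odot> star A x"
    and star_mult: "\<lbrakk>x \<in> carrier A; y \<in> carrier A\<rbrakk> \<Longrightarrow> star A (x \<otimes> y) = star A y \<otimes> star A x"
    and anorm_nonneg: "x \<in> carrier A \<Longrightarrow> 0 \<le> anorm A x"
    and anorm_eq_0_iff: "x \<in> carrier A \<Longrightarrow> anorm A x = 0 \<longleftrightarrow> x = \<zero>"
    and anorm_triangle:
      "\<lbrakk>x \<in> carrier A; y \<in> carrier A\<rbrakk> \<Longrightarrow> anorm A (x \<oplus> y) \<le> anorm A x + anorm A y"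
    and anorm_smult: "x \<in> carrier A \<Longrightarrow> anorm A (c \<odot> x) = cmod c * anorm A x"
    and anorm_mult:
      "\<lbrakk>x \<in> carrier A; y \<in> carrier A\<rbrakk> \<Longrightarrow> anorm A (x \<otimes> y) \<le> anorm A x * anorm A y"
    and cstar_identity: "x \<in> carrier A \<Longrightarrow> anorm A (star A x \<otimes> x) = (anorm A x)\<^sup>2"
    and complete: "Metric_space.mcomplete (carrier A) (alg_dist A)"

context unital_cstar_algebra
begin

sublocale alg: ring A by (rule ring)
sublocale vs: vectorspace class_ring A by (rule vectorspace)
sublocale met: Metric_space "carrier A" "alg_dist A"
  by (rule Metric_space_norm_dist[OF vectorspace anorm_nonneg anorm_eq_0_iff anorm_triangle anorm_smult])

end

definition star_hom ::
  "'a normed_star_algebra \<Rightarrow> 'b normed_star_algebra \<Rightarrow> ('a \<Rightarrow> 'b) set" where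
  "star_hom A B = {\<phi> \<in> module_hom class_ring A B.
     (\<forall>x \<in> carrier A. \<forall>y \<in> carrier A. \<phi> (x \<otimes>\<^bsub>A\<^esub> y) = \<phi> x \<otimes>\<^bsub>B\<^esub> \<phi> y) \<and>
     (\<forall>x \<in> carrier A. \<phi> (star A x) = star B (\<phi> x))}"

definition unital_star_hom ::
  "'a normed_star_algebra \<Rightarrow> 'b normed_star_algebra \<Rightarrow> ('a \<Rightarrow> 'b) set" where
  "unital_star_hom A B = {\<phi> \<in> star_hom A B. \<phi> \<one>\<^bsub>A\<^esub> = \<one>\<^bsub>B\<^esub>}"

definition unital_cstar_subalgebra :: "'a normed_star_algebra \<Rightarrow> 'a set \<Rightarrow> bool" where
  "unital_cstar_subalgebra A S \<longleftrightarrow>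
     submodule class_ring S A \<and> \<one>\<^bsub>A\<^esub> \<in> S \<and>
     (\<forall>x \<in> S. \<forall>y \<in> S. x \<otimes>\<^bsub>A\<^esub> y \<in> S) \<and> (\<forall>x \<in> S. star A x \<in> S) \<and>
     closedin (Metric_space.mtopology (carrier A) (alg_dist A)) S"

definition generates_cstar :: "'a normed_star_algebra \<Rightarrow> 'a set \<Rightarrow> bool" where
  "generates_cstar A G \<longleftrightarrow> unital_cstar_subalgebra A hull G = carrier A"


section \<open>The universal algebra of two almost commuting unitaries\<close>

definition unitary_in :: "'a normed_star_algebra \<Rightarrow> 'a \<Rightarrow> bool" where
  "unitary_in A u \<longleftrightarrow>
     u \<in> carrier A \<and> u \<otimes>\<^bsub>A\<^esub> star A u = \<one>\<^bsub>A\<^esub> \<and> star A u \<otimes>\<^bsub>A\<^esub> u = \<one>\<^bsub>A\<^esub>"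

definition almost_commuting_unitaries ::
  "real \<Rightarrow> 'a normed_star_algebra \<Rightarrow> 'a \<Rightarrow> 'a \<Rightarrow> bool" where
  "almost_commuting_unitaries \<epsilon> A u v \<longleftrightarrow>
     unitary_in A u \<and> unitary_in A v \<and>
     anorm A (u \<otimes>\<^bsub>A\<^esub> v \<ominus>\<^bsub>A\<^esub> v \<otimes>\<^bsub>A\<^esub> u) \<le> \<epsilon>"

text \<open>
  The universal property is tested against the unital C*-algebras \<open>D\<close> whose carrier is a set of
  elements of the type \<open>'d\<close>. If \<open>'d\<close> has at least the cardinality of the continuum, this is no
  restriction: \<open>U\<close> and \<open>V\<close> generate a separable C*-subalgebra of \<open>D\<close>, which has at most
  continuum many elements and hence an isomorphic copy inside \<open>'d\<close>. The maps are taken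
  extensional so that uniqueness refers to values on the carrier only.
\<close>

definition universal_almost_commuting ::
  "'d itself \<Rightarrow> real \<Rightarrow> 'a normed_star_algebra \<Rightarrow> 'a \<Rightarrow> 'a \<Rightarrow> bool" where
  "universal_almost_commuting _ \<epsilon> A u v \<longleftrightarrow>
     unital_cstar_algebra A \<and> almost_commuting_unitaries \<epsilon> A u v \<and> generates_cstar A {u, v} \<and>
     (\<forall>(D :: 'd normed_star_algebra) U V.
        unital_cstar_algebra D \<and> almost_commuting_unitaries \<epsilon> D U V \<longrightarrow>
        (\<exists>!\<phi>. \<phi> \<in> unital_star_hom A D \<inter> extensional (carrier A) \<and> \<phi> u = U \<and> \<phi> v = V))"


section \<open>Hilbert spaces and their bounded operators\<close>

record 'h inner_space = "(complex, 'h) module" +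
  ip :: "'h \<Rightarrow> 'h \<Rightarrow> complex"

definition hnorm :: "'h inner_space \<Rightarrow> 'h \<Rightarrow> real" where
  "hnorm H x = sqrt (Re (ip H x x))"

text \<open>
  The inner product is linear in its first argument. The fields \<open>mult\<close> and \<open>one\<close>, which every
  module record inherits from rings, play no role.
\<close>

locale hilbert_space = vectorspace class_ring H
  for H :: "'h inner_space" (structure) +
  assumes ip_add_left:
      "\<lbrakk>x \<in> carrier H; y \<in> carrier H; z \<in> carrier H\<rbrakk> \<Longrightarrow> ip H (x \<oplus> y) z = ip H x z + ip H y z"
    and ip_smult_left: "\<lbrakk>x \<in> carrier H; y \<in> carrier H\<rbrakk> \<Longrightarrow> ip H (c \<odot> x) y = c * ip H x y"
    and ip_commute: "\<lbrakk>x \<in> carrier H; y \<in> carrier H\<rbrakk> \<Longrightarrow> ip H y x = cnj (ip H x y)"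
    and ip_nonneg: "x \<in> carrier H \<Longrightarrow> 0 \<le> Re (ip H x x)"
    and ip_definite: "\<lbrakk>x \<in> carrier H; ip H x x = 0\<rbrakk> \<Longrightarrow> x = \<zero>"
    and complete: "Metric_space.mcomplete (carrier H) (norm_dist H (hnorm H))"

context hilbert_space
begin

lemma ip_zero_left: "y \<in> carrier H \<Longrightarrow> ip H \<zero> y = 0"
  using ip_smult_left[of \<zero> y 0] by simp

lemma ip_add_right:
  assumes "x \<in> carrier H" "y \<in> carrier H" "z \<in> carrier H"
  shows "ip H x (y \<oplus> z) = ip H x y + ip H x z"
  using assms ip_commute[of "y \<oplus> z" x] ip_commute[of y x] ip_commute[of z x]
  by (simp add: ip_add_left)

lemma ip_smult_right:
  assumes "x \<in> carrier H" "y \<in> carrier H"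
  shows "ip H x (c \<odot> y) = cnj c * ip H x y"
  using assms ip_commute[of "c \<odot> y" x] ip_commute[of y x]
  by (simp add: ip_smult_left)

lemma ip_self: "x \<in> carrier H \<Longrightarrow> ip H x x = complex_of_real (Re (ip H x x))"
  using ip_commute[of x x] by (simp add: complex_eq_iff)

lemma hnorm_nonneg: "x \<in> carrier H \<Longrightarrow> 0 \<le> hnorm H x"
  by (simp add: hnorm_def ip_nonneg)

lemma hnorm_power2: "x \<in> carrier H \<Longrightarrow> (hnorm H x)\<^sup>2 = Re (ip H x x)"
  by (simp add: hnorm_def ip_nonneg)

lemma hnorm_eq_0_iff: "x \<in> carrier H \<Longrightarrow> hnorm H x = 0 \<longleftrightarrow> x = \<zero>"
  using ip_self[of x] ip_definite[of x] ip_zero_left[of \<zero>] by (auto simp: hnorm_def)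

lemma hnorm_smult: "x \<in> carrier H \<Longrightarrow> hnorm H (c \<odot> x) = cmod c * hnorm H x"
proof -
  assume x: "x \<in> carrier H"
  have "ip H (c \<odot> x) (c \<odot> x) = complex_of_real ((cmod c)\<^sup>2) * ip H x x"
    using x by (simp add: ip_smult_left ip_smult_right complex_norm_square mult_ac del: of_real_power)
  then have "Re (ip H (c \<odot> x) (c \<odot> x)) = (cmod c)\<^sup>2 * Re (ip H x x)"
    by simp
  then show ?thesis by (simp add: hnorm_def real_sqrt_mult)
qed

lemma Cauchy_Schwarz:
  assumes x: "x \<in> carrier H" and y: "y \<in> carrier H"
  shows "cmod (ip H x y) \<le> hnorm H x * hnorm H y"
proof (cases "y = \<zero>")
  case True
  then show ?thesis
    using x y ip_zero_left[of x] ip_commute[of y x] hnorm_eq_0_iff[of y] by simp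
next
  case False
  define r where "r = Re (ip H y y)"
  have yy: "ip H y y = of_real r" using ip_self[OF y] by (simp add: r_def)
  have "r \<noteq> 0" using False ip_definite[OF y] yy by auto
  then have r: "r > 0" using ip_nonneg[OF y] by (simp add: r_def)
  define b where "b = ip H x y"
  define z where "z = x \<oplus> (- (b / of_real r)) \<odot> y"
  have z: "z \<in> carrier H" using x y by (simp add: z_def)
  have yx: "ip H y x = cnj b" using ip_commute[OF x y] by (simp add: b_def)
  have "ip H z z = ip H x x - b * cnj b / of_real r"
    using x y r
    by (simp add: z_def ip_add_left ip_add_right ip_smult_left ip_smult_right yy yx
        b_def[symmetric] field_simps)
  also have "\<dots> = ip H x x - of_real ((cmod b)\<^sup>2 / r)"
    by (simp only: complex_norm_square of_real_divide)
  finally have "0 \<le> Re (ip H x x) - (cmod b)\<^sup>2 / r" using ip_nonneg[OF z] by simp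
  then have "(cmod b)\<^sup>2 \<le> Re (ip H x x) * r" using r by (simp add: field_simps)
  also have "\<dots> = (hnorm H x * hnorm H y)\<^sup>2"
    using x y by (simp add: power_mult_distrib hnorm_power2 r_def)
  finally show ?thesis
    unfolding b_def by (rule power2_le_imp_le) (simp add: x y hnorm_nonneg)
qed

lemma hnorm_triangle:
  assumes x: "x \<in> carrier H" and y: "y \<in> carrier H"
  shows "hnorm H (x \<oplus> y) \<le> hnorm H x + hnorm H y"
proof (rule power2_le_imp_le)
  have "(hnorm H (x \<oplus> y))\<^sup>2 = (hnorm H x)\<^sup>2 + (hnorm H y)\<^sup>2 + 2 * Re (ip H x y)"
    using x y ip_commute[OF x y] by (simp add: hnorm_power2 ip_add_left ip_add_right)
  also have "\<dots> \<le> (hnorm H x + hnorm H y)\<^sup>2"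
    using Cauchy_Schwarz[OF x y] complex_Re_le_cmod[of "ip H x y"] by (simp add: power2_sum)
  finally show "(hnorm H (x \<oplus> y))\<^sup>2 \<le> (hnorm H x + hnorm H y)\<^sup>2" .
qed (use x y in \<open>simp add: hnorm_nonneg\<close>)

sublocale met: Metric_space "carrier H" "norm_dist H (hnorm H)"
  by (rule Metric_space_norm_dist[OF vectorspace_axioms hnorm_nonneg hnorm_eq_0_iff hnorm_triangle
        hnorm_smult])

end

definition adjoint_op :: "'h inner_space \<Rightarrow> ('h \<Rightarrow> 'h) \<Rightarrow> 'h \<Rightarrow> 'h" where
  "adjoint_op H T = (\<lambda>x \<in> carrier H.
     THE z. z \<in> carrier H \<and> (\<forall>y \<in> carrier H. ip H (T y) x = ip H y z))"

definition bounded_operators :: "'h inner_space \<Rightarrow> ('h \<Rightarrow> 'h) normed_star_algebra" where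
  "bounded_operators H =
    \<lparr>carrier = {T \<in> module_hom class_ring H H \<inter> extensional (carrier H).
                  \<exists>C. \<forall>x \<in> carrier H. hnorm H (T x) \<le> C * hnorm H x},
     mult = (\<lambda>S T. \<lambda>x \<in> carrier H. S (T x)),
     one = (\<lambda>x \<in> carrier H. x),
     zero = (\<lambda>x \<in> carrier H. \<zero>\<^bsub>H\<^esub>),
     add = (\<lambda>S T. \<lambda>x \<in> carrier H. S x \<oplus>\<^bsub>H\<^esub> T x),
     smult = (\<lambda>c T. \<lambda>x \<in> carrier H. c \<odot>\<^bsub>H\<^esub> T x),
     star = adjoint_op H,
     anorm = (\<lambda>T. SUP x \<in> {x \<in> carrier H. hnorm H x \<le> 1}. hnorm H (T x))\<rparr>"


section \<open>Residual finite dimensionality\<close>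

text \<open>Representations are *-homomorphisms and need not be unital.\<close>

definition representation ::
  "'a normed_star_algebra \<Rightarrow> 'h inner_space \<Rightarrow> ('a \<Rightarrow> 'h \<Rightarrow> 'h) \<Rightarrow> bool" where
  "representation A H \<pi> \<longleftrightarrow> hilbert_space H \<and> \<pi> \<in> star_hom A (bounded_operators H)"

text \<open>
  The underlying vectors of the finite dimensional Hilbert spaces are taken from
  \<^typ>\<open>complex vec\<close>, which contains a copy of each of them.
\<close>

definition residually_finite_dimensional :: "'a normed_star_algebra \<Rightarrow> bool" where
  "residually_finite_dimensional A \<longleftrightarrow>
     (\<forall>a \<in> carrier A. a \<noteq> \<zero>\<^bsub>A\<^esub> \<longrightarrow>
        (\<exists>(H :: complex vec inner_space) \<pi>.
           representation A H \<pi> \<and> vectorspace.fin_dim class_ring H \<and>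
           \<pi> a \<noteq> \<zero>\<^bsub>bounded_operators H\<^esub>))"

end

theory Submission
  imports Defs "HOL-Real_Asymp.Real_Asymp"
begin

text \<open>
  A positive functional \<open>\<Phi>\<close> with \<open>\<Phi> (a* a) > 0\<close> gives a semi-inner product \<open>\<langle>x, y\<rangle> = \<Phi> (y* x)\<close> on which the
  algebra acts by left multiplication. The unitaries \<open>u\<^sub>n = v\<^sup>-\<^sup>n u v\<^sup>n\<close> satisfy \<open>u\<^sub>n\<^sub>+\<^sub>1 = w u\<^sub>n\<close> with \<open>w\<close> unitary
  and \<open>\<parallel>w - 1\<parallel> \<le> \<epsilon>\<close>. Such a \<open>w\<close> can be compressed to a finite dimensional space as a unitary, with
  prescribed values where these lie in the space and without increasing \<open>\<parallel>w - 1\<parallel>\<close>, by means of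
  the Cayley transform. Hence \<open>u\<^sub>0, \<dots>, u\<^sub>M\<close> have compressions whose consecutive distances are
  at most \<open>\<epsilon>\<close>. Running through them forwards and backwards yields a periodic sequence; its direct sum and
  the cyclic shift are matrices satisfying the relation with exactly the same \<open>\<epsilon>\<close>, so the universal
  property turns them into a representation of the algebra. Spreading a vector \<open>x\<close> over the conjugates
  \<open>v\<^sup>-\<^sup>n x\<close>, \<open>n < M\<close>, intertwines it with the left multiplication up to an error of order \<open>1 / sqrt M\<close>, and in the
  limit these representations do not vanish on \<open>a\<close>.
\<close>

text \<open>The relation is an inequality with a fixed \<open>\<epsilon>\<close>: matrices that
  violate it, by however little, are not the images of \<open>u\<close> and \<open>v\<close> under
  any homomorphism. Compressing \<open>u\<close> and \<open>v\<close> independently would lose the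
  bound. Here only \<open>u\<close> is compressed, along its conjugates, while \<open>v\<close>
  becomes a shift; block by block the commutator is then a difference of consecutive compressions
  and is bounded without loss. All error is moved into the intertwining of \<open>v\<close>, where
  it is harmless: it vanishes in the limit, while a vector in the chosen finite set keeps its exact
  seminorm. Returning along the same unitaries avoids any comparison of the last one with the first.
  The Cayley transform enters because a compression of a unitary is in general not unitary, whereas
  a compression of a self-adjoint element is self-adjoint. Two devices connect algebras on carriers
  with the general theory: positivity and Hahn-Banach are developed for a type class and reach
  \<open>A\<close> through the product of all C*-algebras on its type; matrix algebras reach the
  universal property by transport to the type \<open>'d\<close>.\<close>

section \<open>Positivity in C*-algebras\<close>

text \<open>Nothing forces the unit to have norm 1 or to differ from 0: on a one-element type the
  product of all C*-algebras is the zero algebra, and it has to be an instance as well.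
  \<open>monoid_mult\<close> supplies the unit and the powers.\<close>

class cstar_algebra = banach + real_normed_algebra + monoid_mult +
  fixes scaleC :: "complex \<Rightarrow> 'a \<Rightarrow> 'a" (infixr "*\<^sub>C" 75)
    and adj :: "'a \<Rightarrow> 'a"
  assumes scaleC_add_right: "c *\<^sub>C (x + y) = c *\<^sub>C x + c *\<^sub>C y"
    and scaleC_add_left: "(c + d) *\<^sub>C x = c *\<^sub>C x + d *\<^sub>C x"
    and scaleC_scaleC: "c *\<^sub>C d *\<^sub>C x = (c * d) *\<^sub>C x"
    and scaleR_scaleC: "r *\<^sub>R x = complex_of_real r *\<^sub>C x"
    and mult_scaleC_left: "(c *\<^sub>C x) * y = c *\<^sub>C (x * y)"
    and mult_scaleC_right: "x * (c *\<^sub>C y) = c *\<^sub>C (x * y)"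
    and adj_adj [simp]: "adj (adj x) = x"
    and adj_add: "adj (x + y) = adj x + adj y"
    and adj_scaleC: "adj (c *\<^sub>C x) = cnj c *\<^sub>C adj x"
    and adj_mult: "adj (x * y) = adj y * adj x"
    and norm_adj_mult_self: "norm (adj x * x) = (norm x)\<^sup>2"

lemma scaleC_one [simp]: "1 *\<^sub>C x = (x::'a::cstar_algebra)"
  using scaleR_scaleC[of 1 x] by simp

lemma scaleC_zero_left [simp]: "0 *\<^sub>C x = 0"
  using scaleR_scaleC[of 0 x] by simp

lemma scaleC_zero_right [simp]: "c *\<^sub>C 0 = 0"
  using scaleC_add_right[of c 0 0] by simp

lemma scaleC_minus_right: "c *\<^sub>C (- x) = - (c *\<^sub>C x)"
  using scaleC_add_right[of c x "- x"] by (simp add: eq_neg_iff_add_eq_0 add.commute)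

lemma scaleC_minus_left: "(- c) *\<^sub>C x = - (c *\<^sub>C x)"
  using scaleC_add_left[of c "- c" x] by (simp add: eq_neg_iff_add_eq_0 add.commute)

lemma scaleC_diff_right: "c *\<^sub>C (x - y) = c *\<^sub>C x - c *\<^sub>C y"
  using scaleC_add_right[of c x "- y"] by (simp add: scaleC_minus_right)

lemma scaleC_scaleR: "c *\<^sub>C r *\<^sub>R x = r *\<^sub>R c *\<^sub>C x"
  by (simp add: scaleR_scaleC scaleC_scaleC mult.commute)

lemma adj_zero [simp]: "adj 0 = 0"
  using adj_scaleC[of 0 0] by simp

lemma adj_minus: "adj (- x) = - adj x"
  using adj_scaleC[of "-1" x] by (simp add: scaleC_minus_left)

lemma adj_diff: "adj (x - y) = adj x - adj y"
  using adj_add[of x "- y"] by (simp add: adj_minus)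

lemma adj_scaleR: "adj (r *\<^sub>R x) = r *\<^sub>R adj x"
  by (simp add: scaleR_scaleC adj_scaleC)

lemma adj_one [simp]: "adj 1 = (1::'a::cstar_algebra)"
proof -
  have "adj (adj 1 * 1) = adj 1 * adj (adj (1::'a))" by (rule adj_mult)
  then show ?thesis by simp
qed

lemma adj_power: "adj (x ^ n) = adj x ^ n"
  by (induction n) (simp_all add: adj_mult power_commutes)

text \<open>The C*-identity and submultiplicativity bound norm(y)^2 by norm(adj y) * norm(y); this
  is used for \<open>x\<close> and for \<open>adj x\<close>.\<close>

lemma norm_adj [simp]: "norm (adj x) = norm x"
proof -
  have le: "norm y \<le> norm (adj y)" for y
  proof (cases "norm y = 0")
    case False
    have "norm y * norm y \<le> norm (adj y) * norm y"
      using norm_adj_mult_self[of y] norm_mult_ineq[of "adj y" y] by (simp add: power2_eq_square)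
    then show ?thesis using False by simp
  qed simp
  show ?thesis using le[of x] le[of "adj x"] by simp
qed

lemma norm_one_le: "norm (1::'a::cstar_algebra) \<le> 1"
proof -
  have "(1::'a) = 0 \<or> norm (1::'a) = 1"
    using norm_adj_mult_self[of "1::'a"] by (simp add: power2_eq_square)
  then show ?thesis by (elim disjE) simp_all
qed

lemma norm_scaleR_one_le: "t \<ge> 0 \<Longrightarrow> norm (t *\<^sub>R (1::'a::cstar_algebra)) \<le> t"
  using norm_one_le[where 'a='a] mult_left_mono[of "norm (1::'a)" 1 t] by simp

lemma norm_power_le_one:
  fixes x :: "'a::cstar_algebra"
  assumes "norm x \<le> 1"
  shows "norm (x ^ n) \<le> 1"
proof (induction n)
  case (Suc n)
  have "norm (x ^ Suc n) \<le> norm x * norm (x ^ n)" by (simp add: norm_mult_ineq)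
  also have "\<dots> \<le> 1" using Suc assms by (simp add: mult_le_one)
  finally show ?case .
qed (simp add: norm_one_le)

section \<open>Self-adjoint elements and the norms of their powers\<close>

definition sa :: "'a::cstar_algebra \<Rightarrow> bool" where "sa x \<longleftrightarrow> adj x = x"

lemma sa_intros:
  "sa 0" "sa 1" "sa x \<Longrightarrow> sa y \<Longrightarrow> sa (x + y)" "sa x \<Longrightarrow> sa y \<Longrightarrow> sa (x - y)" "sa x \<Longrightarrow> sa (- x)"
  "sa x \<Longrightarrow> sa (r *\<^sub>R x)" "sa (adj z * z)" "sa (z * adj z)" "sa (z + adj z)"
  "sa x \<Longrightarrow> sa (x * x)" "sa x \<Longrightarrow> sa y \<Longrightarrow> x * y = y * x \<Longrightarrow> sa (x * y)" "sa x \<Longrightarrow> sa (x ^ n)"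
  by (simp_all add: sa_def adj_add adj_diff adj_minus adj_scaleR adj_mult adj_power add.commute)

lemma sa_norm_square: "sa x \<Longrightarrow> norm (x * x) = (norm x)\<^sup>2"
  using norm_adj_mult_self[of x] by (simp add: sa_def)

text \<open>For self-adjoint elements the C*-identity computes the norm of a square exactly;
  repeated squaring reaches the exponents 2^m.\<close>

lemma sa_norm_power2_power: "sa x \<Longrightarrow> norm (x ^ (2 ^ m)) = norm x ^ (2 ^ m)"
proof (induction m)
  case (Suc m)
  have "x ^ (2 ^ Suc m) = x ^ (2 ^ m) * x ^ (2 ^ m)"
    by (simp add: mult_2 power_add)
  then show ?case
    using Suc by (simp add: sa_norm_square sa_intros power2_eq_square mult_2 power_add)
qed simp

text \<open>For self-adjoint elements the C*-identity turns linear growth of the powers into contractivity.\<close>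

lemma sa_norm_le_one:
  assumes g: "sa g" and bound: "\<And>n. norm (g ^ n) \<le> 1 + real n * C"
  shows "norm g \<le> 1"
proof (rule ccontr)
  assume "\<not> norm g \<le> 1"
  define \<rho> where "\<rho> = norm g"
  have \<rho>: "\<rho> > 1" using \<open>\<not> norm g \<le> 1\<close> by (simp add: \<rho>_def)
  have "((\<lambda>n. (1 + real n * C) / \<rho> ^ n) \<longlongrightarrow> 0) sequentially"
    using \<rho> by real_asymp
  \<comment> \<open>Only exponents of the form 2^m are usable: there the norm of the power of
    \<open>g\<close> equals the power of \<open>\<rho>\<close> exactly.\<close>
  moreover have "filterlim (\<lambda>m::nat. 2 ^ m :: nat) sequentially sequentially"
    by (intro filterlim_subseq strict_monoI) simp
  ultimately have "((\<lambda>m::nat. (1 + real (2 ^ m) * C) / \<rho> ^ (2 ^ m)) \<longlongrightarrow> 0) sequentially"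
    by (rule filterlim_compose)
  then have "eventually (\<lambda>m::nat. (1 + real (2 ^ m) * C) / \<rho> ^ (2 ^ m) < 1) sequentially"
    by (rule order_tendstoD) simp
  then obtain m :: nat where "(1 + real (2 ^ m) * C) / \<rho> ^ (2 ^ m) < 1"
    by (auto simp: eventually_sequentially)
  then have "1 + real (2 ^ m) * C < \<rho> ^ (2 ^ m)" using \<rho> by (simp add: divide_less_eq)
  then show False
    using bound[of "2 ^ m"] sa_norm_power2_power[OF g, of m] by (simp add: \<rho>_def)
qed

text \<open>For self-adjoint \<open>h\<close> the norm is the spectral radius, so norm(t - h) <= t
  puts the spectrum into [0, 2t]. This expresses a nonnegative spectrum by norms alone.\<close>

definition pos :: "'a::cstar_algebra \<Rightarrow> bool" where
  "pos h \<longleftrightarrow> sa h \<and> (\<exists>t\<ge>0. norm (t *\<^sub>R 1 - h) \<le> t)"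

lemma posI: "sa h \<Longrightarrow> t \<ge> 0 \<Longrightarrow> norm (t *\<^sub>R 1 - h) \<le> t \<Longrightarrow> pos h"
  by (auto simp: pos_def)

lemma pos_sa: "pos h \<Longrightarrow> sa h" by (simp add: pos_def)

lemma norm_diff_mono:
  fixes h :: "'a::cstar_algebra"
  assumes "norm (t *\<^sub>R 1 - h) \<le> t" "t \<le> s"
  shows "norm (s *\<^sub>R 1 - h) \<le> s"
proof -
  have eq: "s *\<^sub>R 1 - h = (s - t) *\<^sub>R 1 + (t *\<^sub>R 1 - h)" by (simp add: scaleR_diff_left)
  have "norm (s *\<^sub>R 1 - h) \<le> norm ((s - t) *\<^sub>R (1::'a)) + norm (t *\<^sub>R 1 - h)"
    unfolding eq by (rule norm_triangle_ineq)
  moreover have "norm ((s - t) *\<^sub>R (1::'a)) \<le> s - t"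
    by (rule norm_scaleR_one_le) (use assms in simp)
  ultimately show ?thesis using assms by linarith
qed

text \<open>By \<open>norm_diff_mono\<close> the parameter in \<open>pos\<close> can be increased,
  so it may be taken nonzero and shared by several elements.\<close>

lemma posE:
  assumes "pos h"
  obtains t where "t > 0" "\<And>s. s \<ge> t \<Longrightarrow> norm (s *\<^sub>R 1 - h) \<le> s"
proof -
  obtain t where "t \<ge> 0" "norm (t *\<^sub>R 1 - h) \<le> t" using assms by (auto simp: pos_def)
  then show thesis using norm_diff_mono[of t h] by (intro that[of "t + 1"]) auto
qed

lemma pos_add: assumes "pos h" "pos k" shows "pos (h + k)"
proof -
  obtain s t where *: "s \<ge> 0" "norm (s *\<^sub>R 1 - h) \<le> s" "t \<ge> 0" "norm (t *\<^sub>R 1 - k) \<le> t"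
    using assms by (auto simp: pos_def)
  have eq: "(s + t) *\<^sub>R 1 - (h + k) = (s *\<^sub>R 1 - h) + (t *\<^sub>R 1 - k)" by (simp add: scaleR_add_left)
  have "norm ((s + t) *\<^sub>R 1 - (h + k)) \<le> s + t"
    unfolding eq using norm_triangle_ineq[of "s *\<^sub>R 1 - h" "t *\<^sub>R 1 - k"] * by linarith
  then show ?thesis
    using assms * by (intro posI[of _ "s + t"]) (simp_all add: sa_intros pos_sa)
qed

lemma pos_scaleR: assumes "pos h" "r \<ge> 0" shows "pos (r *\<^sub>R h)"
proof -
  obtain t where *: "t \<ge> 0" "norm (t *\<^sub>R 1 - h) \<le> t"
    using assms by (auto simp: pos_def)
  have "(r * t) *\<^sub>R 1 - r *\<^sub>R h = r *\<^sub>R (t *\<^sub>R 1 - h)" by (simp add: scaleR_diff_right)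
  then have "norm ((r * t) *\<^sub>R 1 - r *\<^sub>R h) \<le> r * t"
    using * assms(2) by (simp add: mult_left_mono)
  then show ?thesis
    using assms * by (intro posI[of _ "r * t"]) (simp_all add: sa_intros pos_sa)
qed

lemma pos_diff_of_norm_le: "sa h \<Longrightarrow> norm h \<le> t \<Longrightarrow> pos (t *\<^sub>R 1 - h)"
  by (rule posI[of _ t]) (auto simp: sa_intros intro: order_trans[OF norm_ge_zero])

text \<open>The iteration converges since its increments are dominated by those of the scalar one for \<open>k = 1\<close>.\<close>

lemma square_root_iteration:
  assumes k: "sa k" "norm k \<le> 1"
  shows "\<exists>y. sa y \<and> norm y \<le> 1 \<and> y = (1/2) *\<^sub>R (k + y * y) \<and> (\<forall>z. z * k = k * z \<longrightarrow> z * y = y * z)"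
proof -
  define y where "y = rec_nat 0 (\<lambda>_ y. (1/2) *\<^sub>R (k + y * y))"
  have y0: "y 0 = 0" and ySuc: "y (Suc n) = (1/2) *\<^sub>R (k + y n * y n)" for n
    by (simp_all add: y_def)
  define z :: "nat \<Rightarrow> real" where "z = rec_nat 0 (\<lambda>_ z. (1/2) * (1 + z * z))"
  have z0: "z 0 = 0" and zSuc: "z (Suc n) = (1/2) * (1 + z n * z n)" for n
    by (simp_all add: z_def)
  have z01: "0 \<le> z n \<and> z n \<le> 1" for n
    by (induction n) (auto simp: z0 zSuc intro: mult_le_one)
  have zinc: "z n \<le> z (Suc n)" for n
  proof -
    have "0 \<le> (1 - z n) * (1 - z n)" by simp
    then show ?thesis by (simp add: zSuc algebra_simps)
  qed
  have ynorm: "norm (y n) \<le> z n" for n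
  proof (induction n)
    case (Suc n)
    have "norm (y n * y n) \<le> z n * z n"
      using norm_mult_ineq[of "y n" "y n"] mult_mono[OF Suc Suc] z01[of n] by auto
    then show ?case
      using norm_triangle_ineq[of k "y n * y n"] k(2) by (simp add: ySuc zSuc)
  qed (simp add: y0 z0)
  have step: "norm (y (Suc n) - y n) \<le> z (Suc n) - z n" for n
  proof (induction n)
    case 0
    show ?case using k(2) by (simp add: y0 z0 ySuc zSuc)
  next
    case (Suc n)
    let ?a = "y (Suc n)" and ?b = "y n" and ?c = "z (Suc n)" and ?d = "z n"
    have "y (Suc (Suc n)) - ?a = (1/2) *\<^sub>R (k + ?a * ?a) - (1/2) *\<^sub>R (k + ?b * ?b)"
      by (simp only: ySuc)
    also have "\<dots> = (1/2) *\<^sub>R (?a * ?a - ?b * ?b)"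
      by (simp add: scaleR_add_right scaleR_diff_right)
    also have "?a * ?a - ?b * ?b = ?a * (?a - ?b) + (?a - ?b) * ?b"
      by (simp add: algebra_simps)
    finally have "norm (y (Suc (Suc n)) - ?a) \<le> (1/2) * (norm (?a * (?a - ?b)) + norm ((?a - ?b) * ?b))"
      using norm_triangle_ineq[of "?a * (?a - ?b)" "(?a - ?b) * ?b"] by simp
    also have "norm (?a * (?a - ?b)) \<le> ?c * (?c - ?d)"
      using norm_mult_ineq[of ?a "?a - ?b"] mult_mono[OF ynorm[of "Suc n"] Suc] z01[of "Suc n"] by auto
    also have "norm ((?a - ?b) * ?b) \<le> (?c - ?d) * ?d"
      using norm_mult_ineq[of "?a - ?b" ?b] mult_mono[OF Suc ynorm[of n]] zinc[of n] by auto
    also have "1/2 * (?c * (?c - ?d) + (?c - ?d) * ?d) = (1/2) * (1 + ?c * ?c) - (1/2) * (1 + ?d * ?d)"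
      by (simp add: algebra_simps)
    also have "\<dots> = z (Suc (Suc n)) - ?c"
      by (simp only: zSuc)
    finally show ?case by simp
  qed
  have "convergent z"
    by (rule Bseq_monoseq_convergent)
       (use z01 zinc in \<open>auto simp: monoseq_Suc intro!: BseqI'[of z 1]\<close>)
  then have "summable (\<lambda>n. z (Suc n) - z n)"
    using telescope_summable by (auto simp: convergent_def)
  then have "summable (\<lambda>n. y (Suc n) - y n)"
    by (rule summable_comparison_test') (rule step)
  then have "convergent y"
    unfolding summable_iff_convergent by (simp add: sum_lessThan_telescope y0)
  then obtain w where w: "y \<longlonglongrightarrow> w" by (auto simp: convergent_def)
  have ysa: "sa (y n)" for n
    by (induction n) (simp_all add: y0 ySuc sa_intros k)
  have "sa w"
  proof -
    have "(\<lambda>n. adj (y n) - adj w) \<longlonglongrightarrow> 0"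
      by (rule tendsto_norm_zero_cancel)
         (use w in \<open>simp add: adj_diff[symmetric] LIM_zero_iff tendsto_norm_zero_iff\<close>)
    then have "y \<longlonglongrightarrow> adj w" using ysa by (simp add: sa_def LIM_zero_iff)
    then show ?thesis using w LIMSEQ_unique by (auto simp: sa_def)
  qed
  moreover have "norm w \<le> 1"
    by (rule LIMSEQ_le_const2[OF tendsto_norm[OF w]]) (use ynorm z01 in \<open>auto intro: order_trans\<close>)
  moreover have "w = (1/2) *\<^sub>R (k + w * w)"
  proof (rule LIMSEQ_unique)
    show "(\<lambda>n. y (Suc n)) \<longlonglongrightarrow> w" using w by (rule LIMSEQ_Suc)
    show "(\<lambda>n. y (Suc n)) \<longlonglongrightarrow> (1/2) *\<^sub>R (k + w * w)"
      unfolding ySuc by (intro tendsto_intros w)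
  qed
  moreover have "v * w = w * v" if v: "v * k = k * v" for v
  proof (rule LIMSEQ_unique)
    have "v * y n = y n * v" for n
    proof (induction n)
      case (Suc n)
      have "v * (y n * y n) = y n * y n * v" using Suc by (metis mult.assoc)
      then show ?case by (simp add: ySuc ring_distribs v)
    qed (simp add: y0)
    then show "(\<lambda>n. v * y n) \<longlonglongrightarrow> w * v" by (auto intro!: tendsto_intros w)
    show "(\<lambda>n. v * y n) \<longlonglongrightarrow> v * w" by (intro tendsto_intros w)
  qed
  ultimately show ?thesis by blast
qed

text \<open>After normalising to k = 1 - h/t, which has norm at most 1, the fixed point of the
  iteration satisfies 2y = k + y^2, that is (1 - y)^2 = h/t. So sqrt(t) (1 - y) is a root; it is
  positive because norm(y) <= 1. The commutation clause replaces the statement that the root is a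
  limit of polynomials in \<open>h\<close>.\<close>

lemma pos_sqrt:
  assumes "pos h"
  obtains r where "pos r" "r * r = h" "\<And>z. z * h = h * z \<Longrightarrow> z * r = r * z"
proof -
  obtain t where t: "t > 0" "norm (t *\<^sub>R 1 - h) \<le> t" using posE[OF assms] by (metis order_refl)
  define k where "k = 1 - (1/t) *\<^sub>R h"
  have "t *\<^sub>R k = t *\<^sub>R 1 - h" using t by (simp add: k_def scaleR_diff_right)
  then have "t * norm k \<le> t" using t by (metis norm_scaleR abs_of_pos)
  then have k: "sa k" "norm k \<le> 1" using t assms by (simp_all add: k_def sa_intros pos_sa)
  obtain y where y: "sa y" "norm y \<le> 1" "y = (1/2) *\<^sub>R (k + y * y)"
    and comm: "\<And>z. z * k = k * z \<Longrightarrow> z * y = y * z"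
    using square_root_iteration[OF k] by blast
  show thesis
  proof
    show "pos (sqrt t *\<^sub>R (1 - y))"
      by (rule pos_scaleR[OF posI[of _ 1]]) (use y t in \<open>simp_all add: sa_intros\<close>)
    have "y + y = k + y * y" using arg_cong[OF y(3), of "scaleR 2"] by (simp add: scaleR_2)
    then have "(1 - y) * (1 - y) = (1/t) *\<^sub>R h" by (simp add: k_def algebra_simps)
    then show "sqrt t *\<^sub>R (1 - y) * sqrt t *\<^sub>R (1 - y) = h" using t by simp
    show "z * sqrt t *\<^sub>R (1 - y) = sqrt t *\<^sub>R (1 - y) * z" if "z * h = h * z" for z
      using comm[of z] that by (simp add: k_def algebra_simps)
  qed
qed

text \<open>If \<open>g\<^sup>2 + h\<^sup>2 = t\<close> with \<open>g\<close>, \<open>h\<close> commuting, then \<open>h + \<i>g\<close> is \<open>sqrt t\<close> times a unitary.\<close>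

lemma norm_le_of_sum_squares:
  fixes h g :: "'a::cstar_algebra"
  assumes h: "sa h" and g: "sa g" and comm: "h * g = g * h"
    and sum: "h * h + g * g = t *\<^sub>R 1" and t: "t \<ge> 0"
  shows "norm h \<le> sqrt t"
proof -
  define u where "u = h + \<i> *\<^sub>C g"
  have adju: "adj u = h - \<i> *\<^sub>C g"
    using h g by (simp add: u_def sa_def adj_add adj_scaleC scaleC_minus_left)
  have "adj u * u = h * h + g * g"
    unfolding adju unfolding u_def
    by (simp add: algebra_simps mult_scaleC_left mult_scaleC_right scaleC_scaleC comm scaleC_minus_left
        scaleC_diff_right scaleC_add_right)
  then have "(norm u)\<^sup>2 = norm (t *\<^sub>R (1::'a))"
    by (simp only: norm_adj_mult_self[symmetric] sum)
  then have "(norm u)\<^sup>2 \<le> t"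
    using norm_scaleR_one_le[OF t, where 'a='a] by linarith
  then have nu: "norm u \<le> sqrt t" by (simp add: real_le_rsqrt)
  have "h = (1/2) *\<^sub>R (u + adj u)" unfolding adju unfolding u_def by (simp add: scaleR_2[symmetric])
  then have "norm h = norm ((1/2) *\<^sub>R (u + adj u))" by simp
  then show ?thesis using norm_triangle_ineq[of u "adj u"] nu by simp
qed

text \<open>For t = norm(h)^2 the element t - h^2 has a root \<open>g\<close> commuting with
  \<open>h\<close>, and g^2 + h^2 = t bounds norm(g^2) by \<open>t\<close>. Since g^2 = t - h^2,
  this is the norm condition in \<open>pos\<close>.\<close>

lemma pos_square:
  assumes h: "sa h"
  shows "pos (h * h)"
proof -
  define t where "t = (norm h)\<^sup>2"
  have t: "t \<ge> 0" by (simp add: t_def)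
  have "pos (t *\<^sub>R 1 - h * h)"
    by (rule pos_diff_of_norm_le) (simp_all add: h sa_intros sa_norm_square t_def)
  then obtain g where g: "pos g" "g * g = t *\<^sub>R 1 - h * h"
    and comm: "\<And>z. z * (t *\<^sub>R 1 - h * h) = (t *\<^sub>R 1 - h * h) * z \<Longrightarrow> z * g = g * z"
    using pos_sqrt by blast
  have "h * g = g * h" by (rule comm) (simp add: algebra_simps)
  then have "norm g \<le> sqrt t"
    by (intro norm_le_of_sum_squares[of g h]) (use g h t in \<open>simp_all add: pos_sa\<close>)
  then have "norm (g * g) \<le> t"
    using g(1) t by (simp add: sa_norm_square pos_sa) (metis norm_ge_zero power_mono real_sqrt_pow2)
  then show ?thesis using g h t by (intro posI[of _ t]) (simp_all add: sa_intros)
qed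

text \<open>The square roots of \<open>p\<close> and \<open>q\<close> commute with each other, and
  \<open>k\<close> is their product. The last clause is kept because \<open>k\<close> must later
  commute with a third element.\<close>

lemma pos_commuting_product:
  assumes p: "pos p" and q: "pos q" and comm: "p * q = q * p"
  shows "\<exists>k. sa k \<and> k * k = p * q \<and> (\<forall>z. z * p = p * z \<longrightarrow> z * q = q * z \<longrightarrow> z * k = k * z)"
proof -
  obtain r where r: "pos r" "r * r = p" "\<And>z. z * p = p * z \<Longrightarrow> z * r = r * z"
    using pos_sqrt[OF p] by blast
  obtain s where s: "pos s" "s * s = q" "\<And>z. z * q = q * z \<Longrightarrow> z * s = s * z"
    using pos_sqrt[OF q] by blast
  have "q * r = r * q" by (rule r(3)) (simp add: comm)
  then have rs: "r * s = s * r" by (intro s(3)) simp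
  have "sa (r * s)" using r(1) s(1) rs by (simp add: sa_intros pos_sa)
  moreover have "r * s * (r * s) = p * q"
  proof -
    have "r * s * (r * s) = r * (s * r) * s" by (simp add: mult.assoc)
    also have "\<dots> = (r * r) * (s * s)" by (simp add: rs[symmetric] mult.assoc)
    finally show ?thesis by (simp only: r(2) s(2))
  qed
  moreover have "\<forall>z. z * p = p * z \<longrightarrow> z * q = q * z \<longrightarrow> z * (r * s) = r * s * z"
  proof (intro allI impI)
    fix z assume z: "z * p = p * z" "z * q = q * z"
    have "z * (r * s) = (z * r) * s" by (simp add: mult.assoc)
    also have "\<dots> = r * (z * s)" by (simp add: r(3)[OF z(1)] mult.assoc)
    also have "\<dots> = r * s * z" by (simp add: s(3)[OF z(2)] mult.assoc)
    finally show "z * (r * s) = r * s * z" .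
  qed
  ultimately show ?thesis by blast
qed

lemma pos_mult_commute:
  assumes "pos p" "pos q" "p * q = q * p"
  shows "pos (p * q)"
proof -
  obtain k where "sa k" "k * k = p * q" using pos_commuting_product[OF assms] by blast
  then show ?thesis using pos_square[of k] by simp
qed

text \<open>With \<open>\<delta>\<close> = N - s the two norm bounds say that
  \<open>\<delta>\<close> - g and \<open>\<delta>\<close> + g are positive. Their product is then a
  square k^2, and g^2 + k^2 is the square of \<open>\<delta>\<close>. In spectral terms: both ends
  of the spectrum of \<open>g\<close> are controlled.\<close>

lemma sa_norm_le_of_shifts:
  assumes g: "sa g" and n1: "norm (s *\<^sub>R 1 + g) \<le> N" and n2: "norm (s *\<^sub>R 1 - g) \<le> N" and sN: "s \<le> N"
  shows "norm g \<le> N - s"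
proof -
  have N: "N \<ge> 0" using n1 norm_ge_zero order_trans by blast
  define \<delta> where "\<delta> = N - s"
  have "pos (\<delta> *\<^sub>R 1 - g)" "pos (\<delta> *\<^sub>R 1 + g)"
    by (rule posI[of _ N]; use n1 n2 N g in \<open>simp add: \<delta>_def sa_intros algebra_simps del: scaleR_one\<close>)+
  moreover have "(\<delta> *\<^sub>R 1 - g) * (\<delta> *\<^sub>R 1 + g) = (\<delta> *\<^sub>R 1 + g) * (\<delta> *\<^sub>R 1 - g)"
    by (simp add: algebra_simps)
  ultimately obtain k where k: "sa k" "k * k = (\<delta> *\<^sub>R 1 - g) * (\<delta> *\<^sub>R 1 + g)"
    "\<And>z. z * (\<delta> *\<^sub>R 1 - g) = (\<delta> *\<^sub>R 1 - g) * z \<Longrightarrow> z * (\<delta> *\<^sub>R 1 + g) = (\<delta> *\<^sub>R 1 + g) * z \<Longrightarrow> z * k = k * z"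
    using pos_commuting_product by blast
  have "g * k = k * g" by (rule k(3)) (simp_all add: algebra_simps)
  moreover have "g * g + k * k = \<delta>\<^sup>2 *\<^sub>R 1" by (simp add: k(2) algebra_simps power2_eq_square)
  ultimately have "norm g \<le> sqrt (\<delta>\<^sup>2)" using g k(1) by (intro norm_le_of_sum_squares[of g k]) simp_all
  then show ?thesis using sN by (simp add: \<delta>_def)
qed

text \<open>A common large parameter \<open>t\<close> serves for \<open>h\<close> and for
  \<open>- h\<close>; \<open>sa_norm_le_of_shifts\<close> with s = N = t leaves norm(h) <=
  0.\<close>

lemma pos_antisym:
  assumes "pos h" "pos (- h)"
  shows "h = 0"
proof -
  obtain s where s: "\<And>t. t \<ge> s \<Longrightarrow> norm (t *\<^sub>R 1 - h) \<le> t" using posE[OF assms(1)] by metis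
  obtain s' where s': "\<And>t. t \<ge> s' \<Longrightarrow> norm (t *\<^sub>R 1 - (- h)) \<le> t" using posE[OF assms(2)] by metis
  define t where "t = max s s'"
  have "norm h \<le> t - t"
    using s[of t] s'[of t] assms(1)
    by (intro sa_norm_le_of_shifts) (simp_all add: pos_sa t_def)
  then show ?thesis by simp
qed

text \<open>
  With \<open>p = m + c\<close>, \<open>q = m - c\<close> we have \<open>p * q = 0\<close>, so \<open>p * (1 - p / t) ^ n = p * (1 - (p + q) / t) ^ n\<close>
  stays bounded, and \<open>(1 - p / t) ^ n\<close> grows at most linearly.
\<close>

lemma pos_abs_add:
  assumes m: "pos m" and c: "sa c" and comm: "m * c = c * m" and sq: "m * m = c * c"
  shows "pos (m + c)"
proof -
  obtain t where t: "t > 0" "norm (t *\<^sub>R 1 - 2 *\<^sub>R m) \<le> t"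
    using posE[OF pos_scaleR[OF m, of 2]] by (metis order_refl zero_le_numeral)
  define p where "p = m + c"
  define P where "P = 1 - (1/t) *\<^sub>R p"
  define M where "M = 1 - (2/t) *\<^sub>R m"
  have p: "sa p" using m c by (simp add: p_def sa_intros pos_sa)
  have "t *\<^sub>R M = t *\<^sub>R 1 - 2 *\<^sub>R m" using t by (simp add: M_def scaleR_diff_right)
  then have "t * norm M \<le> t" using t by (metis norm_scaleR abs_of_pos)
  then have M: "norm M \<le> 1" using t by simp
  \<comment> \<open>This is p q = 0 in disguise, since 2m = p + q.\<close>
  have "p * p = 2 *\<^sub>R (p * m)"
    by (simp add: p_def algebra_simps comm sq scaleR_2)
  then have pP: "p * P = p * M" by (simp add: P_def M_def algebra_simps)
  have pM: "p * M = M * p" by (simp add: p_def M_def algebra_simps comm)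
  have pPn: "p * P ^ n = p * M ^ n" for n
  proof (induction n)
    case (Suc n)
    have "p * P ^ Suc n = M * (p * P ^ n)" by (simp add: mult.assoc[symmetric] pP pM)
    also have "\<dots> = p * M ^ Suc n" by (simp add: Suc mult.assoc[symmetric] pM)
    finally show ?case .
  qed simp
  have growth: "norm (P ^ n) \<le> 1 + real n * (norm p / t)" for n
  proof (induction n)
    case (Suc n)
    have "P ^ Suc n = P ^ n - (1/t) *\<^sub>R (p * M ^ n)"
      by (simp add: pPn[symmetric]) (simp add: P_def algebra_simps)
    then have "norm (P ^ Suc n) \<le> norm (P ^ n) + norm (p * M ^ n) / t"
      using norm_triangle_ineq4[of "P ^ n" "(1/t) *\<^sub>R (p * M ^ n)"] t by simp
    moreover have "norm (p * M ^ n) \<le> norm p"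
      using norm_mult_ineq[of p "M ^ n"] mult_left_mono[OF norm_power_le_one[OF M, of n], of "norm p"]
      by simp
    then have "norm (p * M ^ n) / t \<le> norm p / t" using t by (simp add: divide_right_mono)
    ultimately show ?case using Suc by (simp add: algebra_simps add_divide_distrib)
  qed (simp add: norm_one_le)
  have "norm P \<le> 1" by (rule sa_norm_le_one[OF _ growth]) (simp add: P_def p sa_intros)
  moreover have "t *\<^sub>R 1 - p = t *\<^sub>R P" using t by (simp add: P_def scaleR_diff_right)
  ultimately have "norm (t *\<^sub>R 1 - p) \<le> t" using t by simp
  then show ?thesis using p t by (intro posI[of _ t]) (simp_all add: p_def)
qed

text \<open>Replaces the fact that y* y and y y* have the same spectrum up to 0. From y* g = G y*
  follows that the power n + 1 of \<open>g\<close> is the power n plus (1/t) y G^n y*; as norm(G) <=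
  1 the powers of \<open>g\<close> grow at most linearly, and \<open>sa_norm_le_one\<close>
  applies.\<close>

lemma neg_pos_swap:
  assumes "pos (- (adj y * y))"
  shows "pos (- (y * adj y))"
proof -
  obtain t where t: "t > 0" "norm (t *\<^sub>R 1 + adj y * y) \<le> t"
    using posE[OF assms] by (metis order_refl diff_minus_eq_add)
  define g where "g = 1 + (1/t) *\<^sub>R (y * adj y)"
  define G where "G = 1 + (1/t) *\<^sub>R (adj y * y)"
  have "t *\<^sub>R G = t *\<^sub>R 1 + adj y * y" using t by (simp add: G_def scaleR_add_right)
  then have "t * norm G \<le> t" using t by (metis norm_scaleR abs_of_pos)
  then have G: "norm G \<le> 1" using t by simp
  have yg: "adj y * g ^ n = G ^ n * adj y" for n
  proof (induction n)
    case (Suc n)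
    have "adj y * g = G * adj y" by (simp add: g_def G_def algebra_simps)
    then have "adj y * g ^ Suc n = G * (adj y * g ^ n)" by (simp add: mult.assoc[symmetric])
    then show ?case by (simp add: Suc mult.assoc)
  qed simp
  have growth: "norm (g ^ n) \<le> 1 + real n * ((norm y)\<^sup>2 / t)" for n
  proof (induction n)
    case (Suc n)
    have "g ^ Suc n = g ^ n + (1/t) *\<^sub>R (y * (G ^ n * adj y))"
      by (simp add: yg[symmetric]) (simp add: g_def algebra_simps)
    then have "norm (g ^ Suc n) \<le> norm (g ^ n) + norm (y * (G ^ n * adj y)) / t"
      using norm_triangle_ineq[of "g ^ n" "(1/t) *\<^sub>R (y * (G ^ n * adj y))"] t by simp
    moreover have "norm (y * (G ^ n * adj y)) \<le> (norm y)\<^sup>2"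
    proof -
      have "norm (G ^ n * adj y) \<le> norm y"
        using norm_mult_ineq[of "G ^ n" "adj y"] mult_right_mono[OF norm_power_le_one[OF G, of n], of "norm y"]
        by simp
      then show ?thesis
        using norm_mult_ineq[of y "G ^ n * adj y"] mult_left_mono[of "norm (G ^ n * adj y)" "norm y" "norm y"]
        by (simp add: power2_eq_square)
    qed
    then have "norm (y * (G ^ n * adj y)) / t \<le> (norm y)\<^sup>2 / t" using t by (simp add: divide_right_mono)
    ultimately show ?case using Suc by (simp add: algebra_simps add_divide_distrib)
  qed (simp add: norm_one_le)
  have "norm g \<le> 1" by (rule sa_norm_le_one[OF _ growth]) (simp add: g_def sa_intros)
  moreover have "t *\<^sub>R 1 - - (y * adj y) = t *\<^sub>R g" using t by (simp add: g_def scaleR_add_right)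
  ultimately have "norm (t *\<^sub>R 1 - - (y * adj y)) \<le> t" using t by simp
  then show ?thesis using t by (intro posI[of _ t]) (simp_all add: sa_intros)
qed

text \<open>With \<open>h\<close>, \<open>k\<close> the real part and, up to sign, the imaginary
  part of \<open>y\<close>, the sum y* y + y y* equals 2 (h^2 + k^2) and is positive. Both summands
  are negative, the second by \<open>neg_pos_swap\<close>, so the sum vanishes; then y* y is
  positive and negative at once.\<close>

lemma neg_pos_adj_mult_imp_zero:
  assumes neg: "pos (- (adj y * y))"
  shows "y = 0"
proof -
  define h where "h = (1/2) *\<^sub>R (y + adj y)"
  define k where "k = (1/2) *\<^sub>R (\<i> *\<^sub>C (y - adj y))"
  have h: "sa h" by (simp add: h_def sa_intros)
  have k: "sa k" by (simp add: k_def sa_def adj_scaleR adj_scaleC adj_diff scaleC_minus_left scaleC_diff_right)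
  have hh: "h * h = (1/4) *\<^sub>R ((y + adj y) * (y + adj y))" by (simp add: h_def)
  have kk: "k * k = - (1/4) *\<^sub>R ((y - adj y) * (y - adj y))"
    by (simp add: k_def mult_scaleC_left mult_scaleC_right scaleC_scaleC scaleC_scaleR scaleC_minus_left)
  have "2 *\<^sub>R (h * h + k * k) = (1/2) *\<^sub>R ((y + adj y) * (y + adj y) - (y - adj y) * (y - adj y))"
    by (simp add: hh kk scaleR_diff_right scaleR_add_right)
  also have "(y + adj y) * (y + adj y) - (y - adj y) * (y - adj y) = 2 *\<^sub>R (adj y * y + y * adj y)"
    by (simp add: algebra_simps scaleR_2)
  finally have sum: "2 *\<^sub>R (h * h + k * k) = adj y * y + y * adj y" by simp
  have p: "pos (adj y * y + y * adj y)"
    unfolding sum[symmetric] by (intro pos_scaleR pos_add pos_square h k) simp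
  have n: "pos (- (y * adj y))" by (rule neg_pos_swap[OF neg])
  have "pos (- (adj y * y + y * adj y))" using pos_add[OF neg n] by (simp add: add.commute)
  then have "adj y * y + y * adj y = 0" using p pos_antisym by blast
  then have "adj y * y = - (y * adj y)" by (simp add: eq_neg_iff_add_eq_0)
  then have "adj y * y = 0" using n neg pos_antisym by metis
  then show ?thesis using norm_adj_mult_self[of y] by simp
qed

text \<open>Let c = x* x, m = |c| and q = m - c, twice the negative part of \<open>c\<close>. Then
  (x q)* (x q) = q c q = - q^3 / 2 is negative, so x q = 0 by the preceding lemma. This gives c q =
  0 and q^2 = 0, whence x* x = |c|.\<close>

theorem pos_adj_mult_self: "pos (adj x * x)"
proof -
  define c where "c = adj x * x"
  have c: "sa c" by (simp add: c_def sa_intros)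
  obtain m where m: "pos m" "m * m = c * c" and comm: "\<And>z. z * (c * c) = c * c * z \<Longrightarrow> z * m = m * z"
    using pos_sqrt[OF pos_square[OF c]] by blast
  have cm: "c * m = m * c" by (rule comm) (simp add: mult.assoc)
  define q where "q = m - c"
  have q: "pos q" using pos_abs_add[of m "- c"] m c cm by (simp add: q_def sa_intros)
  then have qsa: "adj q = q" using pos_sa by (simp add: sa_def)
  have mcq: "m * q = - (c * q)" by (simp add: q_def algebra_simps cm m(2))
  have "q * q * q = q * (m * q) - q * (c * q)" by (simp add: q_def algebra_simps)
  also have "\<dots> = - (2 *\<^sub>R (q * (c * q)))" by (simp add: mcq scaleR_2)
  finally have qcq: "q * (c * q) = - (1/2) *\<^sub>R (q * q * q)" by simp
  have "adj (x * q) * (x * q) = q * (c * q)" by (simp add: adj_mult qsa c_def mult.assoc)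
  then have "- (adj (x * q) * (x * q)) = (1/2) *\<^sub>R (q * q * q)" by (simp add: qcq)
  moreover have "pos (q * q * q)"
    by (rule pos_mult_commute[OF pos_square q]) (use q in \<open>simp_all add: pos_sa mult.assoc\<close>)
  ultimately have "pos (- (adj (x * q) * (x * q)))" using pos_scaleR[of "q * q * q" "1/2"] by simp
  then have "x * q = 0" by (rule neg_pos_adj_mult_imp_zero)
  then have "c * q = 0" by (simp add: c_def mult.assoc)
  then have "q * q = 0" using mcq by (simp add: q_def algebra_simps)
  then have "q = 0" using sa_norm_square[OF pos_sa[OF q]] by simp
  then show ?thesis using m by (simp add: q_def c_def)
qed

text \<open>For large \<open>T\<close> the element T - b has norm at most \<open>T\<close>, so by
  \<open>sa_norm_le_of_shifts\<close> the growth of norm(T + b) over \<open>T\<close> is at least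
  norm(b). The triangle inequality brings this down to \<open>t\<close>. The case b = 0 is excluded
  because of the maximum in \<open>N\<close>.\<close>

lemma norm_shift_pos:
  fixes b :: "'a::cstar_algebra"
  assumes b: "pos b" and b0: "b \<noteq> 0" and t: "t \<ge> 0"
  shows "norm (t *\<^sub>R 1 + b) \<ge> t + norm b"
proof -
  obtain s where s: "\<And>r. r \<ge> s \<Longrightarrow> norm (r *\<^sub>R 1 - b) \<le> r" using posE[OF b] by metis
  define T where "T = max s t"
  define N where "N = max (norm (T *\<^sub>R 1 + b)) T"
  have "norm b \<le> N - T"
    by (rule sa_norm_le_of_shifts) (use s[of T] b in \<open>auto simp: N_def T_def pos_sa\<close>)
  then have le: "T + norm b \<le> norm (T *\<^sub>R 1 + b)" using b0 by (auto simp: N_def max_def split: if_splits)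
  have eq: "T *\<^sub>R 1 + b = (T - t) *\<^sub>R 1 + (t *\<^sub>R 1 + b)" by (simp add: scaleR_diff_left)
  have "norm ((T - t) *\<^sub>R (1::'a)) \<le> T - t" by (rule norm_scaleR_one_le) (simp add: T_def)
  then have "norm (T *\<^sub>R 1 + b) \<le> (T - t) + norm (t *\<^sub>R 1 + b)"
    unfolding eq using norm_triangle_ineq[of "(T - t) *\<^sub>R 1" "t *\<^sub>R 1 + b"] by linarith
  then show ?thesis using le by linarith
qed

section \<open>The Hahn-Banach theorem and states\<close>

definition sublinear :: "('a::real_vector \<Rightarrow> real) \<Rightarrow> bool" where
  "sublinear p \<longleftrightarrow> (\<forall>x y. p (x + y) \<le> p x + p y) \<and> (\<forall>c\<ge>0. \<forall>x. p (c *\<^sub>R x) \<le> c * p x)"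

lemma sublinear_add: "sublinear p \<Longrightarrow> p (x + y) \<le> p x + p y"
  by (simp add: sublinear_def)

lemma sublinear_scaleR:
  assumes p: "sublinear p" and c: "c > 0"
  shows "p (c *\<^sub>R x) = c * p x"
proof (rule antisym)
  show "p (c *\<^sub>R x) \<le> c * p x" using p c by (simp add: sublinear_def)
  have "p ((1/c) *\<^sub>R c *\<^sub>R x) \<le> (1/c) * p (c *\<^sub>R x)"
    using p c unfolding sublinear_def by (meson divide_nonneg_nonneg less_imp_le zero_le_one)
  then show "c * p x \<le> p (c *\<^sub>R x)" using c by (simp add: field_simps)
qed

lemma sublinear_zero: assumes "sublinear p" shows "p 0 = 0"
proof -
  have "p (0 *\<^sub>R 0) \<le> 0 * p 0" using assms unfolding sublinear_def by blast
  moreover have "p (0 + 0) \<le> p 0 + p 0" using assms by (rule sublinear_add)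
  ultimately show ?thesis by simp
qed

lemma sublinear_ge_neg: "sublinear p \<Longrightarrow> - p (- x) \<le> p x"
  using sublinear_add[of p x "- x"] sublinear_zero[of p] by simp

text \<open>The largest sublinear functional below \<open>p\<close> that takes the value \<open>- p y\<close> at \<open>- y\<close>.\<close>

lemma sublinear_tighten:
  assumes p: "sublinear p"
  shows "\<exists>q. sublinear q \<and> (\<forall>x. q x \<le> p x) \<and> q (- y) \<le> - p y"
proof -
  define q where "q = (\<lambda>x. INF t\<in>{0..}. p (x + t *\<^sub>R y) - t * p y)"
  have lower: "- p (- x) \<le> p (x + t *\<^sub>R y) - t * p y" if "t \<ge> 0" for x t
  proof -
    have "p (t *\<^sub>R y) = t * p y"
      using that p by (cases "t = 0") (simp_all add: sublinear_scaleR sublinear_zero)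
    moreover have "p ((x + t *\<^sub>R y) + - x) \<le> p (x + t *\<^sub>R y) + p (- x)" using p by (rule sublinear_add)
    ultimately show ?thesis by simp
  qed
  have bdd: "bdd_below ((\<lambda>t. p (x + t *\<^sub>R y) - t * p y) ` {0..})" for x
    using lower[of _ x] by (auto intro!: bdd_belowI2)
  have q_le: "q x \<le> p (x + t *\<^sub>R y) - t * p y" if "t \<ge> 0" for x t
    unfolding q_def by (rule cINF_lower[OF bdd]) (use that in simp)
  have q_ge: "m \<le> q x" if "\<And>t. t \<ge> 0 \<Longrightarrow> m \<le> p (x + t *\<^sub>R y) - t * p y" for m x
    unfolding q_def by (rule cINF_greatest) (use that in auto)
  have "sublinear q"
    unfolding sublinear_def
  proof (intro conjI allI impI)
    fix x x'
    have "q (x + x') - q x' \<le> q x"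
    proof (rule q_ge)
      fix t :: real assume t: "t \<ge> 0"
      have "q (x + x') - (p (x + t *\<^sub>R y) - t * p y) \<le> q x'"
      proof (rule q_ge)
        fix s :: real assume s: "s \<ge> 0"
        have "q (x + x') \<le> p ((x + t *\<^sub>R y) + (x' + s *\<^sub>R y)) - (t + s) * p y"
          using q_le[of "t + s" "x + x'"] s t by (simp add: algebra_simps)
        also have "\<dots> \<le> (p (x + t *\<^sub>R y) - t * p y) + (p (x' + s *\<^sub>R y) - s * p y)"
          using sublinear_add[OF p, of "x + t *\<^sub>R y" "x' + s *\<^sub>R y"] by (simp add: algebra_simps)
        finally show "q (x + x') - (p (x + t *\<^sub>R y) - t * p y) \<le> p (x' + s *\<^sub>R y) - s * p y" by simp
      qed
      then show "q (x + x') - q x' \<le> p (x + t *\<^sub>R y) - t * p y" by simp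
    qed
    then show "q (x + x') \<le> q x + q x'" by simp
  next
    fix c x assume c: "(c::real) \<ge> 0"
    show "q (c *\<^sub>R x) \<le> c * q x"
    proof (cases "c = 0")
      case True
      then show ?thesis using q_le[of 0 0] sublinear_zero[OF p] by simp
    next
      case False
      then have c: "c > 0" using c by simp
      have "(1/c) * q (c *\<^sub>R x) \<le> q x"
      proof (rule q_ge)
        fix t :: real assume t: "t \<ge> 0"
        have "q (c *\<^sub>R x) \<le> p (c *\<^sub>R (x + t *\<^sub>R y)) - (c * t) * p y"
          using q_le[of "c * t" "c *\<^sub>R x"] t c by (simp add: scaleR_add_right)
        also have "\<dots> = c * (p (x + t *\<^sub>R y) - t * p y)"
          by (simp add: sublinear_scaleR[OF p c] right_diff_distrib)
        finally show "(1/c) * q (c *\<^sub>R x) \<le> p (x + t *\<^sub>R y) - t * p y"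
          using c by (simp add: field_simps)
      qed
      then show ?thesis using c by (simp add: field_simps)
    qed
  qed
  moreover have "q x \<le> p x" for x using q_le[of 0 x] by simp
  moreover have "q (- y) \<le> - p y" using q_le[of 1 "- y"] sublinear_zero[OF p] by simp
  ultimately show ?thesis by blast
qed

text \<open>Zorn's lemma for the reversed order, so that a maximal element is a minimal functional.
  A chain has its pointwise infimum as bound; this is finite since every member is at least - p (-
  x) at \<open>x\<close>.\<close>

lemma sublinear_minimal_exists:
  assumes p: "sublinear p"
  shows "\<exists>f. sublinear f \<and> (\<forall>x. f x \<le> p x) \<and> (\<forall>q. sublinear q \<and> (\<forall>x. q x \<le> f x) \<longrightarrow> q = f)"
proof -
  define S where "S = {q. sublinear q \<and> q \<le> p}"
  let ?R = "\<lambda>q q' :: 'a \<Rightarrow> real. q' \<le> q"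
  have "\<exists>m\<in>S. \<forall>a\<in>S. ?R m a \<longrightarrow> a = m"
  proof (rule predicate_Zorn)
    show "partial_order_on S (relation_of ?R S)"
      by (rule partial_order_on_relation_ofI) auto
    show "\<exists>u\<in>S. \<forall>a\<in>C. u \<le> a" if C: "C \<in> Chains (relation_of ?R S)" for C
    proof (cases "C = {}")
      case True
      then show ?thesis using p by (auto simp: S_def)
    next
      case False
      have CS: "C \<subseteq> S" and lin: "\<And>q q'. q \<in> C \<Longrightarrow> q' \<in> C \<Longrightarrow> q \<le> q' \<or> q' \<le> q"
        using C by (auto simp: Chains_def relation_of_def)
      define u where "u = (\<lambda>x. INF q\<in>C. q x)"
      have bdd: "bdd_below ((\<lambda>q. q x) ` C)" for x
      proof (rule bdd_belowI2)
        fix q assume "q \<in> C"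
        then have "sublinear q" "q (- x) \<le> p (- x)" using CS by (auto simp: S_def le_fun_def)
        then show "- p (- x) \<le> q x" using sublinear_ge_neg[of q x] by simp
      qed
      have u_le: "u x \<le> q x" if "q \<in> C" for x q
        unfolding u_def by (rule cINF_lower[OF bdd that])
      have u_ge: "m \<le> u x" if "\<And>q. q \<in> C \<Longrightarrow> m \<le> q x" for m x
        unfolding u_def by (rule cINF_greatest[OF False]) (use that in auto)
      have "sublinear u"
        unfolding sublinear_def
      proof (intro conjI allI impI)
        fix x y
        have "u (x + y) - u y \<le> u x"
        proof (rule u_ge)
          fix q assume q: "q \<in> C"
          have "u (x + y) - q x \<le> u y"
          proof (rule u_ge)
            fix q' assume q': "q' \<in> C"
            \<comment> \<open>Two members of a chain are comparable, so the smaller one is below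
              \<open>q\<close> at \<open>x\<close> and below \<open>q'\<close> at
              \<open>y\<close>.\<close>
            obtain r where r: "r \<in> C" "r x \<le> q x" "r y \<le> q' y"
              using lin[OF q q'] q q' by (auto simp: le_fun_def)
            then have "sublinear r" using CS by (auto simp: S_def)
            then show "u (x + y) - q x \<le> q' y"
              using u_le[OF r(1), of "x + y"] sublinear_add[of r x y] r by simp
          qed
          then show "u (x + y) - u y \<le> q x" by simp
        qed
        then show "u (x + y) \<le> u x + u y" by simp
      next
        fix c x assume c: "(c::real) \<ge> 0"
        show "u (c *\<^sub>R x) \<le> c * u x"
        proof (cases "c = 0")
          case True
          obtain q where q: "q \<in> C" using False by blast
          then have "sublinear q" using CS by (auto simp: S_def)
          then show ?thesis using True u_le[OF q, of 0] sublinear_zero[of q] by simp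
        next
          case c0: False
          then have c: "c > 0" using c by simp
          have "(1/c) * u (c *\<^sub>R x) \<le> u x"
          proof (rule u_ge)
            fix q assume q: "q \<in> C"
            then have "sublinear q" using CS by (auto simp: S_def)
            then show "(1/c) * u (c *\<^sub>R x) \<le> q x"
              using u_le[OF q, of "c *\<^sub>R x"] c by (simp add: sublinear_scaleR field_simps)
          qed
          then show ?thesis using c by (simp add: field_simps)
        qed
      qed
      moreover have "u \<le> p"
      proof -
        obtain q where "q \<in> C" using False by blast
        then show ?thesis using u_le[of q] CS by (force simp: S_def le_fun_def intro: order_trans)
      qed
      ultimately show ?thesis using u_le by (auto simp: S_def le_fun_def)
    qed
  qed
  then obtain m where m: "m \<in> S" "\<And>a. a \<in> S \<Longrightarrow> a \<le> m \<Longrightarrow> a = m" by blast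
  show ?thesis
  proof (intro exI conjI allI impI)
    show "sublinear m" "m x \<le> p x" for x using m(1) by (auto simp: S_def le_fun_def)
    fix q assume q: "sublinear q \<and> (\<forall>x. q x \<le> m x)"
    then have "q \<in> S" using m(1) by (force simp: S_def le_fun_def intro: order_trans)
    then show "q = m" using m(2) q by (auto simp: le_fun_def)
  qed
qed

text \<open>A minimal sublinear functional is odd, because tightening it at any point changes
  nothing, and an odd sublinear functional is linear. Tightening \<open>p\<close> at
  \<open>b\<close> before minimising fixes the value at \<open>b\<close>.\<close>

theorem Hahn_Banach_sublinear:
  assumes p: "sublinear p"
  obtains f where "linear f" "\<And>x. f x \<le> p x" "f b = p b"
proof -
  obtain q where q: "sublinear q" "\<And>x. q x \<le> p x" "q (- b) \<le> - p b"
    using sublinear_tighten[OF p] by blast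
  obtain f where f: "sublinear f" "\<And>x. f x \<le> q x"
    and min: "\<And>r. sublinear r \<Longrightarrow> (\<And>x. r x \<le> f x) \<Longrightarrow> r = f"
    using sublinear_minimal_exists[OF q(1)] by blast
  have minus: "f (- y) = - f y" for y
  proof -
    obtain r where r: "sublinear r" "\<And>x. r x \<le> f x" "r (- y) \<le> - f y"
      using sublinear_tighten[OF f(1)] by blast
    then have "f (- y) \<le> - f y" using min[of r] by simp
    moreover have "- f y \<le> f (- y)" using sublinear_ge_neg[OF f(1), of "- y"] by simp
    ultimately show ?thesis by simp
  qed
  show thesis
  proof
    show "linear f"
    proof (rule linearI)
      fix x y
      have "f (- x + - y) \<le> f (- x) + f (- y)" by (rule sublinear_add[OF f(1)])
      also have "- x + - y = - (x + y)" by simp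
      finally have "f x + f y \<le> f (x + y)" by (simp add: minus del: minus_add_distrib)
      then show "f (x + y) = f x + f y" using sublinear_add[OF f(1), of x y] by simp
    next
      fix c :: real and x
      consider "c > 0" | "c = 0" | "c < 0" by linarith
      then show "f (c *\<^sub>R x) = c *\<^sub>R f x"
      proof cases
        case 3
        then have "f ((- c) *\<^sub>R x) = (- c) * f x" by (intro sublinear_scaleR[OF f(1)]) simp
        then show ?thesis by (simp add: minus)
      qed (simp_all add: sublinear_scaleR[OF f(1)] sublinear_zero[OF f(1)])
    qed
    show "f x \<le> p x" for x using f(2) q(2) order_trans by blast
    have "- f b \<le> - p b" using f(2)[of "- b"] q(3) by (simp add: minus)
    then show "f b = p b" using \<open>f b \<le> p b\<close> by simp
  qed
qed

section \<open>Positive functionals\<close>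

locale positive_functional =
  fixes \<Phi> :: "'a::cstar_algebra \<Rightarrow> complex"
  assumes add: "\<Phi> (x + y) = \<Phi> x + \<Phi> y"
    and scaleC: "\<Phi> (c *\<^sub>C x) = c * \<Phi> x"
    and adj: "\<Phi> (adj x) = cnj (\<Phi> x)"
    and nonneg: "0 \<le> Re (\<Phi> (adj x * x))"

definition sa_part :: "'a::cstar_algebra \<Rightarrow> 'a" where
  "sa_part x = (1/2) *\<^sub>R (x + adj x)"

lemma sa_part_simps:
  "sa_part (x + y) = sa_part x + sa_part y" "sa_part (c *\<^sub>R x) = c *\<^sub>R sa_part x"
  "sa_part (- x) = - sa_part x" "sa_part (adj x) = sa_part x"
  by (simp_all add: sa_part_def adj_add adj_scaleR adj_minus algebra_simps)

lemma sa_part_sa: "sa x \<Longrightarrow> sa_part x = x"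
  by (simp add: sa_part_def sa_def scaleR_2[symmetric])

text \<open>
  The sublinear functional below is the largest point of the spectrum of the self-adjoint part.
\<close>

theorem exists_positive_functional:
  fixes a :: "'a::cstar_algebra"
  assumes "a \<noteq> 0"
  obtains \<Phi> where "positive_functional \<Phi>" "0 < Re (\<Phi> (adj a * a))"
proof -
  have "(1::'a) \<noteq> 0"
  proof
    assume "(1::'a) = 0"
    then have "a * 1 = a * 0" by simp
    then show False using assms by simp
  qed
  then have n1: "norm (1::'a) = 1"
    using norm_adj_mult_self[of "1::'a"] by (simp add: power2_eq_square)
  define p :: "'a \<Rightarrow> real" where "p = (\<lambda>x. INF t\<in>{0..}. norm (t *\<^sub>R 1 + sa_part x) - t)"
  have lower: "- norm (sa_part x) \<le> norm (t *\<^sub>R 1 + sa_part x) - t" if "t \<ge> 0" for x :: 'a and t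
    using norm_diff_ineq[of "t *\<^sub>R 1" "sa_part x"] that by (simp add: n1)
  have bdd: "bdd_below ((\<lambda>t. norm (t *\<^sub>R 1 + sa_part x) - t) ` {0..})" for x :: 'a
    using lower[of _ x] by (auto intro!: bdd_belowI2)
  have p_le: "p x \<le> norm (t *\<^sub>R 1 + sa_part x) - t" if "t \<ge> 0" for x t
    unfolding p_def by (rule cINF_lower[OF bdd]) (use that in simp)
  have p_ge: "m \<le> p x" if "\<And>t. t \<ge> 0 \<Longrightarrow> m \<le> norm (t *\<^sub>R 1 + sa_part x) - t" for m x
    unfolding p_def by (rule cINF_greatest) (use that in auto)
  have "sublinear p"
    unfolding sublinear_def
  proof (intro conjI allI impI)
    fix x y
    have "p (x + y) - p y \<le> p x"
    proof (rule p_ge)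
      fix t :: real assume t: "t \<ge> 0"
      have "p (x + y) - (norm (t *\<^sub>R 1 + sa_part x) - t) \<le> p y"
      proof (rule p_ge)
        fix s :: real assume s: "s \<ge> 0"
        have eq: "(t + s) *\<^sub>R 1 + sa_part (x + y) = (t *\<^sub>R 1 + sa_part x) + (s *\<^sub>R 1 + sa_part y)"
          by (simp add: sa_part_simps algebra_simps)
        have "p (x + y) \<le> norm ((t *\<^sub>R 1 + sa_part x) + (s *\<^sub>R 1 + sa_part y)) - (t + s)"
          using p_le[of "t + s" "x + y"] s t unfolding eq by simp
        also have "\<dots> \<le> norm (t *\<^sub>R 1 + sa_part x) + norm (s *\<^sub>R 1 + sa_part y) - (t + s)"
          using norm_triangle_ineq[of "t *\<^sub>R 1 + sa_part x" "s *\<^sub>R 1 + sa_part y"] by simp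
        finally show "p (x + y) - (norm (t *\<^sub>R 1 + sa_part x) - t) \<le> norm (s *\<^sub>R 1 + sa_part y) - s" by simp
      qed
      then show "p (x + y) - p y \<le> norm (t *\<^sub>R 1 + sa_part x) - t" by simp
    qed
    then show "p (x + y) \<le> p x + p y" by simp
  next
    fix c :: real and x assume c: "c \<ge> 0"
    show "p (c *\<^sub>R x) \<le> c * p x"
    proof (cases "c = 0")
      case True
      then show ?thesis using p_le[of 0 "0 *\<^sub>R x"] by (simp add: sa_part_simps del: scale_zero_left) (simp add: sa_part_def)
    next
      case False
      then have c: "c > 0" using c by simp
      have "(1/c) * p (c *\<^sub>R x) \<le> p x"
      proof (rule p_ge)
        fix t :: real assume t: "t \<ge> 0"
        have eq: "(c * t) *\<^sub>R 1 + sa_part (c *\<^sub>R x) = c *\<^sub>R (t *\<^sub>R 1 + sa_part x)"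
          by (simp add: sa_part_simps scaleR_add_right)
        have "p (c *\<^sub>R x) \<le> norm (c *\<^sub>R (t *\<^sub>R 1 + sa_part x)) - c * t"
          using p_le[of "c * t" "c *\<^sub>R x"] t c unfolding eq by simp
        then have "p (c *\<^sub>R x) \<le> c * (norm (t *\<^sub>R 1 + sa_part x) - t)"
          using c by (simp add: right_diff_distrib)
        then show "(1/c) * p (c *\<^sub>R x) \<le> norm (t *\<^sub>R 1 + sa_part x) - t"
          using c by (simp add: pos_divide_le_eq mult.commute)
      qed
      then show ?thesis using c by (simp add: field_simps)
    qed
  qed
  then obtain f where f: "linear f" "\<And>x. f x \<le> p x" "f (adj a * a) = p (adj a * a)"
    using Hahn_Banach_sublinear by blast
  have f_pos: "0 \<le> f h" if "pos h" for h
  proof -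
    obtain t where t: "t \<ge> 0" "norm (t *\<^sub>R 1 - h) \<le> t" using \<open>pos h\<close> by (auto simp: pos_def)
    have "f (- h) \<le> 0"
      using f(2)[of "- h"] p_le[OF t(1), of "- h"] t(2)
      by (simp add: sa_part_simps sa_part_sa pos_sa[OF \<open>pos h\<close>])
    then show ?thesis by (simp add: linear_neg[OF f(1)])
  qed
  \<comment> \<open>On a skew-adjoint element \<open>p\<close> is at most 0, as t = 0 in the infimum
    shows, and so it is on its negative; hence \<open>f\<close> vanishes there.\<close>
  have f_sa: "f x = f (sa_part x)" for x
  proof -
    let ?s = "x - sa_part x"
    have s0: "sa_part ?s = 0" "sa_part (- ?s) = 0"
      by (simp_all add: sa_part_def adj_diff adj_scaleR adj_add algebra_simps scaleR_2[symmetric])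
    have "f ?s \<le> 0" "f (- ?s) \<le> 0"
      using f(2)[of ?s] p_le[of 0 ?s] f(2)[of "- ?s"] p_le[of 0 "- ?s"] by (simp_all add: s0 del: minus_diff_eq)
    then show ?thesis by (simp add: linear_neg[OF f(1)] linear_diff[OF f(1)])
  qed
  have f_adj: "f (adj x) = f x" for x
    using f_sa[of x] f_sa[of "adj x"] by (simp add: sa_part_simps)
  \<comment> \<open>The usual complexification f(x) - i f(i x) of a real linear functional.\<close>
  define \<Phi> where "\<Phi> = (\<lambda>x. Complex (f x) (- f (\<i> *\<^sub>C x)))"
  have fi: "f (c *\<^sub>C x) = Re c * f x + Im c * f (\<i> *\<^sub>C x)" for c x
  proof -
    have "c *\<^sub>C x = Re c *\<^sub>R x + Im c *\<^sub>R (\<i> *\<^sub>C x)"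
      unfolding scaleR_scaleC scaleC_scaleC scaleC_add_left[symmetric]
      by (rule arg_cong[of _ _ "\<lambda>d. d *\<^sub>C x"]) (simp add: complex_eq_iff)
    then show ?thesis by (simp add: linear_add[OF f(1)] linear_scale[OF f(1)])
  qed
  have "positive_functional \<Phi>"
  proof
    show "\<Phi> (x + y) = \<Phi> x + \<Phi> y" for x y
      by (simp add: \<Phi>_def linear_add[OF f(1)] scaleC_add_right complex_eq_iff)
    show "\<Phi> (c *\<^sub>C x) = c * \<Phi> x" for c x
      by (simp add: \<Phi>_def complex_eq_iff fi[of c x] scaleC_scaleC fi[of "\<i> * c" x] algebra_simps)
    have "f (\<i> *\<^sub>C adj x) = - f (\<i> *\<^sub>C x)" for x
      using f_adj[of "\<i> *\<^sub>C x"] by (simp add: adj_scaleC scaleC_minus_left linear_neg[OF f(1)])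
    then show "\<Phi> (adj x) = cnj (\<Phi> x)" for x
      by (simp add: \<Phi>_def complex_eq_iff f_adj)
    show "0 \<le> Re (\<Phi> (adj x * x))" for x
      by (simp add: \<Phi>_def f_pos pos_adj_mult_self)
  qed
  moreover have "0 < Re (\<Phi> (adj a * a))"
  proof -
    let ?b = "adj a * a"
    have b: "pos ?b" by (rule pos_adj_mult_self)
    have nb: "norm ?b > 0" using assms by (simp add: norm_adj_mult_self)
    then have b0: "?b \<noteq> 0" by auto
    \<comment> \<open>Every member of the infimum that defines \<open>p\<close> is at least norm(?b)
      by \<open>norm_shift_pos\<close>; this is where the functional is prevented from being 0 at a*
      a.\<close>
    have "norm ?b \<le> p ?b"
      by (rule p_ge) (use norm_shift_pos[OF b b0] in \<open>simp add: sa_part_sa pos_sa[OF b] algebra_simps\<close>)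
    then have "0 < p ?b" using nb by linarith
    then show ?thesis by (simp add: \<Phi>_def f(3))
  qed
  ultimately show thesis by (rule that)
qed

section \<open>The semi-inner product of a positive functional\<close>

context positive_functional
begin

text \<open>The form of the GNS construction, linear in the first argument like \<open>ip\<close>.
  Null vectors are not divided out; they disappear when coordinates are taken.\<close>

definition gns :: "'a \<Rightarrow> 'a \<Rightarrow> complex" where "gns x y = \<Phi> (adj y * x)"

definition sq :: "'a \<Rightarrow> real" where "sq x = Re (gns x x)"

lemma zero: "\<Phi> 0 = 0" using scaleC[of 0 0] by simp

lemma diff: "\<Phi> (x - y) = \<Phi> x - \<Phi> y"
  using add[of "x - y" y] by simp

lemma gns_add_left: "gns (x + y) z = gns x z + gns y z"
  by (simp add: gns_def distrib_left add)

lemma gns_add_right: "gns x (y + z) = gns x y + gns x z"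
  by (simp add: gns_def adj_add distrib_right add)

lemma gns_scaleC_left: "gns (c *\<^sub>C x) y = c * gns x y"
  by (simp add: gns_def mult_scaleC_right scaleC)

lemma gns_scaleC_right: "gns x (c *\<^sub>C y) = cnj c * gns x y"
  by (simp add: gns_def adj_scaleC mult_scaleC_left scaleC)

lemma gns_minus_left: "gns (- x) y = - gns x y"
  using gns_scaleC_left[of "-1" x y] by (simp add: scaleC_minus_left)

lemma gns_minus_right: "gns x (- y) = - gns x y"
  using gns_scaleC_right[of x "-1" y] by (simp add: scaleC_minus_left)

lemma gns_diff_left: "gns (x - y) z = gns x z - gns y z"
  using gns_add_left[of x "- y" z] by (simp add: gns_minus_left)

lemma gns_diff_right: "gns x (y - z) = gns x y - gns x z"
  using gns_add_right[of x y "- z"] by (simp add: gns_minus_right)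

lemma gns_zero [simp]: "gns 0 x = 0" "gns x 0 = 0"
  by (simp_all add: gns_def zero)

lemma gns_sum_left: "gns (\<Sum>i\<in>I. f i) y = (\<Sum>i\<in>I. gns (f i) y)"
  by (induction I rule: infinite_finite_induct) (simp_all add: gns_add_left)

lemma gns_sum_right: "gns x (\<Sum>i\<in>I. f i) = (\<Sum>i\<in>I. gns x (f i))"
  by (induction I rule: infinite_finite_induct) (simp_all add: gns_add_right)

lemma gns_commute: "gns y x = cnj (gns x y)"
  using adj[of "adj y * x"] by (simp add: gns_def adj_mult)

lemma gns_mult_left: "gns (a * x) y = gns x (adj a * y)"
  by (simp add: gns_def adj_mult mult.assoc)

lemma sq_nonneg: "0 \<le> sq x"
  by (simp add: sq_def gns_def nonneg)

lemma gns_self: "gns x x = complex_of_real (sq x)"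
  using gns_commute[of x x] by (simp add: sq_def complex_eq_iff)

lemma sq_scaleC: "sq (c *\<^sub>C x) = (cmod c)\<^sup>2 * sq x"
proof -
  have "gns (c *\<^sub>C x) (c *\<^sub>C x) = complex_of_real ((cmod c)\<^sup>2) * gns x x"
    by (simp add: gns_scaleC_left gns_scaleC_right complex_norm_square mult_ac del: of_real_power)
  then show ?thesis by (simp add: sq_def del: of_real_power)
qed

lemma sq_add: "sq (x + y) = sq x + sq y + 2 * Re (gns x y)"
  using gns_commute[of x y] by (simp add: sq_def gns_add_left gns_add_right)

lemma sq_parallelogram: "sq (x + y) + sq (x - y) = 2 * sq x + 2 * sq y"
  by (simp add: sq_def gns_add_left gns_add_right gns_diff_left gns_diff_right)

text \<open>Write norm(a)^2 - a* a = r^2 with \<open>r\<close> self-adjoint; the difference of the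
  two sides is then sq (r x), which is nonnegative.\<close>

lemma sq_mult_le: "sq (a * x) \<le> (norm a)\<^sup>2 * sq x"
proof -
  have "pos ((norm (adj a * a)) *\<^sub>R 1 - adj a * a)"
    by (rule pos_diff_of_norm_le) (simp_all add: sa_intros)
  then obtain r where r: "pos r" "r * r = (norm (adj a * a)) *\<^sub>R 1 - adj a * a"
    using pos_sqrt by blast
  have "adj (r * x) * (r * x) = adj x * (r * r) * x"
    using pos_sa[OF r(1)] by (simp add: adj_mult sa_def mult.assoc)
  also have "\<dots> = complex_of_real ((norm a)\<^sup>2) *\<^sub>C (adj x * x) - adj (a * x) * (a * x)"
    by (simp add: r(2) norm_adj_mult_self adj_mult algebra_simps scaleR_scaleC mult_scaleC_left
        mult_scaleC_right del: of_real_power)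
  finally have "sq (r * x) = Re (\<Phi> (complex_of_real ((norm a)\<^sup>2) *\<^sub>C (adj x * x) - adj (a * x) * (a * x)))"
    by (simp add: sq_def gns_def)
  also have "\<dots> = (norm a)\<^sup>2 * sq x - sq (a * x)"
    by (simp add: diff scaleC sq_def gns_def del: of_real_power)
  finally show ?thesis using sq_nonneg[of "r * x"] by simp
qed

lemma sq_unitary_mult: "adj a * a = 1 \<Longrightarrow> sq (a * x) = sq x"
  by (simp add: sq_def gns_mult_left mult.assoc[symmetric])

text \<open>The degenerate case of Cauchy-Schwarz: if \<open>sq n\<close> is 0, then adding
  multiples of \<open>n\<close> to \<open>y\<close> changes \<open>sq\<close> linearly in the
  parameter \<open>s\<close>, so nonnegativity forces the slope to be 0.\<close>

lemma gns_null:
  assumes "sq n = 0"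
  shows "gns n y = 0" "gns y n = 0"
proof -
  let ?g = "gns n y"
  have "0 \<le> sq y + 2 * s * (cmod ?g)\<^sup>2" for s :: real
  proof -
    have "0 \<le> sq ((of_real s * cnj ?g) *\<^sub>C n + y)" by (rule sq_nonneg)
    also have "\<dots> = sq y + 2 * s * Re (cnj ?g * ?g)"
      by (simp add: sq_add sq_scaleC assms gns_scaleC_left) (simp add: algebra_simps)
    also have "cnj ?g * ?g = of_real ((cmod ?g)\<^sup>2)"
      by (simp add: complex_norm_square mult.commute del: of_real_power)
    finally show ?thesis by (simp del: of_real_power)
  qed
  \<comment> \<open>For \<open>?g\<close> different from 0 this value of \<open>s\<close> would make
    the nonnegative quantity equal to -1.\<close>
  from this[of "- (sq y + 1) / (2 * (cmod ?g)\<^sup>2)"] show "gns n y = 0"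
    by (cases "?g = 0") (simp_all add: field_simps)
  then show "gns y n = 0" using gns_commute[of n y] by simp
qed

lemma sq_add_null: "sq n = 0 \<Longrightarrow> sq (x + n) = sq x"
  by (simp add: sq_add gns_null)

section \<open>Orthonormal families for the semi-inner product\<close>

definition orthonormal :: "nat \<Rightarrow> (nat \<Rightarrow> 'a) \<Rightarrow> bool" where
  "orthonormal d e \<longleftrightarrow> (\<forall>i<d. \<forall>j<d. gns (e i) (e j) = (if i = j then 1 else 0))"

text \<open>The expansion is required only up to a vector of seminorm 0, because the form is merely
  semidefinite.\<close>

definition spanned :: "nat \<Rightarrow> (nat \<Rightarrow> 'a) \<Rightarrow> 'a \<Rightarrow> bool" where
  "spanned d e x \<longleftrightarrow> sq (x - (\<Sum>i<d. gns x (e i) *\<^sub>C e i)) = 0"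

text \<open>Gram-Schmidt; a vector whose residual \<open>r\<close> has seminorm 0 contributes no new
  member of the family.\<close>

lemma exists_orthonormal:
  assumes "finite B"
  shows "\<exists>d e. orthonormal d e \<and> (\<forall>b\<in>B. spanned d e b)"
  using assms
proof (induction B)
  case empty
  show ?case by (intro exI[of _ 0]) (simp add: orthonormal_def)
next
  case (insert b B)
  then obtain d e where e: "orthonormal d e" and B: "\<And>b. b \<in> B \<Longrightarrow> spanned d e b" by blast
  define r where "r = b - (\<Sum>i<d. gns b (e i) *\<^sub>C e i)"
  show ?case
  proof (cases "sq r = 0")
    case True
    then show ?thesis using e B by (intro exI[of _ d] exI[of _ e]) (auto simp: r_def spanned_def)
  next
    case False
    then have r0: "sq r > 0" using sq_nonneg[of r] by simp
    define s where "s = sqrt (sq r)"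
    have s: "s > 0" "s * s = sq r" using r0 by (simp_all add: s_def)
    define f where "f = e(d := complex_of_real (1/s) *\<^sub>C r)"
    have fi: "f i = e i" if "i < d" for i using that by (simp add: f_def)
    have fd: "f d = complex_of_real (1/s) *\<^sub>C r" by (simp add: f_def)
    have re: "gns r (e j) = 0" if "j < d" for j
    proof -
      have "(\<Sum>i<d. gns b (e i) * gns (e i) (e j)) = (\<Sum>i<d. if i = j then gns b (e i) else 0)"
        using e that by (intro sum.cong) (auto simp: orthonormal_def)
      then show ?thesis using that by (simp add: r_def gns_diff_left gns_sum_left gns_scaleC_left)
    qed
    have er: "gns (e j) r = 0" if "j < d" for j using gns_commute[of r "e j"] re[OF that] by simp
    have rr: "gns r r = of_real (s * s)" by (simp add: gns_self s(2))
    have rb: "gns b r = of_real (s * s)"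
    proof -
      have "gns b r = gns (r + (\<Sum>i<d. gns b (e i) *\<^sub>C e i)) r" by (simp add: r_def)
      also have "\<dots> = gns r r" by (simp add: gns_add_left gns_sum_left gns_scaleC_left er)
      finally show ?thesis by (simp add: rr)
    qed
    have "orthonormal (Suc d) f"
      unfolding orthonormal_def
    proof (intro allI impI)
      fix i j assume ij: "i < Suc d" "j < Suc d"
      then consider "i < d" "j < d" | "i < d" "j = d" | "i = d" "j < d" | "i = d" "j = d" by linarith
      then show "gns (f i) (f j) = (if i = j then 1 else 0)"
      proof cases
        case 1
        then show ?thesis using e by (simp add: fi orthonormal_def)
      next
        case 4
        then show ?thesis using s(1) by (simp add: fd gns_scaleC_left gns_scaleC_right rr)
      qed (simp_all add: fi fd gns_scaleC_left gns_scaleC_right er re)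
    qed
    moreover have "spanned (Suc d) f c" if "c \<in> insert b B" for c
    proof -
      \<comment> \<open>Vectors from \<open>B\<close> are orthogonal to \<open>r\<close>, so the
        added term vanishes for them; for \<open>b\<close> itself the added term is exactly
        \<open>r\<close>.\<close>
      have expand: "c - (\<Sum>i<Suc d. gns c (f i) *\<^sub>C f i)
          = (c - (\<Sum>i<d. gns c (e i) *\<^sub>C e i)) - (of_real (1/s) * of_real (1/s) * gns c r) *\<^sub>C r"
      proof -
        have "(\<Sum>i<d. gns c (f i) *\<^sub>C f i) = (\<Sum>i<d. gns c (e i) *\<^sub>C e i)"
          by (intro sum.cong) (simp_all add: fi)
        then show ?thesis by (simp add: fd gns_scaleC_right scaleC_scaleC mult.commute mult.left_commute algebra_simps)
      qed
      show ?thesis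
      proof (cases "c \<in> B")
        case True
        let ?n = "c - (\<Sum>i<d. gns c (e i) *\<^sub>C e i)"
        have n: "sq ?n = 0" using B[OF True] by (simp add: spanned_def)
        have "gns c r = gns (?n + (\<Sum>i<d. gns c (e i) *\<^sub>C e i)) r" by simp
        also have "\<dots> = 0"
          by (simp only: gns_add_left gns_null[OF n] gns_sum_left gns_scaleC_left) (simp add: er)
        finally show ?thesis unfolding spanned_def expand using n by simp
      next
        case False
        then have "c = b" using that by simp
        moreover have "of_real (1/s) * of_real (1/s) * gns b r = 1" using s(1) by (simp add: rb)
        ultimately show ?thesis unfolding spanned_def expand by (simp only: r_def[symmetric]) (simp add: sq_def)
      qed
    qed
    ultimately show ?thesis by blast
  qed
qed

end

section \<open>Isometries of Hilbert spaces\<close>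

text \<open>Surjectivity is not part of the notion; on coordinate spaces it follows by
  \<open>isometry_surjective_cvec_space\<close>, which makes these maps unitaries there.\<close>

definition isometry_op :: "'h inner_space \<Rightarrow> ('h \<Rightarrow> 'h) \<Rightarrow> bool" where
  "isometry_op H T \<longleftrightarrow> T \<in> module_hom class_ring H H \<and>
     (\<forall>x\<in>carrier H. \<forall>y\<in>carrier H. ip H (T x) (T y) = ip H x y)"

lemma module_homI:
  assumes "\<And>x. x \<in> carrier M \<Longrightarrow> f x \<in> carrier N"
    and "\<And>x y. x \<in> carrier M \<Longrightarrow> y \<in> carrier M \<Longrightarrow> f (x \<oplus>\<^bsub>M\<^esub> y) = f x \<oplus>\<^bsub>N\<^esub> f y"
    and "\<And>c x. c \<in> carrier R \<Longrightarrow> x \<in> carrier M \<Longrightarrow> f (c \<odot>\<^bsub>M\<^esub> x) = c \<odot>\<^bsub>N\<^esub> f x"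
  shows "f \<in> module_hom R M N"
  using assms by (auto simp: module_hom_def)

lemma module_homD:
  assumes "f \<in> module_hom R M N"
  shows "\<And>x. x \<in> carrier M \<Longrightarrow> f x \<in> carrier N"
    and "\<And>x y. x \<in> carrier M \<Longrightarrow> y \<in> carrier M \<Longrightarrow> f (x \<oplus>\<^bsub>M\<^esub> y) = f x \<oplus>\<^bsub>N\<^esub> f y"
    and "\<And>c x. c \<in> carrier R \<Longrightarrow> x \<in> carrier M \<Longrightarrow> f (c \<odot>\<^bsub>M\<^esub> x) = c \<odot>\<^bsub>N\<^esub> f x"
  using assms by (auto simp: module_hom_def)

lemma isometry_opD:
  assumes "isometry_op H T"
  shows "\<And>x. x \<in> carrier H \<Longrightarrow> T x \<in> carrier H"
    and "\<And>x y. x \<in> carrier H \<Longrightarrow> y \<in> carrier H \<Longrightarrow> T (x \<oplus>\<^bsub>H\<^esub> y) = T x \<oplus>\<^bsub>H\<^esub> T y"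
    and "\<And>c x. x \<in> carrier H \<Longrightarrow> T (c \<odot>\<^bsub>H\<^esub> x) = c \<odot>\<^bsub>H\<^esub> T x"
    and "\<And>x y. x \<in> carrier H \<Longrightarrow> y \<in> carrier H \<Longrightarrow> ip H (T x) (T y) = ip H x y"
  using assms by (auto simp: isometry_op_def module_hom_def)

lemma isometry_op_compose:
  "isometry_op H S \<Longrightarrow> isometry_op H T \<Longrightarrow> isometry_op H (\<lambda>x. S (T x))"
  by (auto simp: isometry_op_def module_hom_def Pi_def)

lemma isometry_op_id: "isometry_op H (\<lambda>x. x)"
  by (simp add: isometry_op_def module_hom_def)

lemma isometry_op_hnorm: "isometry_op H T \<Longrightarrow> x \<in> carrier H \<Longrightarrow> hnorm H (T x) = hnorm H x"
  by (simp add: hnorm_def isometry_opD)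

context hilbert_space
begin

lemma one_smult: "x \<in> carrier H \<Longrightarrow> 1 \<odot> x = x"
  using smult_one[of x] by (simp add: class_ring_simps)

lemma zero_smult: "x \<in> carrier H \<Longrightarrow> 0 \<odot> x = \<zero>"
  using smult_l_null[of x] by (simp add: class_ring_simps)

lemma smult_smult: "x \<in> carrier H \<Longrightarrow> c \<odot> (d \<odot> x) = (c * d) \<odot> x"
  using smult_assoc1[of c d x] by (simp add: class_ring_simps)

lemma minus_eq_smult: "x \<in> carrier H \<Longrightarrow> y \<in> carrier H \<Longrightarrow> x \<ominus> y = x \<oplus> (-1) \<odot> y"
  using smult_l_minus[of 1 y] smult_one[of y] by (simp add: class_ring_simps M.minus_eq)

lemma add_smult_neg: "x \<in> carrier H \<Longrightarrow> x \<oplus> (-1) \<odot> x = \<zero>"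
  by (simp flip: minus_eq_smult add: M.minus_eq M.r_neg)

lemma eq_if_add_smult_neg:
  assumes "x \<in> carrier H" "y \<in> carrier H" "x \<oplus> (-1) \<odot> y = \<zero>"
  shows "x = y"
proof -
  have "(-1) \<odot> y \<oplus> y = \<zero>"
    using assms add_smult_neg[of y] M.a_comm[of "(-1) \<odot> y" y] by simp
  then have "x = x \<oplus> ((-1) \<odot> y \<oplus> y)" using assms by simp
  also have "\<dots> = (x \<oplus> (-1) \<odot> y) \<oplus> y" using assms(1,2) by (simp add: M.a_assoc)
  finally show ?thesis using assms by simp
qed

lemmas ip_simps = ip_add_left ip_add_right ip_smult_left ip_smult_right

text \<open>
  Complex Householder maps: if \<open>a\<close>, \<open>b\<close> have the same norm and \<open>z = a - b\<close>, then
  \<open>x \<mapsto> x - (\<langle>x, z\<rangle> / \<langle>a, z\<rangle>) z\<close> is an isometry because \<open>2 Re \<langle>a, z\<rangle> = \<langle>z, z\<rangle>\<close>.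
\<close>

lemma householder:
  assumes a: "a \<in> carrier H" and b: "b \<in> carrier H" and eq: "ip H a a = ip H b b"
  shows "\<exists>R. isometry_op H R \<and> R a = b \<and> (\<forall>x\<in>carrier H. ip H x a = ip H x b \<longrightarrow> R x = x)"
proof (cases "a = b")
  case True
  then show ?thesis using isometry_op_id by blast
next
  case False
  define z where "z = a \<oplus> (-1) \<odot> b"
  define c where "c = ip H a z"
  have z: "z \<in> carrier H" using a b by (simp add: z_def)
  have ba: "ip H b a = cnj (ip H a b)" using ip_commute[OF a b] .
  define s where "s = Re (ip H a a)"
  have aa: "ip H a a = of_real s" "ip H b b = of_real s"
    using ip_self[OF a] eq by (simp_all add: s_def)
  have zz: "ip H z z = c + cnj c"
    using a b by (simp add: z_def c_def ip_simps ba aa)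
  have "z \<noteq> \<zero>" using False eq_if_add_smult_neg[OF a b] by (auto simp: z_def)
  then have "ip H z z \<noteq> 0" using ip_definite[OF z] by blast
  then have c0: "c \<noteq> 0" using zz by auto
  define R where "R = (\<lambda>x. x \<oplus> (- (ip H x z / c)) \<odot> z)"
  have "isometry_op H R"
    unfolding isometry_op_def
  proof (intro conjI ballI module_homI)
    fix x y assume x: "x \<in> carrier H" and y: "y \<in> carrier H"
    have "(- (ip H (x \<oplus> y) z / c)) \<odot> z = (- (ip H x z / c)) \<odot> z \<oplus> (- (ip H y z / c)) \<odot> z"
      using x y z smult_l_distr[of "- (ip H x z / c)" "- (ip H y z / c)" z]
      by (simp add: class_ring_simps ip_simps add_divide_distrib)
    then show "R (x \<oplus> y) = R x \<oplus> R y"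
      using x y z by (simp add: R_def M.a_ac)
    define \<alpha> \<beta> where "\<alpha> = ip H x z / c" and "\<beta> = ip H y z / c"
    have xz: "ip H x z = \<alpha> * c" "ip H y z = \<beta> * c" using c0 by (simp_all add: \<alpha>_def \<beta>_def)
    have zy: "ip H z y = cnj (\<beta> * c)" using ip_commute[OF y z] xz by simp
    have "ip H (R x) (R y) = ip H (x \<oplus> (- \<alpha>) \<odot> z) (y \<oplus> (- \<beta>) \<odot> z)"
      by (simp add: R_def \<alpha>_def \<beta>_def)
    also have "\<dots> = ip H x y - cnj \<beta> * (\<alpha> * c) - \<alpha> * cnj (\<beta> * c) + \<alpha> * cnj \<beta> * (c + cnj c)"
      using x y z by (simp add: ip_simps xz zy zz algebra_simps)
    also have "\<dots> = ip H x y" by (simp add: algebra_simps)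
    finally show "ip H (R x) (R y) = ip H x y" .
  next
    fix k x assume x: "x \<in> carrier H"
    show "R (k \<odot> x) = k \<odot> R x"
      using x z smult_assoc1[of k "- (ip H x z / c)" z]
      by (simp add: R_def ip_simps smult_r_distr class_ring_simps)
  qed (use z in \<open>simp add: R_def\<close>)
  moreover have "R a = b"
  proof -
    have "R a = a \<oplus> (-1) \<odot> (a \<oplus> (-1) \<odot> b)" using c0 by (simp add: R_def c_def z_def)
    also have "\<dots> = (a \<oplus> (-1) \<odot> a) \<oplus> b"
      using a b by (simp add: smult_r_distr smult_smult one_smult M.a_assoc)
    finally show ?thesis using a b by (simp add: add_smult_neg)
  qed
  moreover have "R x = x" if x: "x \<in> carrier H" and xa: "ip H x a = ip H x b" for x
    using x a b xa z by (simp add: R_def z_def ip_simps zero_smult)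
  ultimately show ?thesis by blast
qed

text \<open>Induction over \<open>I\<close>: if \<open>Q\<close> is right on \<open>I\<close>, a
  Householder map \<open>R\<close> carries Q (x k) to \<open>y k\<close>. Equality of the Gram
  matrices says that each \<open>y i\<close> has the same inner product with Q (x k) and
  \<open>y k\<close>, so \<open>R\<close> leaves the values already attained unchanged. No
  complements or dimensions have to be compared.\<close>

lemma isometry_from_gram:
  assumes "finite I" and "\<And>i. i \<in> I \<Longrightarrow> x i \<in> carrier H" and "\<And>i. i \<in> I \<Longrightarrow> y i \<in> carrier H"
    and "\<And>i j. i \<in> I \<Longrightarrow> j \<in> I \<Longrightarrow> ip H (x i) (x j) = ip H (y i) (y j)"
  shows "\<exists>Q. isometry_op H Q \<and> (\<forall>i\<in>I. Q (x i) = y i)"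
  using assms
proof (induction I)
  case empty
  show ?case using isometry_op_id by blast
next
  case (insert k I)
  note x = insert.prems(1) and y = insert.prems(2) and gram = insert.prems(3)
  have "\<exists>Q. isometry_op H Q \<and> (\<forall>i\<in>I. Q (x i) = y i)"
    by (rule insert.IH; rule insert.prems; rule insertI2; assumption)
  then obtain Q where Q: "isometry_op H Q" "\<And>i. i \<in> I \<Longrightarrow> Q (x i) = y i" by blast
  have xk: "x k \<in> carrier H" and yk: "y k \<in> carrier H" by (rule x y; simp)+
  have Qxk: "Q (x k) \<in> carrier H" by (rule isometry_opD(1)[OF Q(1) xk])
  have "ip H (Q (x k)) (Q (x k)) = ip H (y k) (y k)"
    unfolding isometry_opD(4)[OF Q(1) xk xk] by (rule gram) simp_all
  then obtain R where R: "isometry_op H R" "R (Q (x k)) = y k"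
    "\<And>v. v \<in> carrier H \<Longrightarrow> ip H v (Q (x k)) = ip H v (y k) \<Longrightarrow> R v = v"
    using householder[OF Qxk yk] by blast
  have RQ: "R (Q (x i)) = y i" if i: "i \<in> I" for i
  proof -
    have xi: "x i \<in> carrier H" and yi: "y i \<in> carrier H" by (rule x y; simp add: i)+
    have "ip H (Q (x i)) (Q (x k)) = ip H (y i) (y k)"
      unfolding isometry_opD(4)[OF Q(1) xi xk] by (rule gram) (simp_all add: i)
    then have "R (y i) = y i" using yi by (intro R(3)) (simp_all only: Q(2)[OF i])
    then show ?thesis by (simp only: Q(2)[OF i])
  qed
  show ?case
    using isometry_op_compose[OF R(1) Q(1)] RQ R(2) by (intro exI[of _ "\<lambda>v. R (Q v)"]) blast
qed

text \<open>The cross terms cancel, because \<open>K\<close> is symmetric and \<open>c\<close> is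
  purely imaginary.\<close>

lemma cayley_ip:
  assumes K: "K \<in> module_hom class_ring H H"
    and sym: "\<And>x y. x \<in> carrier H \<Longrightarrow> y \<in> carrier H \<Longrightarrow> ip H (K x) y = ip H x (K y)"
    and x: "x \<in> carrier H" and y: "y \<in> carrier H" and c: "c = \<i> \<or> c = - \<i>"
  shows "ip H (x \<oplus> c \<odot> K x) (y \<oplus> c \<odot> K y) = ip H x y + ip H (K x) (K y)"
  using x y module_homD(1)[OF K] c by (elim disjE) (simp_all add: ip_simps sym algebra_simps)

text \<open>By \<open>cayley_ip\<close> the square norm of (1 - iK) w is that of \<open>w\<close>
  plus that of K w.\<close>

lemma cayley_injective:
  assumes K: "K \<in> module_hom class_ring H H"
    and sym: "\<And>x y. x \<in> carrier H \<Longrightarrow> y \<in> carrier H \<Longrightarrow> ip H (K x) y = ip H x (K y)"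
    and w: "w \<in> carrier H" and zero: "w \<oplus> (- \<i>) \<odot> K w = \<zero>"
  shows "w = \<zero>"
proof -
  have Kw: "K w \<in> carrier H" by (rule module_homD(1)[OF K w])
  have "ip H w w + ip H (K w) (K w) = 0"
    using cayley_ip[OF K sym w w, of "- \<i>"] by (simp add: zero ip_zero_left)
  from arg_cong[OF this, of Re] have "Re (ip H w w) + Re (ip H (K w) (K w)) = 0" by simp
  then have "Re (ip H w w) = 0" using ip_nonneg[OF w] ip_nonneg[OF Kw] by linarith
  then show ?thesis using ip_definite[OF w] ip_self[OF w] by simp
qed

text \<open>The Cayley transform \<open>(1 + \<i>K)(1 - \<i>K)\<^sup>-\<^sup>1\<close> of a symmetric operator.\<close>

lemma cayley_isometry:
  assumes K: "K \<in> module_hom class_ring H H"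
    and sym: "\<And>x y. x \<in> carrier H \<Longrightarrow> y \<in> carrier H \<Longrightarrow> ip H (K x) y = ip H x (K y)"
    and surj: "\<And>y. y \<in> carrier H \<Longrightarrow> \<exists>x\<in>carrier H. x \<oplus> (- \<i>) \<odot> K x = y"
  shows "\<exists>Q. isometry_op H Q \<and> (\<forall>x\<in>carrier H. Q (x \<oplus> (- \<i>) \<odot> K x) = x \<oplus> \<i> \<odot> K x)"
proof -
  have Kc: "K x \<in> carrier H" if "x \<in> carrier H" for x using module_homD(1)[OF K that] .
  have Kadd: "K (x \<oplus> y) = K x \<oplus> K y" if "x \<in> carrier H" "y \<in> carrier H" for x y
    using module_homD(2)[OF K that] .
  have Ksm: "K (c \<odot> x) = c \<odot> K x" if "x \<in> carrier H" for x c
    using module_homD(3)[OF K _ that] by simp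
  define T where "T = (\<lambda>c x. x \<oplus> c \<odot> K x)"
  have Tc: "T c x \<in> carrier H" if "x \<in> carrier H" for c x using that Kc by (simp add: T_def)
  have Tadd: "T c (x \<oplus> y) = T c x \<oplus> T c y" if "x \<in> carrier H" "y \<in> carrier H" for c x y
    using that Kc by (simp add: T_def Kadd smult_r_distr M.a_ac)
  have Tsm: "T c (k \<odot> x) = k \<odot> T c x" if "x \<in> carrier H" for c k x
    using that Kc by (simp add: T_def Ksm smult_r_distr smult_smult mult.commute)
  have Tip: "ip H (T c x) (T c y) = ip H x y + ip H (K x) (K y)"
    if "x \<in> carrier H" "y \<in> carrier H" "c = \<i> \<or> c = - \<i>" for c x y
    unfolding T_def using cayley_ip[OF K sym that] by simp
  have inj: "x = y" if xy: "x \<in> carrier H" "y \<in> carrier H" "T (- \<i>) x = T (- \<i>) y" for x y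
  proof -
    define w where "w = x \<oplus> (-1) \<odot> y"
    have w: "w \<in> carrier H" using xy by (simp add: w_def)
    have "T (- \<i>) w = \<zero>"
      using xy Tc by (simp add: w_def Tadd Tsm add_smult_neg)
    then have "w = \<zero>" using cayley_injective[OF K sym w] by (simp add: T_def)
    then show ?thesis using eq_if_add_smult_neg xy by (simp add: w_def)
  qed
  define S where "S = (\<lambda>y. SOME x. x \<in> carrier H \<and> T (- \<i>) x = y)"
  have S: "S (T (- \<i>) x) = x" if x: "x \<in> carrier H" for x
    unfolding S_def
  proof (rule some_equality)
    show "x' = x" if "x' \<in> carrier H \<and> T (- \<i>) x' = T (- \<i>) x" for x' using inj x that by blast
  qed (use x in simp)
  define Q where "Q = (\<lambda>y. T \<i> (S y))"
  have ex: "\<exists>x\<in>carrier H. y = T (- \<i>) x" if "y \<in> carrier H" for y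
    using surj[OF that] by (auto simp: T_def)
  have "isometry_op H Q"
    unfolding isometry_op_def
  proof (intro conjI ballI module_homI)
    fix u v assume u: "u \<in> carrier H" and v: "v \<in> carrier H"
    obtain x where x: "x \<in> carrier H" "u = T (- \<i>) x" using ex[OF u] by blast
    obtain y where y: "y \<in> carrier H" "v = T (- \<i>) y" using ex[OF v] by blast
    note * = x y
    then have "S (u \<oplus> v) = x \<oplus> y" using S[of "x \<oplus> y"] by (simp add: Tadd)
    then show "Q (u \<oplus> v) = Q u \<oplus> Q v" using * by (simp add: Q_def S Tadd)
    show "ip H (Q u) (Q v) = ip H u v" using * by (simp add: Q_def S Tip)
  next
    fix k u assume u: "u \<in> carrier H"
    obtain x where *: "x \<in> carrier H" "u = T (- \<i>) x" using ex[OF u] by blast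
    then have "S (k \<odot> u) = k \<odot> x" using S[of "k \<odot> x"] by (simp add: Tsm)
    then show "Q (k \<odot> u) = k \<odot> Q u" using * by (simp add: Q_def S Tsm)
    show "Q u \<in> carrier H" using * by (simp add: Q_def S Tc)
  qed
  then show ?thesis using S by (intro exI[of _ Q]) (auto simp: Q_def T_def)
qed

end

section \<open>Coordinate spaces\<close>

definition cvec_space :: "nat \<Rightarrow> complex vec inner_space" where
  "cvec_space n =
    \<lparr>carrier = carrier_vec n, mult = undefined, one = undefined, zero = 0\<^sub>v n, add = (+),
     smult = (\<cdot>\<^sub>v), ip = (\<lambda>v w. \<Sum>i<n. v $ i * cnj (w $ i))\<rparr>"

lemma cvec_space_simps [simp]:
  "carrier (cvec_space n) = carrier_vec n" "zero (cvec_space n) = 0\<^sub>v n"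
  "add (cvec_space n) = (+)" "smult (cvec_space n) = (\<cdot>\<^sub>v)"
  by (simp_all add: cvec_space_def)

lemma ip_cvec_space: "ip (cvec_space n) v w = (\<Sum>i<n. v $ i * cnj (w $ i))"
  by (simp add: cvec_space_def)

lemma vectorspace_cvec_space: "vectorspace class_ring (cvec_space n)"
proof -
  have grp: "abelian_group (cvec_space n)"
  proof (rule abelian_groupI)
    show "\<exists>y\<in>carrier (cvec_space n). y \<oplus>\<^bsub>cvec_space n\<^esub> x = \<zero>\<^bsub>cvec_space n\<^esub>"
      if "x \<in> carrier (cvec_space n)" for x
      using that by (intro bexI[of _ "- x"]) auto
  qed (auto intro!: eq_vecI)
  have "module class_ring (cvec_space n)"
    by (rule moduleI[OF class_cring.cring_axioms grp])
       (auto simp: class_ring_simps smult_add_distrib_vec add_smult_distrib_vec smult_smult_assoc intro!: eq_vecI)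
  then show ?thesis
    using class_field by (simp add: vectorspace_def)
qed

lemma minus_cvec_space:
  assumes "x \<in> carrier_vec n" "y \<in> carrier_vec n"
  shows "x \<ominus>\<^bsub>cvec_space n\<^esub> y = x - y"
proof -
  interpret vectorspace class_ring "cvec_space n" by (rule vectorspace_cvec_space)
  have "\<ominus>\<^bsub>cvec_space n\<^esub> y = - y"
    by (rule M.minus_equality) (use assms in auto)
  then show ?thesis using assms by (simp add: a_minus_def minus_add_uminus_vec)
qed

lemma hnorm_cvec_space: "hnorm (cvec_space n) v = sqrt (\<Sum>i<n. (cmod (v $ i))\<^sup>2)"
proof -
  have "ip (cvec_space n) v v = (\<Sum>i<n. complex_of_real ((cmod (v $ i))\<^sup>2))"
    by (simp add: ip_cvec_space complex_norm_square del: of_real_power)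
  then show ?thesis by (simp add: hnorm_def del: of_real_power)
qed

lemma cmod_le_hnorm_cvec_space: "i < n \<Longrightarrow> cmod (v $ i) \<le> hnorm (cvec_space n) v"
  unfolding hnorm_cvec_space
  by (rule real_le_rsqrt) (simp add: member_le_sum[of i "{..<n}" "\<lambda>i. (cmod (v $ i))\<^sup>2"])

text \<open>The triangle inequality is the one of \<open>L2_set\<close>; a Cauchy sequence converges
  in each coordinate, and finitely many coordinates give convergence in norm.\<close>

lemma hilbert_space_cvec_space: "hilbert_space (cvec_space n)"
proof -
  let ?H = "cvec_space n"
  interpret vectorspace class_ring "cvec_space n" by (rule vectorspace_cvec_space)
  have nonneg: "0 \<le> Re (ip ?H x x)" for x
    by (simp add: ip_cvec_space sum_nonneg)
  have definite: "x = 0\<^sub>v n" if x: "x \<in> carrier_vec n" "hnorm ?H x = 0" for x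
  proof (rule eq_vecI)
    fix i assume "i < dim_vec (0\<^sub>v n :: complex vec)"
    then show "x $ i = 0\<^sub>v n $ i" using cmod_le_hnorm_cvec_space[of i n x] x(2) by simp
  qed (use x in simp)
  have pre: "ip ?H (x + y) z = ip ?H x z + ip ?H y z" if "x \<in> carrier_vec n" "y \<in> carrier_vec n" for x y z
    using that by (simp add: ip_cvec_space distrib_right sum.distrib)
  have pre2: "ip ?H (c \<cdot>\<^sub>v x) y = c * ip ?H x y" if "x \<in> carrier_vec n" for c x y
    using that by (simp add: ip_cvec_space sum_distrib_left mult.assoc)
  have dist: "norm_dist ?H (hnorm ?H) x y = hnorm ?H (x - y)" if "x \<in> carrier_vec n" "y \<in> carrier_vec n" for x y
    using that by (simp add: norm_dist_def minus_cvec_space)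
  have com: "ip ?H y x = cnj (ip ?H x y)" for x y
    by (simp add: ip_cvec_space mult.commute)
  have sub: "hnorm ?H v = L2_set (\<lambda>i. cmod (v $ i)) {..<n}" for v
    by (simp add: hnorm_cvec_space L2_set_def)
  have metric: "Metric_space (carrier_vec n) (norm_dist ?H (hnorm ?H))"
  proof -
    have "Metric_space (carrier ?H) (norm_dist ?H (hnorm ?H))"
    proof (rule Metric_space_norm_dist[OF vectorspace_axioms])
      fix x y assume xy: "x \<in> carrier ?H" "y \<in> carrier ?H"
      have "hnorm ?H (x + y) \<le> L2_set (\<lambda>i. cmod (x $ i) + cmod (y $ i)) {..<n}"
        unfolding sub using xy by (intro L2_set_mono) (auto simp: norm_triangle_ineq)
      also have "\<dots> \<le> hnorm ?H x + hnorm ?H y" unfolding sub by (rule L2_set_triangle_ineq)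
      finally show "hnorm ?H (x \<oplus>\<^bsub>?H\<^esub> y) \<le> hnorm ?H x + hnorm ?H y" by simp
    next
      fix c x assume x: "x \<in> carrier ?H"
      have "hnorm ?H (c \<cdot>\<^sub>v x) = L2_set (\<lambda>i. cmod c * cmod (x $ i)) {..<n}"
        unfolding sub using x by (intro L2_set_cong) (auto simp: norm_mult)
      then show "hnorm ?H (c \<odot>\<^bsub>?H\<^esub> x) = cmod c * hnorm ?H x"
        by (simp add: sub L2_set_right_distrib)
    next
      fix x assume x: "x \<in> carrier ?H"
      show "hnorm ?H x = 0 \<longleftrightarrow> x = \<zero>\<^bsub>?H\<^esub>"
      proof
        show "hnorm ?H x = 0 \<Longrightarrow> x = \<zero>\<^bsub>?H\<^esub>" using definite[of x] x by simp
      qed (simp add: hnorm_cvec_space)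
    qed (simp add: hnorm_cvec_space sum_nonneg)
    then show ?thesis by simp
  qed
  interpret met: Metric_space "carrier_vec n" "norm_dist ?H (hnorm ?H)" by (rule metric)
  have complete: "met.mcomplete"
    unfolding met.mcomplete_def
  proof (intro allI impI)
    fix \<sigma> assume \<sigma>: "met.MCauchy \<sigma>"
    have rng: "\<sigma> k \<in> carrier_vec n" for k using \<sigma> by (auto simp: met.MCauchy_def)
    have "Cauchy (\<lambda>k. \<sigma> k $ i)" if i: "i < n" for i
    proof (rule CauchyI)
      fix e :: real assume "e > 0"
      then obtain N where N: "\<And>k l. N \<le> k \<Longrightarrow> N \<le> l \<Longrightarrow> norm_dist ?H (hnorm ?H) (\<sigma> k) (\<sigma> l) < e"
        using \<sigma> unfolding met.MCauchy_def by meson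
      have "norm (\<sigma> k $ i - \<sigma> l $ i) < e" if "k \<ge> N" "l \<ge> N" for k l
        using N[OF that] cmod_le_hnorm_cvec_space[OF i, of "\<sigma> k - \<sigma> l"] rng[of k] rng[of l] i
        by (simp add: dist)
      then show "\<exists>M. \<forall>m\<ge>M. \<forall>k\<ge>M. norm (\<sigma> m $ i - \<sigma> k $ i) < e" by blast
    qed
    then have "\<forall>i. \<exists>l. i < n \<longrightarrow> (\<lambda>k. \<sigma> k $ i) \<longlonglongrightarrow> l"
      using Cauchy_convergent by (auto simp: convergent_def)
    then obtain l where l: "\<And>i. i < n \<Longrightarrow> (\<lambda>k. \<sigma> k $ i) \<longlonglongrightarrow> l i" by metis
    have lc: "vec n l \<in> carrier_vec n" by simp
    have "(\<lambda>k. norm_dist ?H (hnorm ?H) (\<sigma> k) (vec n l)) = (\<lambda>k. sqrt (\<Sum>i<n. (cmod (\<sigma> k $ i - l i))\<^sup>2))"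
      using rng by (simp add: dist hnorm_cvec_space)
    moreover have "(\<lambda>k. sqrt (\<Sum>i<n. (cmod (\<sigma> k $ i - l i))\<^sup>2)) \<longlonglongrightarrow> sqrt (\<Sum>i<n. (cmod (l i - l i))\<^sup>2)"
      by (intro tendsto_intros l) auto
    ultimately have "(\<lambda>k. norm_dist ?H (hnorm ?H) (\<sigma> k) (vec n l)) \<longlonglongrightarrow> 0" by simp
    then have "limitin met.mtopology \<sigma> (vec n l) sequentially"
      using rng by (simp add: met.limitin_metric_dist_null)
    then show "\<exists>x. limitin met.mtopology \<sigma> x sequentially" by blast
  qed
  show ?thesis
  proof (unfold_locales)
    show "\<lbrakk>x \<in> carrier ?H; ip ?H x x = 0\<rbrakk> \<Longrightarrow> x = \<zero>\<^bsub>?H\<^esub>" for x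
      using definite[of x] by (simp add: hnorm_def)
    show "Metric_space.mcomplete (carrier ?H) (norm_dist ?H (hnorm ?H))" using complete by simp
    show "ip ?H y x = cnj (ip ?H x y)" for x y by (rule com)
  qed (use pre pre2 nonneg in auto)
qed

text \<open>\<open>cvec_space n\<close> and \<open>module_vec\<close> are different records with the
  same vector operations, so linear combinations and spans agree and the unit vectors
  generate.\<close>

lemma fin_dim_cvec_space: "vectorspace.fin_dim class_ring (cvec_space n)"
proof -
  interpret vs: vectorspace class_ring "cvec_space n" by (rule vectorspace_cvec_space)
  interpret V: vec_space "TYPE(complex)" n .
  have lin: "vs.lincomb a S = V.lincomb a S" for a S
    unfolding vs.lincomb_def V.lincomb_def finsum_def finprod_def
    by (simp add: module_vec_simps)
  have "vs.span (set (unit_vecs n)) = V.span (set (unit_vecs n))"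
    unfolding vs.span_def V.span_def lin by simp
  then have "vs.gen_set (set (unit_vecs n))"
    using V.span_unit_vecs_is_carrier by (simp add: module_vec_simps)
  then show ?thesis
    unfolding vs.fin_dim_def using unit_vecs_carrier
    by (intro exI[of _ "set (unit_vecs n)"]) (auto simp: module_vec_simps)
qed

text \<open>Induction on the number \<open>k\<close> of leading coordinates of \<open>x\<close> that
  are kept while the others are set to 0.\<close>

lemma cvec_hom_eq_mat:
  assumes T: "T \<in> module_hom class_ring (cvec_space n) (cvec_space n)" and x: "x \<in> carrier_vec n"
  shows "T x = mat n n (\<lambda>(i, j). T (unit_vec n j) $ i) *\<^sub>v x"
proof -
  have Tc: "T x \<in> carrier_vec n" if "x \<in> carrier_vec n" for x
    using module_homD(1)[OF T] that by simp
  have Tadd: "T (x + y) = T x + T y" if "x \<in> carrier_vec n" "y \<in> carrier_vec n" for x y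
    using module_homD(2)[OF T] that by simp
  have Tsm: "T (c \<cdot>\<^sub>v x) = c \<cdot>\<^sub>v T x" if "x \<in> carrier_vec n" for c x
    using module_homD(3)[OF T] that by simp
  define A where "A = mat n n (\<lambda>(i, j). T (unit_vec n j) $ i)"
  have A: "A \<in> carrier_mat n n" by (simp add: A_def)
  have "T (vec n (\<lambda>i. if i < k then x $ i else 0)) = vec n (\<lambda>i. \<Sum>j<k. A $$ (i, j) * x $ j)"
    if "k \<le> n" for k
    using that
  proof (induction k)
    case 0
    have "T (0 \<cdot>\<^sub>v 0\<^sub>v n) = 0 \<cdot>\<^sub>v T (0\<^sub>v n)" by (rule Tsm) simp
    moreover have "0 \<cdot>\<^sub>v T (0\<^sub>v n) = 0\<^sub>v n" using Tc[of "0\<^sub>v n"] by (intro eq_vecI) auto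
    moreover have "(0::complex) \<cdot>\<^sub>v 0\<^sub>v n = 0\<^sub>v n" by (intro eq_vecI) auto
    ultimately have "T (0\<^sub>v n) = 0\<^sub>v n" by simp
    then show ?case by (simp add: zero_vec_def)
  next
    case (Suc k)
    have "vec n (\<lambda>i. if i < Suc k then x $ i else 0)
        = vec n (\<lambda>i. if i < k then x $ i else 0) + x $ k \<cdot>\<^sub>v unit_vec n k"
      using Suc.prems by (intro eq_vecI) (auto simp: less_Suc_eq)
    then have "T (vec n (\<lambda>i. if i < Suc k then x $ i else 0))
        = vec n (\<lambda>i. \<Sum>j<k. A $$ (i, j) * x $ j) + x $ k \<cdot>\<^sub>v T (unit_vec n k)"
      using Suc by (simp add: Tadd Tsm)
    also have "\<dots> = vec n (\<lambda>i. \<Sum>j<Suc k. A $$ (i, j) * x $ j)"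
      using Suc.prems Tc[of "unit_vec n k"] by (intro eq_vecI) (auto simp: A_def)
    finally show ?case .
  qed
  from this[of n] have "T (vec n (\<lambda>i. if i < n then x $ i else 0)) = vec n (\<lambda>i. \<Sum>j<n. A $$ (i, j) * x $ j)"
    by simp
  moreover have "vec n (\<lambda>i. if i < n then x $ i else 0) = x" using x by (intro eq_vecI) auto
  moreover have "vec n (\<lambda>i. \<Sum>j<n. A $$ (i, j) * x $ j) = A *\<^sub>v x"
    using A x by (intro eq_vecI) (auto simp: scalar_prod_def lessThan_atLeast0)
  ultimately show ?thesis by (simp add: A_def)
qed

text \<open>A trivial kernel makes the determinant of the matrix nonzero, so the matrix has a right
  inverse.\<close>

lemma injective_imp_surjective_cvec_space:
  assumes T: "T \<in> module_hom class_ring (cvec_space n) (cvec_space n)"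
    and inj: "\<And>x. x \<in> carrier_vec n \<Longrightarrow> T x = 0\<^sub>v n \<Longrightarrow> x = 0\<^sub>v n"
    and y: "y \<in> carrier_vec n"
  shows "\<exists>x\<in>carrier_vec n. T x = y"
proof -
  define A where "A = mat n n (\<lambda>(i, j). T (unit_vec n j) $ i)"
  have A: "A \<in> carrier_mat n n" by (simp add: A_def)
  have TA: "T x = A *\<^sub>v x" if "x \<in> carrier_vec n" for x
    unfolding A_def by (rule cvec_hom_eq_mat[OF T that])
  have "det A \<noteq> 0"
    unfolding det_0_iff_vec_prod_zero_field[OF A] using inj TA by auto
  then have "A \<in> Units (ring_mat TYPE(complex) n ())"
    by (rule det_non_zero_imp_unit[OF A])
  then obtain B where B: "B \<in> carrier_mat n n" "A * B = 1\<^sub>m n"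
    by (auto simp: Units_def ring_mat_def)
  have "T (B *\<^sub>v y) = y"
    using B y A by (simp add: TA assoc_mult_mat_vec[symmetric])
  then show ?thesis using B y by (intro bexI[of _ "B *\<^sub>v y"]) auto
qed

section \<open>Compressing unitaries to finite dimensional spaces\<close>

lemma norm_power_ineq_cstar: "norm (x ^ n) \<le> norm (x::'a::cstar_algebra) ^ n"
proof (induction n)
  case (Suc n)
  have "norm (x ^ Suc n) \<le> norm x * norm (x ^ n)" by (simp add: norm_mult_ineq)
  also have "\<dots> \<le> norm x * norm x ^ n" by (intro mult_left_mono Suc) simp
  finally show ?case by simp
qed (simp add: norm_one_le)

lemma neumann_inverse:
  fixes x :: "'a::cstar_algebra"
  assumes "norm x < 1"
  shows "\<exists>r. (1 - x) * r = 1 \<and> r * (1 - x) = 1"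
proof -
  have s: "summable (\<lambda>n. x ^ n)"
    by (rule summable_comparison_test'[of "\<lambda>n. norm x ^ n"])
       (use assms norm_power_ineq_cstar in \<open>auto intro: summable_geometric\<close>)
  define r where "r = (\<Sum>n. x ^ n)"
  have "(\<Sum>n. x ^ Suc n) = r - 1" using suminf_split_head[OF s] by (simp add: r_def)
  moreover have "(\<Sum>n. x ^ Suc n) = x * r" using suminf_mult[OF s, of x] by (simp add: r_def)
  moreover have "(\<Sum>n. x ^ Suc n) = r * x"
    using suminf_mult2[OF s, of x] by (simp add: r_def power_commutes)
  ultimately show ?thesis by (intro exI[of _ r]) (simp add: algebra_simps)
qed

definition unitary :: "'a::cstar_algebra \<Rightarrow> bool" where
  "unitary u \<longleftrightarrow> adj u * u = 1 \<and> u * adj u = 1"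

lemma unitary_cancel:
  assumes "unitary u"
  shows "adj u * (u * x) = x" "u * (adj u * x) = x"
  using assms by (simp_all add: unitary_def mult.assoc[symmetric])

lemma unitary_one: "unitary 1" by (simp add: unitary_def)

lemma unitary_adj: "unitary u \<Longrightarrow> unitary (adj u)" by (simp add: unitary_def)

lemma unitary_mult: "unitary u \<Longrightarrow> unitary v \<Longrightarrow> unitary (u * v)"
  by (simp add: unitary_def adj_mult) (metis mult.assoc mult_1_right)

lemma unitary_power: "unitary u \<Longrightarrow> unitary (u ^ n)"
  by (induction n) (simp_all add: unitary_one unitary_mult)

lemma unitary_norm_le: "unitary u \<Longrightarrow> norm u \<le> 1"
  using norm_adj_mult_self[of u] norm_one_le[where 'a='a]
  by (metis abs_norm_cancel one_power2 power2_le_iff_abs_le unitary_def zero_le_one)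

lemma norm_unitary_mult_le:
  assumes "unitary u" shows "norm (u * x) \<le> norm x" "norm (x * u) \<le> norm x"
  using unitary_norm_le[OF assms] norm_mult_ineq[of u x] norm_mult_ineq[of x u]
    mult_right_mono[of "norm u" 1 "norm x"] mult_left_mono[of "norm u" 1 "norm x"] by auto

lemma hnorm_cvec_minus_commute: "x \<in> carrier_vec n \<Longrightarrow> y \<in> carrier_vec n \<Longrightarrow>
    hnorm (cvec_space n) (x - y) = hnorm (cvec_space n) (y - x)"
  by (simp add: hnorm_cvec_space norm_minus_commute)

lemma hnorm_cvec_minus_le:
  assumes "x \<in> carrier_vec n" "y \<in> carrier_vec n"
  shows "hnorm (cvec_space n) (x - y) \<le> hnorm (cvec_space n) x + hnorm (cvec_space n) y"
proof -
  interpret hilbert_space "cvec_space n" by (rule hilbert_space_cvec_space)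
  have "x - y = x + (-1) \<cdot>\<^sub>v y" using assms by (intro eq_vecI) auto
  then show ?thesis using hnorm_triangle[of x "(-1) \<cdot>\<^sub>v y"] hnorm_smult[of y "-1"] assms by simp
qed

lemma hnorm_cvec_power2: "(hnorm (cvec_space n) v)\<^sup>2 = Re (ip (cvec_space n) v v)"
  by (simp add: hnorm_def ip_cvec_space sum_nonneg)

section \<open>Coordinates, and compressions of unitaries in them\<close>

context positive_functional
begin

lemma sq_mult_null: "sq n = 0 \<Longrightarrow> sq (a * n) = 0"
  using sq_mult_le[of a n] sq_nonneg[of "a * n"] by simp

lemma sq_unitary: "unitary u \<Longrightarrow> sq (u * x) = sq x"
  by (simp add: sq_unitary_mult unitary_def)

text \<open>\<open>coord\<close> and \<open>emb\<close> are adjoint to each other. For an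
  orthonormal family \<open>emb\<close> is isometric, and \<open>coord\<close> followed by
  \<open>emb\<close> is the orthogonal projection onto the span.\<close>

definition coord :: "nat \<Rightarrow> (nat \<Rightarrow> 'a) \<Rightarrow> 'a \<Rightarrow> complex vec" where
  "coord d e x = vec d (\<lambda>i. gns x (e i))"

definition emb :: "nat \<Rightarrow> (nat \<Rightarrow> 'a) \<Rightarrow> complex vec \<Rightarrow> 'a" where
  "emb d e v = (\<Sum>i<d. v $ i *\<^sub>C e i)"

lemma coord_carrier [simp]: "coord d e x \<in> carrier_vec d"
  by (simp add: coord_def)

lemma coord_add: "coord d e (x + y) = coord d e x + coord d e y"
  by (intro eq_vecI) (simp_all add: coord_def gns_add_left)

lemma coord_scaleC: "coord d e (c *\<^sub>C x) = c \<cdot>\<^sub>v coord d e x"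
  by (intro eq_vecI) (simp_all add: coord_def gns_scaleC_left)

lemma coord_diff: "coord d e (x - y) = coord d e x - coord d e y"
  by (intro eq_vecI) (simp_all add: coord_def gns_diff_left)

lemma coord_null: "sq n = 0 \<Longrightarrow> coord d e n = 0\<^sub>v d"
  by (intro eq_vecI) (simp_all add: coord_def gns_null)

lemma emb_add: "v \<in> carrier_vec d \<Longrightarrow> w \<in> carrier_vec d \<Longrightarrow> emb d e (v + w) = emb d e v + emb d e w"
  by (simp add: emb_def scaleC_add_left sum.distrib)

lemma scaleC_sum_right: "c *\<^sub>C (\<Sum>i\<in>I. f i) = (\<Sum>i\<in>I. c *\<^sub>C f i)"
  by (induction I rule: infinite_finite_induct) (simp_all add: scaleC_add_right)

lemma emb_smult: "v \<in> carrier_vec d \<Longrightarrow> emb d e (c \<cdot>\<^sub>v v) = c *\<^sub>C emb d e v"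
  by (simp add: emb_def scaleC_scaleC scaleC_sum_right)

lemma ip_coord_left: "ip (cvec_space d) (coord d e x) v = gns x (emb d e v)"
  by (simp add: ip_cvec_space coord_def emb_def gns_sum_right gns_scaleC_right mult.commute)

lemma ip_coord_right: "ip (cvec_space d) v (coord d e x) = gns (emb d e v) x"
  unfolding emb_def gns_sum_left gns_scaleC_left ip_cvec_space
  by (intro sum.cong) (simp_all add: coord_def gns_commute[of _ x])

lemma gns_emb:
  assumes "orthonormal d e"
  shows "gns (emb d e v) (emb d e w) = ip (cvec_space d) v w"
proof -
  have "gns (e i) (emb d e w) = cnj (w $ i)" if "i < d" for i
  proof -
    have "gns (e i) (emb d e w) = (\<Sum>j<d. cnj (w $ j) * gns (e i) (e j))"
      by (simp add: emb_def gns_sum_right gns_scaleC_right)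
    also have "\<dots> = (\<Sum>j<d. if i = j then cnj (w $ j) else 0)"
      using assms that by (intro sum.cong) (auto simp: orthonormal_def)
    finally show ?thesis using that by simp
  qed
  then show ?thesis
    unfolding emb_def[of d e v] gns_sum_left gns_scaleC_left ip_cvec_space by (intro sum.cong) simp_all
qed

lemma spanned_iff: "spanned d e x \<longleftrightarrow> sq (x - emb d e (coord d e x)) = 0"
  by (simp add: spanned_def emb_def coord_def)

lemma spanned_add:
  assumes "spanned d e x" "spanned d e y"
  shows "spanned d e (x + y)"
proof -
  have eq: "x + y - emb d e (coord d e (x + y))
      = (x - emb d e (coord d e x)) + (y - emb d e (coord d e y))"
    by (simp add: coord_add emb_add)
  show ?thesis using assms unfolding spanned_iff eq by (simp only: sq_add_null)
qed

lemma ip_coord_spanned: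
  assumes "spanned d e x"
  shows "ip (cvec_space d) (coord d e x) (coord d e y) = gns x y"
  using assms gns_null(1)[of "x - emb d e (coord d e x)" y]
  by (simp add: ip_coord_right gns_diff_left spanned_iff)

lemma hnorm_coord_spanned: "spanned d e x \<Longrightarrow> (hnorm (cvec_space d) (coord d e x))\<^sup>2 = sq x"
  by (simp add: hnorm_cvec_power2 ip_coord_spanned sq_def)

lemma sq_emb: "orthonormal d e \<Longrightarrow> sq (emb d e v) = (hnorm (cvec_space d) v)\<^sup>2"
  by (simp add: sq_def gns_emb hnorm_cvec_power2)

text \<open>Bessel's inequality, from the nonnegative seminorm of \<open>x\<close> minus its
  projection.\<close>

lemma hnorm_coord_le:
  assumes e: "orthonormal d e"
  shows "(hnorm (cvec_space d) (coord d e x))\<^sup>2 \<le> sq x"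
proof -
  let ?v = "coord d e x"
  have "0 \<le> sq (x - emb d e ?v)" by (rule sq_nonneg)
  also have "\<dots> = sq x + sq (emb d e ?v) - 2 * Re (gns x (emb d e ?v))"
    using gns_commute[of x "emb d e ?v"] by (simp add: sq_def gns_diff_left gns_diff_right)
  also have "gns x (emb d e ?v) = ip (cvec_space d) ?v ?v" by (simp add: ip_coord_left)
  finally show ?thesis by (simp add: sq_emb[OF e] hnorm_cvec_power2)
qed

text \<open>A spanned \<open>x\<close> differs from its projection by a null vector; multiplication
  by \<open>a\<close> keeps it null (\<open>sq_mult_null\<close>), and \<open>coord\<close> kills
  null vectors.\<close>

lemma coord_mult_emb_coord:
  assumes "spanned d e x"
  shows "coord d e (a * emb d e (coord d e x)) = coord d e (a * x)"
proof -
  have "sq (a * (x - emb d e (coord d e x))) = 0"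
    using assms by (intro sq_mult_null) (simp add: spanned_iff)
  then have zero: "coord d e (a * x) - coord d e (a * emb d e (coord d e x)) = 0\<^sub>v d"
    by (simp add: coord_null coord_diff[symmetric] right_diff_distrib[symmetric])
  show ?thesis
  proof (rule eq_vecI)
    fix i assume "i < dim_vec (coord d e (a * x))"
    then have i: "i < d" by (simp add: coord_def)
    then show "coord d e (a * emb d e (coord d e x)) $ i = coord d e (a * x) $ i"
      using arg_cong[OF zero, of "\<lambda>v. v $ i"] by (simp add: coord_def)
  qed (simp add: coord_def)
qed

text \<open>
  For \<open>\<epsilon> < 2\<close> the Cayley transform \<open>K\<close> of \<open>W\<close> exists and is self-adjoint, and \<open>Q\<close> is the inverse
  Cayley transform of its compression. This agrees with \<open>W\<close> on \<open>E\<close> since \<open>K (1 + W) x = \<i> (1 - W) x\<close>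
  stays in the span for \<open>x \<in> E\<close>.
\<close>

lemma compress_unitary:
  assumes e: "orthonormal d e" and W: "unitary W" and bound: "norm (W - 1) \<le> \<epsilon>"
    and E: "finite E" and span: "\<And>x. x \<in> E \<Longrightarrow> spanned d e x \<and> spanned d e (W * x)"
  shows "\<exists>Q. isometry_op (cvec_space d) Q \<and> (\<forall>x\<in>E. Q (coord d e x) = coord d e (W * x)) \<and>
     (\<forall>v\<in>carrier_vec d. hnorm (cvec_space d) (Q v - v) \<le> \<epsilon> * hnorm (cvec_space d) v)"
proof -
  let ?H = "cvec_space d"
  interpret H: hilbert_space "cvec_space d" by (rule hilbert_space_cvec_space)
  have \<epsilon>0: "\<epsilon> \<ge> 0" using bound norm_ge_zero order_trans by blast
  show ?thesis
  proof (cases "\<epsilon> \<ge> 2")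
    \<comment> \<open>Here the bound on Q v - v holds for every isometry, so it is enough to match
      the Gram matrices.\<close>
    case True
    have "\<exists>Q. isometry_op ?H Q \<and> (\<forall>x\<in>E. Q (coord d e x) = coord d e (W * x))"
    proof (rule H.isometry_from_gram[OF E])
      fix x y assume "x \<in> E" "y \<in> E"
      then show "ip ?H (coord d e x) (coord d e y) = ip ?H (coord d e (W * x)) (coord d e (W * y))"
        using span by (simp add: ip_coord_spanned gns_mult_left unitary_cancel[OF W])
    qed auto
    then obtain Q where Q: "isometry_op ?H Q" "\<forall>x\<in>E. Q (coord d e x) = coord d e (W * x)" by blast
    have "hnorm ?H (Q v - v) \<le> \<epsilon> * hnorm ?H v" if v: "v \<in> carrier_vec d" for v
    proof -
      have "hnorm ?H (Q v - v) \<le> hnorm ?H (Q v) + hnorm ?H v"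
        using isometry_opD(1)[OF Q(1), of v] v by (intro hnorm_cvec_minus_le) simp_all
      also have "\<dots> = 2 * hnorm ?H v" using isometry_op_hnorm[OF Q(1), of v] v by simp
      also have "\<dots> \<le> \<epsilon> * hnorm ?H v" using True H.hnorm_nonneg[of v] v by (simp add: mult_right_mono)
      finally show ?thesis .
    qed
    then show ?thesis using Q by blast
  next
    case False
    then have \<epsilon>2: "\<epsilon> < 2" by simp
    \<comment> \<open>Since 1 - (1 - W)/2 = (1 + W)/2 and norm(1 - W) < 2, the Neumann series yields
      the inverse \<open>R\<close> of 1 + W.\<close>
    have "norm ((1/2) *\<^sub>R (1 - W)) < 1" using bound \<epsilon>2 by (simp add: norm_minus_commute)
    then obtain r where r: "(1 - (1/2) *\<^sub>R (1 - W)) * r = 1" "r * (1 - (1/2) *\<^sub>R (1 - W)) = 1"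
      using neumann_inverse by blast
    define R where "R = (1/2) *\<^sub>R r"
    have half: "1 - (1/2) *\<^sub>R (1 - W) = (1/2) *\<^sub>R (1 + W)"
    proof -
      have "1 - (1/2) *\<^sub>R (1 - W) = (1 - (1/2) *\<^sub>R 1) + (1/2) *\<^sub>R W" by (simp add: scaleR_diff_right)
      also have "1 - (1/2) *\<^sub>R 1 = (1/2) *\<^sub>R (1::'a)" by (simp flip: scaleR_left_diff_distrib[of 1 "1/2" "1::'a", simplified])
      finally show ?thesis by (simp add: scaleR_add_right)
    qed
    have R: "(1 + W) * R = 1" "R * (1 + W) = 1" using r by (simp_all add: half R_def)
    define K where "K = \<i> *\<^sub>C ((1 - W) * R)"
    have adjK: "adj K = K"
    proof -
      have aR: "adj R * (1 + adj W) = 1"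
        using arg_cong[OF R(1), of adj] by (simp add: adj_mult adj_add)
      \<comment> \<open>Both sides equal W* - W. Multiplied by the inverses of 1 + W* and 1 + W this
        becomes self-adjointness of \<open>K\<close>.\<close>
      have "(adj W - 1) * (1 + W) = (1 + adj W) * (1 - W)"
        using W by (simp add: unitary_def algebra_simps)
      then have "adj R * ((adj W - 1) * (1 + W)) * R = adj R * ((1 + adj W) * (1 - W)) * R" by simp
      moreover have "adj R * ((adj W - 1) * (1 + W)) * R = adj R * (adj W - 1)"
        using R(1) by (simp add: mult.assoc)
      moreover have "adj R * ((1 + adj W) * (1 - W)) * R = (1 - W) * R"
        using aR by (simp add: mult.assoc[symmetric])
      ultimately have "adj R * (adj W - 1) = (1 - W) * R" by simp
      moreover have "adj K = \<i> *\<^sub>C (adj R * (adj W - 1))"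
        by (simp add: K_def adj_scaleC adj_mult adj_diff scaleC_minus_left scaleC_minus_right[symmetric]
            algebra_simps)
      ultimately show ?thesis by (simp add: K_def)
    qed
    define k where "k = (\<lambda>v. coord d e (K * emb d e v))"
    have kc: "k v \<in> carrier_vec d" for v by (simp add: k_def)
    have k_hom: "k \<in> module_hom class_ring ?H ?H"
      by (rule module_homI)
         (simp_all add: k_def emb_add emb_smult distrib_left coord_add mult_scaleC_right coord_scaleC)
    have k_sym: "ip ?H (k v) w = ip ?H v (k w)" for v w
      by (simp add: k_def ip_coord_left ip_coord_right gns_mult_left adjK)
    have surj: "\<exists>x\<in>carrier ?H. x \<oplus>\<^bsub>?H\<^esub> (- \<i>) \<odot>\<^bsub>?H\<^esub> k x = y" if "y \<in> carrier ?H" for y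
    proof -
      have "(\<lambda>x. x + (- \<i>) \<cdot>\<^sub>v k x) \<in> module_hom class_ring ?H ?H"
      proof (rule module_homI)
        fix x y assume xy: "x \<in> carrier ?H" "y \<in> carrier ?H"
        then have "k (x + y) = k x + k y" using module_homD(2)[OF k_hom, of x y] by simp
        then show "x \<oplus>\<^bsub>?H\<^esub> y + (- \<i>) \<cdot>\<^sub>v k (x \<oplus>\<^bsub>?H\<^esub> y) = x + (- \<i>) \<cdot>\<^sub>v k x \<oplus>\<^bsub>?H\<^esub> (y + (- \<i>) \<cdot>\<^sub>v k y)"
          using xy kc[of x] kc[of y] by (intro eq_vecI) (auto simp: algebra_simps)
      next
        fix c x assume x: "x \<in> carrier ?H"
        then have "k (c \<cdot>\<^sub>v x) = c \<cdot>\<^sub>v k x" using module_homD(3)[OF k_hom, of c x] by simp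
        then show "c \<odot>\<^bsub>?H\<^esub> x + (- \<i>) \<cdot>\<^sub>v k (c \<odot>\<^bsub>?H\<^esub> x) = c \<odot>\<^bsub>?H\<^esub> (x + (- \<i>) \<cdot>\<^sub>v k x)"
          using x kc[of x] by (intro eq_vecI) (auto simp: algebra_simps)
      qed (use kc in simp)
      moreover have "x = 0\<^sub>v d" if "x \<in> carrier_vec d" "x + (- \<i>) \<cdot>\<^sub>v k x = 0\<^sub>v d" for x
        using H.cayley_injective[OF k_hom, of x] k_sym that by simp
      ultimately show ?thesis
        using injective_imp_surjective_cvec_space[of "\<lambda>x. x + (- \<i>) \<cdot>\<^sub>v k x" d y] that by simp
    qed
    obtain Q where Q: "isometry_op ?H Q"
      and Qk: "\<And>x. x \<in> carrier_vec d \<Longrightarrow> Q (x + (- \<i>) \<cdot>\<^sub>v k x) = x + \<i> \<cdot>\<^sub>v k x"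
      using H.cayley_isometry[OF k_hom k_sym surj] by auto
    have "Q (coord d e x) = coord d e (W * x)" if x: "x \<in> E" for x
    proof -
      \<comment> \<open>On g = (1 + W) x the transform acts as K g = i (1 - W) x, so that (1 - iK) g
        = 2 x and (1 + iK) g = 2 W x. As \<open>g\<close> is spanned, the same holds for
        \<open>k\<close> in coordinates, and \<open>Q\<close> maps 2 x to 2 W x.\<close>
      let ?g = "x + W * x"
      have g: "spanned d e ?g" using span[OF x] by (intro spanned_add) auto
      have "K * ?g = \<i> *\<^sub>C ((1 - W) * (R * (1 + W)) * x)"
        by (simp add: K_def mult_scaleC_left distrib_left distrib_right mult.assoc scaleC_add_right)
      then have Kg: "K * ?g = \<i> *\<^sub>C (x - W * x)" by (simp add: R left_diff_distrib)
      have kg: "k (coord d e ?g) = \<i> \<cdot>\<^sub>v coord d e (x - W * x)"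
        by (simp add: k_def coord_mult_emb_coord[OF g] Kg coord_scaleC)
      have "coord d e ?g + (- \<i>) \<cdot>\<^sub>v k (coord d e ?g) = 2 \<cdot>\<^sub>v coord d e x"
        unfolding kg by (intro eq_vecI) (simp_all add: coord_def gns_add_left gns_diff_left)
      moreover have "coord d e ?g + \<i> \<cdot>\<^sub>v k (coord d e ?g) = 2 \<cdot>\<^sub>v coord d e (W * x)"
        unfolding kg by (intro eq_vecI) (simp_all add: coord_def gns_add_left gns_diff_left)
      ultimately have "Q (2 \<cdot>\<^sub>v coord d e x) = 2 \<cdot>\<^sub>v coord d e (W * x)"
        using Qk[of "coord d e ?g"] by simp
      moreover have "Q (2 \<cdot>\<^sub>v coord d e x) = 2 \<cdot>\<^sub>v Q (coord d e x)"
        using isometry_opD(3)[OF Q, of "coord d e x" 2] by simp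
      ultimately have "(1/2) \<cdot>\<^sub>v (2 \<cdot>\<^sub>v Q (coord d e x)) = (1/2) \<cdot>\<^sub>v (2 \<cdot>\<^sub>v coord d e (W * x))" by simp
      then show ?thesis by (simp add: smult_smult_assoc)
    qed
    moreover have "hnorm ?H (Q v - v) \<le> \<epsilon> * hnorm ?H v" if v: "v \<in> carrier_vec d" for v
    proof -
      obtain x where x: "x \<in> carrier_vec d" "v = x + (- \<i>) \<cdot>\<^sub>v k x" using surj[of v] v by auto
      \<comment> \<open>For v = (1 - ik) x the difference Q v - v is 2i k x. The claim thus becomes
        4 |k x|^2 <= eps^2 (|x|^2 + |k x|^2), with eps for \<open>\<epsilon>\<close>.\<close>
      have "Q v - v = (2 * \<i>) \<cdot>\<^sub>v k x"
        unfolding x(2) Qk[OF x(1)] using x(1) kc[of x] by (intro eq_vecI) auto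
      then have Qv: "hnorm ?H (Q v - v) = 2 * hnorm ?H (k x)"
        using H.hnorm_smult[of "k x" "2 * \<i>"] kc[of x] by (simp add: norm_mult)
      have v2: "(hnorm ?H v)\<^sup>2 = (hnorm ?H x)\<^sup>2 + (hnorm ?H (k x))\<^sup>2"
        using H.cayley_ip[OF k_hom k_sym, of x x "- \<i>"] x by (simp add: hnorm_cvec_power2)
      let ?y = "emb d e x"
      let ?z = "R * ?y"
      have y: "?y = ?z + W * ?z"
        using R(1) by (simp add: mult.assoc[symmetric] distrib_right[symmetric]) (simp add: distrib_right)
      have Ky: "K * ?y = \<i> *\<^sub>C (?z - W * ?z)"
        by (simp add: K_def mult_scaleC_left left_diff_distrib mult.assoc)
      have s1: "sq (K * ?y) = sq (?z - W * ?z)" by (simp add: Ky sq_scaleC)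
      have "sq (?z - W * ?z) = sq ((1 - W) * ?z)" by (simp add: left_diff_distrib)
      also have "\<dots> \<le> (norm (1 - W))\<^sup>2 * sq ?z" by (rule sq_mult_le)
      also have "\<dots> \<le> \<epsilon>\<^sup>2 * sq ?z"
        using bound by (intro mult_right_mono power_mono sq_nonneg) (simp_all add: norm_minus_commute)
      finally have s2: "sq (K * ?y) \<le> \<epsilon>\<^sup>2 * sq ?z" by (simp add: s1)
      \<comment> \<open>The parallelogram law for z and W z, where y = z + W z and K y = i (z - W
        z). Together with \<open>s2\<close> it gives the wanted inequality for \<open>K\<close> in
        place of its compression.\<close>
      have "4 * sq ?z = sq ?y + sq (K * ?y)"
        using sq_parallelogram[of ?z "W * ?z"] by (simp add: s1 y[symmetric] sq_unitary[OF W])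
      then have s3: "4 * sq (K * ?y) \<le> \<epsilon>\<^sup>2 * (sq ?y + sq (K * ?y))"
        using s2 by (simp flip: \<open>4 * sq ?z = sq ?y + sq (K * ?y)\<close>)
      have kx: "(hnorm ?H (k x))\<^sup>2 \<le> sq (K * ?y)" unfolding k_def by (rule hnorm_coord_le[OF e])
      \<comment> \<open>With the terms in \<open>K\<close> collected on one side the coefficient 4 -
        eps^2 is nonnegative, so the smaller seminorm of the compression may be inserted.\<close>
      have "\<epsilon>\<^sup>2 \<le> 4" using power_mono[of \<epsilon> 2 2] \<epsilon>2 \<epsilon>0 by simp
      then have "(4 - \<epsilon>\<^sup>2) * (hnorm ?H (k x))\<^sup>2 \<le> (4 - \<epsilon>\<^sup>2) * sq (K * ?y)"
        using kx by (intro mult_left_mono) simp_all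
      also have "\<dots> \<le> \<epsilon>\<^sup>2 * sq ?y" using s3 by (simp add: algebra_simps)
      also have "\<dots> = \<epsilon>\<^sup>2 * (hnorm ?H x)\<^sup>2" by (simp add: sq_emb[OF e])
      finally have "4 * (hnorm ?H (k x))\<^sup>2 \<le> \<epsilon>\<^sup>2 * ((hnorm ?H x)\<^sup>2 + (hnorm ?H (k x))\<^sup>2)"
        by (simp only: left_diff_distrib distrib_left)
      then have "(2 * hnorm ?H (k x))\<^sup>2 \<le> (\<epsilon> * hnorm ?H v)\<^sup>2"
        by (simp only: power_mult_distrib v2) simp
      then have "2 * hnorm ?H (k x) \<le> \<epsilon> * hnorm ?H v"
        by (rule power2_le_imp_le) (use \<epsilon>0 H.hnorm_nonneg[of v] v in simp)
      then show ?thesis by (simp add: Qv)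
    qed
    ultimately show ?thesis using Q by blast
  qed
qed

text \<open>Consecutive conjugates \<open>u n\<close> differ by a left factor \<open>?W\<close>
  whose distance from 1 is at most the norm of the commutator. The first conjugate is compressed by
  its Gram matrix alone; each further compression is the preceding one followed by a compression of
  \<open>?W\<close> that is prescribed on the vectors already reached. Composing with an isometry
  does not change the bound for the step.\<close>

lemma compress_conjugates:
  assumes U: "unitary U" and V: "unitary V" and bound: "norm (U * V - V * U) \<le> \<epsilon>"
    and E: "finite E"
  shows "\<exists>d e Q. orthonormal d e \<and>
     (\<forall>n<M. \<forall>x\<in>E. spanned d e (adj V ^ n * x)) \<and>
     (\<forall>n. isometry_op (cvec_space d) (Q n)) \<and>
     (\<forall>n<M. \<forall>v\<in>carrier_vec d. hnorm (cvec_space d) (Q (Suc n) v - Q n v) \<le> \<epsilon> * hnorm (cvec_space d) v) \<and>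
     (\<forall>n<M. \<forall>x\<in>E. Q n (coord d e (adj V ^ n * x)) = coord d e (adj V ^ n * (U * x)))"
proof -
  define u where "u = (\<lambda>n. adj V ^ n * U * V ^ n)"
  have uni: "unitary (adj V ^ n)" "unitary (V ^ n)" for n
    by (simp_all add: unitary_power unitary_adj V)
  then have u: "unitary (u n)" for n by (simp add: u_def unitary_mult U)
  have VV: "V ^ n * adj V ^ n = 1" for n
    using uni(2)[of n] by (simp add: unitary_def adj_power)
  have u_mult: "u n * (adj V ^ n * x) = adj V ^ n * (U * x)" for n x
  proof -
    have "u n * (adj V ^ n * x) = adj V ^ n * U * (V ^ n * adj V ^ n) * x" by (simp add: u_def mult.assoc)
    then show ?thesis by (simp add: VV mult.assoc)
  qed
  have step: "norm (u (Suc n) * adj (u n) - 1) \<le> \<epsilon>" for n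
  proof -
    have "u (Suc n) = adj V ^ n * (adj V * U * V) * V ^ n"
      by (simp add: u_def power_commutes mult.assoc) (simp add: mult.assoc[symmetric] power_commutes)
    moreover have "adj V * U * V - U = adj V * (U * V - V * U)"
      by (simp add: right_diff_distrib unitary_cancel[OF V] mult.assoc)
    ultimately have "u (Suc n) - u n = adj V ^ n * (adj V * (U * V - V * U)) * V ^ n"
      by (metis u_def left_diff_distrib right_diff_distrib)
    moreover have "u (Suc n) * adj (u n) - 1 = (u (Suc n) - u n) * adj (u n)"
      using u[of n] by (simp add: unitary_def left_diff_distrib)
    ultimately have "u (Suc n) * adj (u n) - 1 = adj V ^ n * (adj V * (U * V - V * U)) * V ^ n * adj (u n)"
      by simp
    also have "norm \<dots> \<le> norm (U * V - V * U)"
      using norm_unitary_mult_le(2)[OF unitary_adj[OF u]] norm_unitary_mult_le(2)[OF uni(2)]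
        norm_unitary_mult_le(1)[OF uni(1)] norm_unitary_mult_le(1)[OF unitary_adj[OF V]]
      by (meson order_trans)
    finally show ?thesis using bound by simp
  qed
  \<comment> \<open>\<open>E'\<close> holds the vectors on which all conjugates have to be correct,
    and \<open>B\<close> also their images under \<open>u 0\<close> up to \<open>u M\<close>, so
    that every value prescribed to a compression is spanned.\<close>
  define E' where "E' = (\<Union>n<M. (\<lambda>x. adj V ^ n * x) ` E)"
  define B where "B = E' \<union> (\<Union>n\<le>M. (\<lambda>x. u n * x) ` E')"
  have finE': "finite E'" using E by (simp add: E'_def)
  then have "finite B" by (simp add: B_def)
  then obtain d e where e: "orthonormal d e" and B: "\<And>b. b \<in> B \<Longrightarrow> spanned d e b"
    using exists_orthonormal by blast
  have span_u: "spanned d e (u m * x)" if "x \<in> E'" "m \<le> M" for m x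
    by (rule B) (use that in \<open>auto simp: B_def\<close>)
  let ?H = "cvec_space d"
  interpret H: hilbert_space "cvec_space d" by (rule hilbert_space_cvec_space)
  \<comment> \<open>Beyond \<open>M\<close> nothing but an isometry is demanded, so the recursion
    can continue with the identity.\<close>
  define P where "P = (\<lambda>n Q. isometry_op ?H Q \<and> (n \<le> M \<longrightarrow> (\<forall>x\<in>E'. Q (coord d e x) = coord d e (u n * x))))"
  define Rel where "Rel = (\<lambda>n Q Q'. n < M \<longrightarrow>
      (\<forall>v\<in>carrier_vec d. hnorm ?H (Q' v - Q v) \<le> \<epsilon> * hnorm ?H v))"
  have "\<exists>Q. \<forall>n. P n (Q n) \<and> Rel n (Q n) (Q (Suc n))"
  proof (rule dependent_nat_choice)
    have "\<exists>Q. isometry_op ?H Q \<and> (\<forall>x\<in>E'. Q (coord d e x) = coord d e (u 0 * x))"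
    proof (rule H.isometry_from_gram[OF finE'])
      fix x y assume "x \<in> E'" "y \<in> E'"
      then have "spanned d e x" "spanned d e (u 0 * x)" using B by (auto simp: B_def)
      then show "ip ?H (coord d e x) (coord d e y) = ip ?H (coord d e (u 0 * x)) (coord d e (u 0 * y))"
        by (simp add: ip_coord_spanned gns_mult_left unitary_cancel[OF u])
    qed auto
    then show "\<exists>Q. P 0 Q" by (auto simp: P_def)
  next
    fix Q n assume Q: "P n Q"
    show "\<exists>Q'. P (Suc n) Q' \<and> Rel n Q Q'"
    proof (cases "n < M")
      case False
      then show ?thesis using isometry_op_id by (auto simp: P_def Rel_def)
    next
      case True
      let ?W = "u (Suc n) * adj (u n)"
      have Wu: "?W * (u n * x) = u (Suc n) * x" for x
        by (simp add: mult.assoc unitary_cancel[OF u])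
      have "\<exists>Q'. isometry_op ?H Q' \<and> (\<forall>x\<in>(\<lambda>x. u n * x) ` E'. Q' (coord d e x) = coord d e (?W * x)) \<and>
          (\<forall>v\<in>carrier_vec d. hnorm ?H (Q' v - v) \<le> \<epsilon> * hnorm ?H v)"
      proof (rule compress_unitary[OF e _ step])
        show "unitary ?W" by (intro unitary_mult unitary_adj u)
        fix x assume "x \<in> (\<lambda>x. u n * x) ` E'"
        then show "spanned d e x \<and> spanned d e (?W * x)"
          using span_u[of _ n] span_u[of _ "Suc n"] True by (auto simp: Wu)
      qed (use finE' in simp)
      then obtain Q' where Q': "isometry_op ?H Q'"
        "\<And>x. x \<in> E' \<Longrightarrow> Q' (coord d e (u n * x)) = coord d e (u (Suc n) * x)"
        "\<And>v. v \<in> carrier_vec d \<Longrightarrow> hnorm ?H (Q' v - v) \<le> \<epsilon> * hnorm ?H v"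
        by (auto simp: Wu)
      have Qi: "isometry_op ?H Q" using Q by (simp add: P_def)
      have "P (Suc n) (\<lambda>v. Q' (Q v))"
        using Q True Q'(2) isometry_op_compose[OF Q'(1) Qi] by (simp add: P_def)
      moreover have "Rel n Q (\<lambda>v. Q' (Q v))"
        unfolding Rel_def
      proof (intro impI ballI)
        fix v :: "complex vec" assume v: "v \<in> carrier_vec d"
        then have "Q v \<in> carrier_vec d" using isometry_opD(1)[OF Qi, of v] by simp
        then show "hnorm ?H (Q' (Q v) - Q v) \<le> \<epsilon> * hnorm ?H v"
          using Q'(3)[of "Q v"] isometry_op_hnorm[OF Qi, of v] v by simp
      qed
      ultimately show ?thesis by blast
    qed
  qed
  then obtain Q where Q: "\<And>n. P n (Q n)" "\<And>n. Rel n (Q n) (Q (Suc n))" by blast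
  show ?thesis
  proof (intro exI[of _ d] exI[of _ e] exI[of _ Q] conjI allI impI ballI)
    show "orthonormal d e" by (rule e)
    show "isometry_op ?H (Q n)" for n using Q(1)[of n] by (simp add: P_def)
    show "hnorm ?H (Q (Suc n) v - Q n v) \<le> \<epsilon> * hnorm ?H v" if "n < M" "v \<in> carrier_vec d" for n v
      using Q(2)[of n] that by (simp add: Rel_def)
    fix n x assume "n < M" "x \<in> E"
    then have x: "adj V ^ n * x \<in> E'" by (auto simp: E'_def)
    then show "spanned d e (adj V ^ n * x)" using B by (simp add: B_def)
    show "Q n (coord d e (adj V ^ n * x)) = coord d e (adj V ^ n * (U * x))"
      using Q(1)[of n] x \<open>n < M\<close> by (simp add: P_def u_mult)
  qed
qed

end

section \<open>The periodic amplification\<close>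

text \<open>Together with \<open>cat\<close> this encodes the direct sum of \<open>N\<close> copies
  of a coordinate space as a single coordinate space.\<close>

definition block :: "nat \<Rightarrow> complex vec \<Rightarrow> nat \<Rightarrow> complex vec" where
  "block d v n = vec d (\<lambda>l. v $ (n * d + l))"

definition cat :: "nat \<Rightarrow> nat \<Rightarrow> (nat \<Rightarrow> complex vec) \<Rightarrow> complex vec" where
  "cat N d f = vec (N * d) (\<lambda>i. f (i div d) $ (i mod d))"

lemma block_carrier [simp]: "block d v n \<in> carrier_vec d"
  by (simp add: block_def)

lemma cat_carrier [simp]: "cat N d f \<in> carrier_vec (N * d)"
  by (simp add: cat_def)

lemma block_index_less: "n < N \<Longrightarrow> l < d \<Longrightarrow> n * d + l < N * (d::nat)"
  using mult_le_mono1[of "Suc n" N d] by simp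

lemma block_cat: "n < N \<Longrightarrow> f n \<in> carrier_vec d \<Longrightarrow> block d (cat N d f) n = f n"
  by (intro eq_vecI) (auto simp: block_def cat_def block_index_less)

lemma block_add: "v \<in> carrier_vec (N * d) \<Longrightarrow> w \<in> carrier_vec (N * d) \<Longrightarrow> n < N \<Longrightarrow>
    block d (v + w) n = block d v n + block d w n"
  by (intro eq_vecI) (auto simp: block_def block_index_less)

lemma block_smult: "v \<in> carrier_vec (N * d) \<Longrightarrow> n < N \<Longrightarrow> block d (c \<cdot>\<^sub>v v) n = c \<cdot>\<^sub>v block d v n"
  by (intro eq_vecI) (auto simp: block_def block_index_less)

lemma index_div_mod_less:
  assumes "i < N * d"
  shows "i div d < N" "i mod d < (d::nat)"
proof -
  have "d > 0" using assms by (cases d) auto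
  then show "i mod d < d" by simp
  show "i div d < N" using assms by (simp add: less_mult_imp_div_less)
qed

lemma cat_cong: "(\<And>n. n < N \<Longrightarrow> f n = g n) \<Longrightarrow> cat N d f = cat N d g"
  by (intro eq_vecI) (auto simp: cat_def index_div_mod_less)

lemma cat_add:
  assumes "\<And>n. n < N \<Longrightarrow> f n \<in> carrier_vec d" "\<And>n. n < N \<Longrightarrow> g n \<in> carrier_vec d"
  shows "cat N d (\<lambda>n. f n + g n) = cat N d f + cat N d g"
proof (rule eq_vecI)
  fix i assume "i < dim_vec (cat N d f + cat N d g)"
  then have i: "i < N * d" by (simp add: cat_def)
  then show "cat N d (\<lambda>n. f n + g n) $ i = (cat N d f + cat N d g) $ i"
    using index_div_mod_less[OF i] assms(2)[of "i div d"] by (simp add: cat_def carrier_vecD)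
qed (simp add: cat_def)

lemma cat_smult:
  assumes "\<And>n. n < N \<Longrightarrow> f n \<in> carrier_vec d"
  shows "cat N d (\<lambda>n. c \<cdot>\<^sub>v f n) = c \<cdot>\<^sub>v cat N d f"
proof (rule eq_vecI)
  fix i assume "i < dim_vec (c \<cdot>\<^sub>v cat N d f)"
  then have i: "i < N * d" by (simp add: cat_def)
  then show "cat N d (\<lambda>n. c \<cdot>\<^sub>v f n) $ i = (c \<cdot>\<^sub>v cat N d f) $ i"
    using index_div_mod_less[OF i] assms(1)[of "i div d"] by (simp add: cat_def carrier_vecD)
qed (simp add: cat_def)

lemma cat_diff:
  assumes "\<And>n. n < N \<Longrightarrow> f n \<in> carrier_vec d" "\<And>n. n < N \<Longrightarrow> g n \<in> carrier_vec d"
  shows "cat N d (\<lambda>n. f n - g n) = cat N d f - cat N d g"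
proof (rule eq_vecI)
  fix i assume "i < dim_vec (cat N d f - cat N d g)"
  then have i: "i < N * d" by (simp add: cat_def)
  then show "cat N d (\<lambda>n. f n - g n) $ i = (cat N d f - cat N d g) $ i"
    using index_div_mod_less[OF i] assms(2)[of "i div d"] by (simp add: cat_def carrier_vecD)
qed (simp add: cat_def)

lemma ip_cat:
  assumes "\<And>n. n < N \<Longrightarrow> f n \<in> carrier_vec d" "\<And>n. n < N \<Longrightarrow> g n \<in> carrier_vec d"
  shows "ip (cvec_space (N * d)) (cat N d f) (cat N d g) = (\<Sum>n<N. ip (cvec_space d) (f n) (g n))"
proof -
  let ?h = "\<lambda>i. f (i div d) $ (i mod d) * cnj (g (i div d) $ (i mod d))"
  have "ip (cvec_space (N * d)) (cat N d f) (cat N d g) = (\<Sum>i<N * d. ?h i)"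
    by (simp add: ip_cvec_space cat_def)
  also have "\<dots> = (\<Sum>n<N. \<Sum>i\<in>{n * d..<n * d + d}. ?h i)"
    by (rule sum.nat_group[symmetric])
  also have "\<dots> = (\<Sum>n<N. ip (cvec_space d) (f n) (g n))"
  proof (rule sum.cong[OF refl])
    fix n
    have "(\<Sum>i\<in>{n * d..<n * d + d}. ?h i) = (\<Sum>l\<in>{0..<d}. ?h (l + n * d))"
      using sum.shift_bounds_nat_ivl[of ?h 0 "n * d" d] by (simp add: add.commute)
    also have "\<dots> = ip (cvec_space d) (f n) (g n)"
      unfolding ip_cvec_space lessThan_atLeast0 by (intro sum.cong) auto
    finally show "(\<Sum>i\<in>{n * d..<n * d + d}. ?h i) = ip (cvec_space d) (f n) (g n)" .
  qed
  finally show ?thesis .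
qed

lemma cat_block: "v \<in> carrier_vec (N * d) \<Longrightarrow> cat N d (block d v) = v"
  by (intro eq_vecI) (auto simp: cat_def block_def index_div_mod_less)

lemma hnorm_cat:
  assumes "\<And>n. n < N \<Longrightarrow> f n \<in> carrier_vec d"
  shows "(hnorm (cvec_space (N * d)) (cat N d f))\<^sup>2 = (\<Sum>n<N. (hnorm (cvec_space d) (f n))\<^sup>2)"
  by (simp add: hnorm_cvec_power2 ip_cat assms)

lemma ip_block:
  assumes "v \<in> carrier_vec (N * d)" "w \<in> carrier_vec (N * d)"
  shows "(\<Sum>n<N. ip (cvec_space d) (block d v n) (block d w n)) = ip (cvec_space (N * d)) v w"
  using ip_cat[of N "block d v" d "block d w"] assms by (simp add: cat_block)

lemma hnorm_block:
  assumes "v \<in> carrier_vec (N * d)"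
  shows "(\<Sum>n<N. (hnorm (cvec_space d) (block d v n))\<^sup>2) = (hnorm (cvec_space (N * d)) v)\<^sup>2"
  using hnorm_cat[of N "block d v" d] assms by (simp add: cat_block)

section \<open>The cyclic shift and block diagonal isometries\<close>

definition cyc_pred :: "nat \<Rightarrow> nat \<Rightarrow> nat" where
  "cyc_pred N n = (if n = 0 then N - 1 else n - 1)"

lemma cyc_pred_less: "n < N \<Longrightarrow> cyc_pred N n < N"
  by (auto simp: cyc_pred_def)

lemma bij_betw_cyc_pred: "bij_betw (cyc_pred N) {..<N} {..<N}"
  by (rule bij_betwI[where g = "\<lambda>n. if Suc n = N then 0 else Suc n"]) (auto simp: cyc_pred_def)

lemma sum_cyc_pred: "(\<Sum>n<N. f (cyc_pred N n)) = (\<Sum>n<N. f n)"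
  by (rule sum.reindex_bij_betw[OF bij_betw_cyc_pred])

text \<open>The shift moves block n - 1 to position n. This direction fits the embedding
  \<open>J\<close> below, because \<open>adj V ^ n * (V * x)\<close> is
  \<open>adj V ^ (n - 1) * x\<close> for n > 0.\<close>

lemma isometry_shift: "isometry_op (cvec_space (N * d)) (\<lambda>v. cat N d (\<lambda>n. block d v (cyc_pred N n)))"
  unfolding isometry_op_def
proof (intro conjI ballI module_homI)
  fix v w assume v: "v \<in> carrier (cvec_space (N * d))" and w: "w \<in> carrier (cvec_space (N * d))"
  have "cat N d (\<lambda>n. block d (v + w) (cyc_pred N n))
      = cat N d (\<lambda>n. block d v (cyc_pred N n) + block d w (cyc_pred N n))"
    using v w by (intro cat_cong) (simp add: block_add cyc_pred_less)
  then show "cat N d (\<lambda>n. block d (v \<oplus>\<^bsub>cvec_space (N * d)\<^esub> w) (cyc_pred N n))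
      = cat N d (\<lambda>n. block d v (cyc_pred N n)) \<oplus>\<^bsub>cvec_space (N * d)\<^esub> cat N d (\<lambda>n. block d w (cyc_pred N n))"
    by (simp add: cat_add)
  show "ip (cvec_space (N * d)) (cat N d (\<lambda>n. block d v (cyc_pred N n))) (cat N d (\<lambda>n. block d w (cyc_pred N n)))
      = ip (cvec_space (N * d)) v w"
    using v w sum_cyc_pred[of "\<lambda>n. ip (cvec_space d) (block d v n) (block d w n)" N]
    by (simp add: ip_cat ip_block)
next
  fix c v assume v: "v \<in> carrier (cvec_space (N * d))"
  have "cat N d (\<lambda>n. block d (c \<cdot>\<^sub>v v) (cyc_pred N n)) = cat N d (\<lambda>n. c \<cdot>\<^sub>v block d v (cyc_pred N n))"
    using v by (intro cat_cong) (simp add: block_smult cyc_pred_less)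
  then show "cat N d (\<lambda>n. block d (c \<odot>\<^bsub>cvec_space (N * d)\<^esub> v) (cyc_pred N n))
      = c \<odot>\<^bsub>cvec_space (N * d)\<^esub> cat N d (\<lambda>n. block d v (cyc_pred N n))"
    by (simp add: cat_smult)
qed simp

lemma isometry_diagonal:
  assumes Q: "\<And>n. isometry_op (cvec_space d) (Q n)"
  shows "isometry_op (cvec_space (N * d)) (\<lambda>v. cat N d (\<lambda>n. Q n (block d v n)))"
  unfolding isometry_op_def
proof (intro conjI ballI module_homI)
  have Qc: "Q n (block d v n) \<in> carrier_vec d" for n v
    using isometry_opD(1)[OF Q, of "block d v n" n] by simp
  fix v w assume v: "v \<in> carrier (cvec_space (N * d))" and w: "w \<in> carrier (cvec_space (N * d))"
  have "cat N d (\<lambda>n. Q n (block d (v + w) n)) = cat N d (\<lambda>n. Q n (block d v n) + Q n (block d w n))"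
    using v w isometry_opD(2)[OF Q] by (intro cat_cong) (simp add: block_add)
  then show "cat N d (\<lambda>n. Q n (block d (v \<oplus>\<^bsub>cvec_space (N * d)\<^esub> w) n))
      = cat N d (\<lambda>n. Q n (block d v n)) \<oplus>\<^bsub>cvec_space (N * d)\<^esub> cat N d (\<lambda>n. Q n (block d w n))"
    by (simp add: cat_add Qc)
  show "ip (cvec_space (N * d)) (cat N d (\<lambda>n. Q n (block d v n))) (cat N d (\<lambda>n. Q n (block d w n)))
      = ip (cvec_space (N * d)) v w"
    using v w isometry_opD(4)[OF Q] by (simp add: ip_cat Qc ip_block)
next
  have Qc: "Q n (block d v n) \<in> carrier_vec d" for n v
    using isometry_opD(1)[OF Q, of "block d v n" n] by simp
  fix c v assume v: "v \<in> carrier (cvec_space (N * d))"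
  have "cat N d (\<lambda>n. Q n (block d (c \<cdot>\<^sub>v v) n)) = cat N d (\<lambda>n. c \<cdot>\<^sub>v Q n (block d v n))"
    using v isometry_opD(3)[OF Q] by (intro cat_cong) (simp add: block_smult)
  then show "cat N d (\<lambda>n. Q n (block d (c \<odot>\<^bsub>cvec_space (N * d)\<^esub> v) n))
      = c \<odot>\<^bsub>cvec_space (N * d)\<^esub> cat N d (\<lambda>n. Q n (block d v n))"
    by (simp add: cat_smult Qc)
qed simp

text \<open>
  Running through the conjugates \<open>V\<^sup>-\<^sup>n U V\<^sup>n\<close>, \<open>n < M\<close>, forwards and then backwards makes the
  sequence of compressed unitaries periodic, so that the cyclic shift almost commutes with their
  direct sum. The embedding \<open>J\<close> only uses the first half of the period.
\<close>

context positive_functional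
begin

theorem finite_dimensional_approximation:
  assumes U: "unitary U" and V: "unitary V" and bound: "norm (U * V - V * U) \<le> \<epsilon>"
    and E: "finite E" and M: "M > 0"
  shows "\<exists>k J Ut Vt. isometry_op (cvec_space k) Ut \<and> isometry_op (cvec_space k) Vt \<and>
     (\<forall>v\<in>carrier_vec k. hnorm (cvec_space k) (Ut (Vt v) - Vt (Ut v)) \<le> \<epsilon> * hnorm (cvec_space k) v) \<and>
     (\<forall>x. J x \<in> carrier_vec k) \<and> (\<forall>x y. J (x + y) = J x + J y) \<and> (\<forall>c x. J (c *\<^sub>C x) = c \<cdot>\<^sub>v J x) \<and>
     (\<forall>x. (hnorm (cvec_space k) (J x))\<^sup>2 \<le> sq x) \<and>
     (\<forall>x\<in>E. (hnorm (cvec_space k) (J x))\<^sup>2 = sq x) \<and>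
     (\<forall>x\<in>E. Ut (J x) = J (U * x)) \<and>
     (\<forall>x. (hnorm (cvec_space k) (Vt (J x) - J (V * x)))\<^sup>2 \<le> 2 / real M * sq x)"
proof -
  obtain d e Q where e: "orthonormal d e"
    and span: "\<And>n x. n < M \<Longrightarrow> x \<in> E \<Longrightarrow> spanned d e (adj V ^ n * x)"
    and Q: "\<And>n. isometry_op (cvec_space d) (Q n)"
    and Qstep: "\<And>n v. n < M \<Longrightarrow> v \<in> carrier_vec d \<Longrightarrow>
        hnorm (cvec_space d) (Q (Suc n) v - Q n v) \<le> \<epsilon> * hnorm (cvec_space d) v"
    and QU: "\<And>n x. n < M \<Longrightarrow> x \<in> E \<Longrightarrow> Q n (coord d e (adj V ^ n * x)) = coord d e (adj V ^ n * (U * x))"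
    using compress_conjugates[OF U V bound E, of M] by blast
  let ?H = "cvec_space d"
  interpret H: hilbert_space "cvec_space d" by (rule hilbert_space_cvec_space)
  define N where "N = 2 * M"
  let ?K = "cvec_space (N * d)"
  interpret K: hilbert_space "cvec_space (N * d)" by (rule hilbert_space_cvec_space)
  have \<epsilon>0: "\<epsilon> \<ge> 0" using bound norm_ge_zero order_trans by blast
  have Qc: "Q n v \<in> carrier_vec d" if "v \<in> carrier_vec d" for n v
    using isometry_opD(1)[OF Q, of v n] that by simp
  have Qsm: "Q n (c \<cdot>\<^sub>v v) = c \<cdot>\<^sub>v Q n v" if "v \<in> carrier_vec d" for n c v
    using isometry_opD(3)[OF Q, of v n c] that by simp
  have Q0: "Q n (0\<^sub>v d) = 0\<^sub>v d" for n
    using H.hnorm_eq_0_iff[of "Q n (0\<^sub>v d)"] H.hnorm_eq_0_iff[of "0\<^sub>v d"]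
      isometry_op_hnorm[OF Q[of n], of "0\<^sub>v d"] Qc[of "0\<^sub>v d" n] by simp
  \<comment> \<open>The index runs 0, ..., M - 1, M - 1, ..., 0, so it never jumps, not even from
    the end of the period to its beginning.\<close>
  define fold_index where "fold_index = (\<lambda>n. min n (N - 1 - n))"
  define Ut where "Ut = (\<lambda>v. cat N d (\<lambda>n. Q (fold_index n) (block d v n)))"
  define Vt where "Vt = (\<lambda>v. cat N d (\<lambda>n. block d v (cyc_pred N n)))"
  \<comment> \<open>This factor turns the square norm of \<open>J x\<close> into the average of the
    square norms of \<open>M\<close> blocks.\<close>
  define s where "s = 1 / sqrt (real M)"
  have s: "s\<^sup>2 = 1 / real M" using M by (simp add: s_def power_divide)
  define f where "f = (\<lambda>x n. if n < M then complex_of_real s \<cdot>\<^sub>v coord d e (adj V ^ n * x) else 0\<^sub>v d)"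
  have fc: "f x n \<in> carrier_vec d" for x n by (simp add: f_def)
  define J where "J = (\<lambda>x. cat N d (f x))"
  have Ut: "isometry_op ?K Ut" unfolding Ut_def by (rule isometry_diagonal[OF Q])
  have Vt: "isometry_op ?K Vt" unfolding Vt_def by (rule isometry_shift)
  have uniV: "sq (adj V ^ n * x) = sq x" for n x
    by (rule sq_unitary) (simp add: unitary_power unitary_adj V)
  have fold_step: "hnorm ?H (Q (fold_index n) v - Q (fold_index (cyc_pred N n)) v) \<le> \<epsilon> * hnorm ?H v"
    if n: "n < N" and v: "v \<in> carrier_vec d" for n v
  proof -
    \<comment> \<open>Equality occurs at n = 0 and n = M, where the direction changes; otherwise the
      index moves by one, upwards in the first half and downwards in the second.\<close>
    have "fold_index n = fold_index (cyc_pred N n) \<or>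
       (fold_index n = Suc (fold_index (cyc_pred N n)) \<and> fold_index (cyc_pred N n) < M) \<or>
       (fold_index (cyc_pred N n) = Suc (fold_index n) \<and> fold_index n < M)"
      using n by (auto simp: fold_index_def cyc_pred_def N_def min_def)
    then show ?thesis
    proof (elim disjE conjE)
      assume "fold_index n = fold_index (cyc_pred N n)"
      moreover have "hnorm ?H (Q m v - Q m v) = 0" for m
        using Qc[OF v, of m] by (simp add: hnorm_cvec_space)
      moreover have "0 \<le> \<epsilon> * hnorm ?H v" using \<epsilon>0 H.hnorm_nonneg[of v] v by simp
      ultimately show ?thesis by (simp only:)
    next
      assume "fold_index n = Suc (fold_index (cyc_pred N n))" "fold_index (cyc_pred N n) < M"
      then show ?thesis using Qstep[OF _ v] by simp
    next
      assume "fold_index (cyc_pred N n) = Suc (fold_index n)" "fold_index n < M"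
      then show ?thesis
        using Qstep[OF _ v, of "fold_index n"] hnorm_cvec_minus_commute[OF Qc[OF v] Qc[OF v]] by simp
    qed
  qed
  have comm: "hnorm ?K (Ut (Vt v) - Vt (Ut v)) \<le> \<epsilon> * hnorm ?K v" if v: "v \<in> carrier_vec (N * d)" for v
  proof -
    let ?p = "cyc_pred N"
    have 1: "Ut (Vt v) = cat N d (\<lambda>n. Q (fold_index n) (block d v (?p n)))"
      unfolding Ut_def Vt_def by (intro cat_cong) (simp add: block_cat)
    have 2: "Vt (Ut v) = cat N d (\<lambda>n. Q (fold_index (?p n)) (block d v (?p n)))"
      unfolding Ut_def Vt_def by (intro cat_cong) (simp add: block_cat cyc_pred_less Qc)
    \<comment> \<open>Both products move the same block to position n and differ only in the
      isometry applied to it, so \<open>fold_step\<close> bounds the commutator blockwise and with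
      the same constant.\<close>
    have "Ut (Vt v) - Vt (Ut v) = cat N d (\<lambda>n. Q (fold_index n) (block d v (?p n)) - Q (fold_index (?p n)) (block d v (?p n)))"
      unfolding 1 2 by (rule cat_diff[symmetric]) (simp_all add: Qc)
    then have "(hnorm ?K (Ut (Vt v) - Vt (Ut v)))\<^sup>2
        = (\<Sum>n<N. (hnorm ?H (Q (fold_index n) (block d v (?p n)) - Q (fold_index (?p n)) (block d v (?p n))))\<^sup>2)"
      by (simp add: hnorm_cat Qc)
    also have "\<dots> \<le> (\<Sum>n<N. (\<epsilon> * hnorm ?H (block d v (?p n)))\<^sup>2)"
      by (intro sum_mono power_mono fold_step) (simp_all add: H.hnorm_nonneg Qc)
    also have "\<dots> = (\<Sum>n<N. (\<epsilon> * hnorm ?H (block d v n))\<^sup>2)"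
      by (rule sum_cyc_pred[of "\<lambda>n. (\<epsilon> * hnorm ?H (block d v n))\<^sup>2"])
    also have "\<dots> = (\<epsilon> * hnorm ?K v)\<^sup>2"
      by (simp add: power_mult_distrib sum_distrib_left[symmetric] hnorm_block[OF v])
    finally show ?thesis
      by (rule power2_le_imp_le) (use \<epsilon>0 K.hnorm_nonneg[of v] v in simp)
  qed
  have J_norm: "(hnorm ?K (J x))\<^sup>2 = (\<Sum>n<M. (hnorm ?H (coord d e (adj V ^ n * x)))\<^sup>2) / real M" for x
  proof -
    have "(hnorm ?K (J x))\<^sup>2 = (\<Sum>n<N. (hnorm ?H (f x n))\<^sup>2)"
      by (simp add: J_def hnorm_cat fc)
    also have "\<dots> = (\<Sum>n<N. if n < M then (hnorm ?H (coord d e (adj V ^ n * x)))\<^sup>2 / real M else 0)"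
    proof (rule sum.cong[OF refl])
      fix n
      have "hnorm ?H (0\<^sub>v d) = 0" by (simp add: hnorm_cvec_space)
      then show "(hnorm ?H (f x n))\<^sup>2 = (if n < M then (hnorm ?H (coord d e (adj V ^ n * x)))\<^sup>2 / real M else 0)"
        using H.hnorm_smult[of "coord d e (adj V ^ n * x)" "complex_of_real s"]
        by (simp add: f_def power_mult_distrib s)
    qed
    also have "\<dots> = (\<Sum>n<M. (hnorm ?H (coord d e (adj V ^ n * x)))\<^sup>2 / real M)"
      by (rule sum.mono_neutral_cong_right) (auto simp: N_def)
    finally show ?thesis by (simp add: sum_divide_distrib)
  qed
  have Jc: "J x \<in> carrier_vec (N * d)" for x by (simp add: J_def)
  have J_add: "J (x + y) = J x + J y" for x y
  proof -
    have "f (x + y) n = f x n + f y n" for n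
      by (simp add: f_def distrib_left coord_add smult_add_distrib_vec[OF coord_carrier coord_carrier])
    then have "f (x + y) = (\<lambda>n. f x n + f y n)" by (rule ext)
    then show ?thesis by (simp add: J_def cat_add fc)
  qed
  have J_sm: "J (c *\<^sub>C x) = c \<cdot>\<^sub>v J x" for c x
  proof -
    have "c \<cdot>\<^sub>v 0\<^sub>v d = 0\<^sub>v d" by (intro eq_vecI) auto
    then have "f (c *\<^sub>C x) n = c \<cdot>\<^sub>v f x n" for n
      by (simp add: f_def mult_scaleC_right coord_scaleC smult_smult_assoc mult.commute)
    then have "f (c *\<^sub>C x) = (\<lambda>n. c \<cdot>\<^sub>v f x n)" by (rule ext)
    then show ?thesis by (simp add: J_def cat_smult fc)
  qed
  have J_le: "(hnorm ?K (J x))\<^sup>2 \<le> sq x" for x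
  proof -
    have "(\<Sum>n<M. (hnorm ?H (coord d e (adj V ^ n * x)))\<^sup>2) \<le> (\<Sum>n<M. sq x)"
      using hnorm_coord_le[OF e] uniV by (intro sum_mono) metis
    then show ?thesis using M by (simp add: J_norm divide_le_eq mult.commute)
  qed
  have J_eq: "(hnorm ?K (J x))\<^sup>2 = sq x" if "x \<in> E" for x
  proof -
    have "(\<Sum>n<M. (hnorm ?H (coord d e (adj V ^ n * x)))\<^sup>2) = (\<Sum>n<M. sq x)"
      using hnorm_coord_spanned[OF span[OF _ that]] uniV by (intro sum.cong) auto
    then show ?thesis using M by (simp add: J_norm)
  qed
  have J_U: "Ut (J x) = J (U * x)" if "x \<in> E" for x
    unfolding Ut_def J_def
  proof (rule cat_cong)
    fix n assume n: "n < N"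
    have "Q (fold_index n) (f x n) = f (U * x) n"
    proof (cases "n < M")
      case True
      then have "fold_index n = n" by (auto simp: fold_index_def N_def)
      then show ?thesis using True QU[OF True that] by (simp add: f_def Qsm)
    qed (simp add: f_def Q0)
    then show "Q (fold_index n) (block d (cat N d (f x)) n) = f (U * x) n"
      using n by (simp add: block_cat fc)
  qed
  have J_V: "(hnorm ?K (Vt (J x) - J (V * x)))\<^sup>2 \<le> 2 / real M * sq x" for x
  proof -
    have "Vt (J x) = cat N d (\<lambda>n. f x (cyc_pred N n))"
      unfolding Vt_def J_def by (intro cat_cong) (simp add: block_cat cyc_pred_less fc)
    then have "Vt (J x) - J (V * x) = cat N d (\<lambda>n. f x (cyc_pred N n) - f (V * x) n)"
      unfolding J_def by (simp add: cat_diff fc)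
    then have "(hnorm ?K (Vt (J x) - J (V * x)))\<^sup>2 = (\<Sum>n<N. (hnorm ?H (f x (cyc_pred N n) - f (V * x) n))\<^sup>2)"
      by (simp add: hnorm_cat fc)
    \<comment> \<open>The shift is exact except at the ends of the support of \<open>J\<close>: at n
      = 0 a zero block arrives where one is expected, at n = M a block leaves the first half. Each
      error is at most sq x / M, which explains the factor 2 / M.\<close>
    also have "\<dots> \<le> (\<Sum>n<N. if n = 0 \<or> n = M then sq x / real M else 0)"
    proof (rule sum_mono)
      fix n assume "n \<in> {..<N}"
      then have n: "n < N" by simp
      have part: "(hnorm ?H (complex_of_real s \<cdot>\<^sub>v coord d e y))\<^sup>2 \<le> sq y / real M" for y
        using H.hnorm_smult[of "coord d e y" "complex_of_real s"] hnorm_coord_le[OF e, of y] M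
        by (simp add: power_mult_distrib s divide_right_mono)
      consider "n = 0" | "0 < n" "n < M" | "n = M" | "M < n" by linarith
      then show "(hnorm ?H (f x (cyc_pred N n) - f (V * x) n))\<^sup>2 \<le> (if n = 0 \<or> n = M then sq x / real M else 0)"
      proof cases
        case 1
        have "\<not> cyc_pred N n < M" using 1 M by (simp add: cyc_pred_def N_def)
        then have "f x (cyc_pred N n) - f (V * x) n = 0\<^sub>v d - complex_of_real s \<cdot>\<^sub>v coord d e (V * x)"
          using 1 M by (simp add: f_def)
        then have "hnorm ?H (f x (cyc_pred N n) - f (V * x) n) = hnorm ?H (complex_of_real s \<cdot>\<^sub>v coord d e (V * x))"
          by (simp add: hnorm_cvec_space coord_def del: zero_minus_vec)
        then show ?thesis using part[of "V * x"] 1 by (simp add: sq_unitary[OF V])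
      next
        case 2
        then obtain m where m: "n = Suc m" by (cases n) auto
        have "adj V ^ n * (V * x) = adj V ^ m * x"
          by (simp add: m power_commutes[symmetric] mult.assoc unitary_cancel[OF V])
        then have "f x (cyc_pred N n) = f (V * x) n"
          using 2 m by (simp add: f_def cyc_pred_def)
        then show ?thesis using 2 fc[of "V * x" n] by (simp add: hnorm_cvec_space)
      next
        case 3
        have "f x (cyc_pred N n) - f (V * x) n = complex_of_real s \<cdot>\<^sub>v coord d e (adj V ^ (M - 1) * x)"
          using 3 M by (simp add: f_def cyc_pred_def N_def)
        then show ?thesis using part[of "adj V ^ (M - 1) * x"] 3 by (simp add: uniV)
      next
        case 4
        then have "f x (cyc_pred N n) - f (V * x) n = 0\<^sub>v d"
          by (auto simp: f_def cyc_pred_def)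
        then show ?thesis using 4 by (simp add: hnorm_cvec_space)
      qed
    qed
    also have "\<dots> = (\<Sum>n\<in>{0, M}. sq x / real M)"
      using M by (intro sum.mono_neutral_cong_right) (auto simp: N_def)
    also have "\<dots> = 2 / real M * sq x" using M by simp
    finally show ?thesis .
  qed
  show ?thesis
    using Ut Vt comm Jc J_add J_sm J_le J_eq J_U J_V by (intro exI[of _ "N * d"] exI[of _ J] exI[of _ Ut] exI[of _ Vt]) blast
qed

end

section \<open>The product of all C*-algebras on a type\<close>

context unital_cstar_algebra
begin

lemma smult_closed_C: "x \<in> carrier A \<Longrightarrow> c \<odot> x \<in> carrier A"
  by (rule vs.smult_closed) simp_all

lemma one_smult_C: "x \<in> carrier A \<Longrightarrow> 1 \<odot> x = x"
  using vs.smult_one[of x] by (simp add: class_ring_simps)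

lemma smult_add_left_C: "x \<in> carrier A \<Longrightarrow> (c + d) \<odot> x = c \<odot> x \<oplus> d \<odot> x"
  using vs.smult_l_distr[of c d x] by (simp add: class_ring_simps)

lemma smult_add_right_C: "x \<in> carrier A \<Longrightarrow> y \<in> carrier A \<Longrightarrow> c \<odot> (x \<oplus> y) = c \<odot> x \<oplus> c \<odot> y"
  using vs.smult_r_distr[of c x y] by simp

lemma smult_smult_C: "x \<in> carrier A \<Longrightarrow> c \<odot> (d \<odot> x) = (c * d) \<odot> x"
  using vs.smult_assoc1[of c d x] by (simp add: class_ring_simps)

lemma zero_smult_C: "x \<in> carrier A \<Longrightarrow> 0 \<odot> x = \<zero>"
  using vs.smult_l_null[of x] by (simp add: class_ring_simps)

lemma minus_smult_C: "x \<in> carrier A \<Longrightarrow> (-1) \<odot> x = \<ominus> x"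
  using vs.smult_l_minus[of 1 x] by (simp add: class_ring_simps one_smult_C)

lemma anorm_minus: "x \<in> carrier A \<Longrightarrow> anorm A (\<ominus> x) = anorm A x"
  using anorm_smult[of x "-1"] by (simp add: minus_smult_C)

lemma anorm_zero: "anorm A \<zero> = 0"
  using anorm_eq_0_iff[of \<zero>] by simp

lemma star_zero: "star A \<zero> = \<zero>"
  using star_smult[of \<zero> 0] by (simp add: zero_smult_C star_closed)

lemma anorm_star: assumes x: "x \<in> carrier A" shows "anorm A (star A x) = anorm A x"
proof -
  have le: "anorm A y \<le> anorm A (star A y)" if y: "y \<in> carrier A" for y
  proof (cases "anorm A y = 0")
    case True
    then show ?thesis using anorm_nonneg[OF star_closed[OF y]] by simp
  next
    case False
    have "anorm A y * anorm A y \<le> anorm A (star A y) * anorm A y"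
      using cstar_identity[OF y] anorm_mult[OF star_closed[OF y] y] by (simp add: power2_eq_square)
    then show ?thesis using False anorm_nonneg[OF y] by simp
  qed
  show ?thesis using le[OF x] le[OF star_closed[OF x]] by (simp add: star_star x)
qed

lemma star_one: "star A \<one> = \<one>"
proof -
  have "star A (star A \<one> \<otimes> \<one>) = star A \<one> \<otimes> star A (star A \<one>)"
    by (rule star_mult) (simp_all add: star_closed)
  then show ?thesis by (simp add: star_closed star_star)
qed

lemma anorm_one_le: "anorm A \<one> \<le> 1"
proof -
  have "anorm A \<one> = anorm A \<one> * anorm A \<one>"
    using cstar_identity[of \<one>] by (simp add: star_one power2_eq_square)
  then have "anorm A \<one> = 0 \<or> anorm A \<one> = 1" by simp
  then show ?thesis by auto
qed

end

abbreviation all_cstar :: "'a normed_star_algebra set" where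
  "all_cstar \<equiv> Collect unital_cstar_algebra"

text \<open>
  Members of the \<open>\<ell>\<^sup>\<infinity>\<close>-product of all unital C*-algebras with elements in \<open>'a\<close>. It is a closed type,
  so the theory above applies to it, and every unital C*-algebra on \<open>'a\<close> is one of its summands.
\<close>

definition families :: "('a normed_star_algebra \<Rightarrow> 'a) set" where
  "families = {f. (\<forall>A. if unital_cstar_algebra A then f A \<in> carrier A else f A = undefined) \<and>
     (\<exists>C. \<forall>A. unital_cstar_algebra A \<longrightarrow> anorm A (f A) \<le> C)}"

lemma familiesI:
  assumes "\<And>A. unital_cstar_algebra A \<Longrightarrow> f A \<in> carrier A"
    and "\<And>A. unital_cstar_algebra A \<Longrightarrow> anorm A (f A) \<le> C"
  shows "(\<lambda>A. if unital_cstar_algebra A then f A else undefined) \<in> families"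
  using assms by (auto simp: families_def)

lemma zero_family: "(\<lambda>A. if unital_cstar_algebra A then \<zero>\<^bsub>A\<^esub> else undefined) \<in> families"
proof (rule familiesI[where C = 0])
  fix A :: "'a normed_star_algebra" assume "unital_cstar_algebra A"
  then interpret unital_cstar_algebra A .
  show "\<zero>\<^bsub>A\<^esub> \<in> carrier A" "anorm A \<zero>\<^bsub>A\<^esub> \<le> 0" by (simp_all add: anorm_zero)
qed

typedef 'a cstar_product = "families :: ('a normed_star_algebra \<Rightarrow> 'a) set"
  morphisms comp Abs_cstar_product
  using zero_family by blast

lemma comp_carrier: "unital_cstar_algebra A \<Longrightarrow> comp x A \<in> carrier A"
  using comp[of x] by (auto simp: families_def split: if_splits)

lemma cstar_product_eqI:
  assumes "\<And>A. unital_cstar_algebra A \<Longrightarrow> comp x A = comp y A"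
  shows "x = y"
proof -
  have "comp x A = comp y A" for A
    using assms[of A] comp[of x] comp[of y] by (cases "unital_cstar_algebra A") (auto simp: families_def)
  then show ?thesis by (simp add: comp_inject[symmetric] ext)
qed

text \<open>Values outside the index set are pinned to \<open>undefined\<close>, so that equality of
  members can be decided on the components at C*-algebras.\<close>

definition mk_family :: "('a normed_star_algebra \<Rightarrow> 'a) \<Rightarrow> 'a cstar_product" where
  "mk_family f = Abs_cstar_product (\<lambda>A. if unital_cstar_algebra A then f A else undefined)"

lemma comp_mk_family:
  assumes "\<And>A. unital_cstar_algebra A \<Longrightarrow> f A \<in> carrier A"
    and "\<And>A. unital_cstar_algebra A \<Longrightarrow> anorm A (f A) \<le> C"
    and "unital_cstar_algebra B"
  shows "comp (mk_family f) B = f B"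
  using assms(3) Abs_cstar_product_inverse[OF familiesI[of f C, OF assms(1,2)]]
  by (simp add: mk_family_def)

lemma comp_bounded: "\<exists>C\<ge>0. \<forall>A. unital_cstar_algebra A \<longrightarrow> anorm A (comp x A) \<le> C"
proof -
  obtain C where "\<And>A. unital_cstar_algebra A \<Longrightarrow> anorm A (comp x A) \<le> C"
    using comp[of x] by (auto simp: families_def)
  then show ?thesis by (intro exI[of _ "max C 0"]) (auto intro: order_trans[OF _ max.cobounded1])
qed

instantiation cstar_product :: (type) "{real_normed_algebra, monoid_mult}"
begin

definition "0 = mk_family (\<lambda>A. \<zero>\<^bsub>A\<^esub>)"
definition "1 = mk_family (\<lambda>A. \<one>\<^bsub>A\<^esub>)"
definition "x + y = mk_family (\<lambda>A. comp x A \<oplus>\<^bsub>A\<^esub> comp y A)"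
definition "- x = mk_family (\<lambda>A. \<ominus>\<^bsub>A\<^esub> comp x A)"
definition "x - y = mk_family (\<lambda>A. comp x A \<ominus>\<^bsub>A\<^esub> comp y A)"
definition "x * y = mk_family (\<lambda>A. comp x A \<otimes>\<^bsub>A\<^esub> comp y A)"
definition "r *\<^sub>R x = mk_family (\<lambda>A. complex_of_real r \<odot>\<^bsub>A\<^esub> comp x A)"
text \<open>Inserting 0 makes the set nonempty without exhibiting any C*-algebra on the
  type.\<close>

definition "norm x = Sup (insert 0 ((\<lambda>A. anorm A (comp x A)) ` all_cstar))"
definition "dist x y = norm (x - y :: 'a cstar_product)"
definition "sgn x = inverse (norm x) *\<^sub>R (x :: 'a cstar_product)"
definition uniformity_cstar_product :: "('a cstar_product \<times> 'a cstar_product) filter"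
  where "uniformity_cstar_product = (INF e\<in>{0<..}. principal {(x, y). dist x y < e})"
definition open_cstar_product :: "'a cstar_product set \<Rightarrow> bool"
  where "open_cstar_product S = (\<forall>x\<in>S. \<forall>\<^sub>F (x', y) in uniformity. x' = x \<longrightarrow> y \<in> S)"

context
  fixes B :: "'a normed_star_algebra"
  assumes B: "unital_cstar_algebra B"
begin

lemma comp_zero: "comp 0 B = \<zero>\<^bsub>B\<^esub>"
  unfolding zero_cstar_product_def
proof (rule comp_mk_family[where C = 0])
  fix A :: "'a normed_star_algebra" assume "unital_cstar_algebra A"
  then interpret unital_cstar_algebra A .
  show "\<zero>\<^bsub>A\<^esub> \<in> carrier A" "anorm A \<zero>\<^bsub>A\<^esub> \<le> 0" by (simp_all add: anorm_zero)
qed (rule B)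

lemma comp_one: "comp 1 B = \<one>\<^bsub>B\<^esub>"
  unfolding one_cstar_product_def
proof (rule comp_mk_family[where C = 1])
  fix A :: "'a normed_star_algebra" assume "unital_cstar_algebra A"
  then interpret unital_cstar_algebra A .
  show "\<one>\<^bsub>A\<^esub> \<in> carrier A" "anorm A \<one>\<^bsub>A\<^esub> \<le> 1" by (simp_all add: anorm_one_le)
qed (rule B)

lemma comp_add: "comp (x + y) B = comp x B \<oplus>\<^bsub>B\<^esub> comp y B"
proof -
  obtain C where C: "\<And>A. unital_cstar_algebra A \<Longrightarrow> anorm A (comp x A) \<le> C" using comp_bounded by metis
  obtain D where D: "\<And>A. unital_cstar_algebra A \<Longrightarrow> anorm A (comp y A) \<le> D" using comp_bounded by metis
  show ?thesis
    unfolding plus_cstar_product_def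
  proof (rule comp_mk_family[where C = "C + D"])
    fix A :: "'a normed_star_algebra" assume A: "unital_cstar_algebra A"
    then interpret unital_cstar_algebra A .
    show "comp x A \<oplus>\<^bsub>A\<^esub> comp y A \<in> carrier A" using A by (simp add: comp_carrier)
    show "anorm A (comp x A \<oplus>\<^bsub>A\<^esub> comp y A) \<le> C + D"
      using anorm_triangle[of "comp x A" "comp y A"] C[OF A] D[OF A] A by (simp add: comp_carrier)
  qed (rule B)
qed

lemma comp_mk_family_smult: "comp (mk_family (\<lambda>A. c \<odot>\<^bsub>A\<^esub> comp x A)) B = c \<odot>\<^bsub>B\<^esub> comp x B"
proof -
  obtain C where C: "\<And>A. unital_cstar_algebra A \<Longrightarrow> anorm A (comp x A) \<le> C" using comp_bounded by metis
  show ?thesis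
  proof (rule comp_mk_family[where C = "cmod c * C"])
    fix A :: "'a normed_star_algebra" assume A: "unital_cstar_algebra A"
    then interpret unital_cstar_algebra A .
    show "c \<odot>\<^bsub>A\<^esub> comp x A \<in> carrier A" using A by (simp add: comp_carrier smult_closed_C)
    show "anorm A (c \<odot>\<^bsub>A\<^esub> comp x A) \<le> cmod c * C"
      using C[OF A] A by (simp add: comp_carrier anorm_smult mult_left_mono)
  qed (rule B)
qed

lemma comp_scaleR: "comp (r *\<^sub>R x) B = complex_of_real r \<odot>\<^bsub>B\<^esub> comp x B"
  by (simp add: scaleR_cstar_product_def comp_mk_family_smult)

lemma comp_uminus: "comp (- x) B = \<ominus>\<^bsub>B\<^esub> comp x B"
proof -
  obtain C where C: "\<And>A. unital_cstar_algebra A \<Longrightarrow> anorm A (comp x A) \<le> C" using comp_bounded by metis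
  show ?thesis
    unfolding uminus_cstar_product_def
  proof (rule comp_mk_family[where C = C])
    fix A :: "'a normed_star_algebra" assume A: "unital_cstar_algebra A"
    then interpret unital_cstar_algebra A .
    show "\<ominus>\<^bsub>A\<^esub> comp x A \<in> carrier A" "anorm A (\<ominus>\<^bsub>A\<^esub> comp x A) \<le> C"
      using C[OF A] A by (simp_all add: comp_carrier anorm_minus)
  qed (rule B)
qed

lemma comp_minus: "comp (x - y) B = comp x B \<ominus>\<^bsub>B\<^esub> comp y B"
proof -
  obtain C where C: "\<And>A. unital_cstar_algebra A \<Longrightarrow> anorm A (comp x A) \<le> C" using comp_bounded by metis
  obtain D where D: "\<And>A. unital_cstar_algebra A \<Longrightarrow> anorm A (comp y A) \<le> D" using comp_bounded by metis
  show ?thesis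
    unfolding minus_cstar_product_def
  proof (rule comp_mk_family[where C = "C + D"])
    fix A :: "'a normed_star_algebra" assume A: "unital_cstar_algebra A"
    then interpret unital_cstar_algebra A .
    show "comp x A \<ominus>\<^bsub>A\<^esub> comp y A \<in> carrier A" using A by (simp add: comp_carrier)
    show "anorm A (comp x A \<ominus>\<^bsub>A\<^esub> comp y A) \<le> C + D"
      using anorm_triangle[of "comp x A" "\<ominus>\<^bsub>A\<^esub> comp y A"] C[OF A] D[OF A] A
      by (simp add: comp_carrier a_minus_def anorm_minus)
  qed (rule B)
qed

lemma comp_mult: "comp (x * y) B = comp x B \<otimes>\<^bsub>B\<^esub> comp y B"
proof -
  obtain C where C: "C \<ge> 0" "\<And>A. unital_cstar_algebra A \<Longrightarrow> anorm A (comp x A) \<le> C" using comp_bounded by metis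
  obtain D where D: "\<And>A. unital_cstar_algebra A \<Longrightarrow> anorm A (comp y A) \<le> D" using comp_bounded by metis
  show ?thesis
    unfolding times_cstar_product_def
  proof (rule comp_mk_family[where C = "C * D"])
    fix A :: "'a normed_star_algebra" assume A: "unital_cstar_algebra A"
    then interpret unital_cstar_algebra A .
    show "comp x A \<otimes>\<^bsub>A\<^esub> comp y A \<in> carrier A" using A by (simp add: comp_carrier)
    have "anorm A (comp x A) * anorm A (comp y A) \<le> C * D"
      using C(2)[OF A] D[OF A] C(1) A by (intro mult_mono) (simp_all add: comp_carrier anorm_nonneg)
    then show "anorm A (comp x A \<otimes>\<^bsub>A\<^esub> comp y A) \<le> C * D"
      using anorm_mult[of "comp x A" "comp y A"] A by (simp add: comp_carrier)
  qed (rule B)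
qed

lemma comp_mk_family_star: "comp (mk_family (\<lambda>A. star A (comp x A))) B = star B (comp x B)"
proof -
  obtain C where C: "\<And>A. unital_cstar_algebra A \<Longrightarrow> anorm A (comp x A) \<le> C" using comp_bounded by metis
  show ?thesis
  proof (rule comp_mk_family[where C = C])
    fix A :: "'a normed_star_algebra" assume A: "unital_cstar_algebra A"
    then interpret unital_cstar_algebra A .
    show "star A (comp x A) \<in> carrier A" "anorm A (star A (comp x A)) \<le> C"
      using C[OF A] A by (simp_all add: comp_carrier anorm_star star_closed)
  qed (rule B)
qed

lemma anorm_comp_le: "anorm B (comp x B) \<le> norm x"
proof -
  obtain C where "C \<ge> 0" "\<And>A. unital_cstar_algebra A \<Longrightarrow> anorm A (comp x A) \<le> C" using comp_bounded by metis
  then have "bdd_above (insert 0 ((\<lambda>A. anorm A (comp x A)) ` all_cstar))"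
    by (auto intro!: bdd_aboveI[of _ C])
  then show ?thesis unfolding norm_cstar_product_def using B by (intro cSup_upper) auto
qed

end

lemmas comp_simps = comp_zero comp_one comp_add comp_scaleR comp_uminus comp_minus comp_mult

lemma norm_cstar_product_nonneg: "0 \<le> norm (x :: 'a cstar_product)"
proof -
  obtain C where "C \<ge> 0" "\<And>A. unital_cstar_algebra A \<Longrightarrow> anorm A (comp x A) \<le> C" using comp_bounded by metis
  then have "bdd_above (insert 0 ((\<lambda>A. anorm A (comp x A)) ` all_cstar))"
    by (auto intro!: bdd_aboveI[of _ C])
  then show ?thesis unfolding norm_cstar_product_def by (intro cSup_upper) auto
qed

lemma norm_cstar_product_le:
  assumes "C \<ge> 0" "\<And>A. unital_cstar_algebra A \<Longrightarrow> anorm A (comp x A) \<le> C"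
  shows "norm x \<le> C"
  unfolding norm_cstar_product_def by (rule cSup_least) (use assms in auto)

instance
proof
  fix x y z :: "'a cstar_product" and a b :: real
  show "x + y + z = x + (y + z)" "x + y = y + x" "0 + x = x" "- x + x = 0" "x - y = x + - y"
    "x * y * z = x * (y * z)" "(x + y) * z = x * z + y * z" "x * (y + z) = x * y + x * z"
    "1 * x = x" "x * 1 = x"
    by (rule cstar_product_eqI; frule unital_cstar_algebra.ring;
        simp add: comp_simps comp_carrier ring.ring_simprules monoid.r_one[OF ring.is_monoid])+
  have scaleR: "a *\<^sub>R (x + y) = a *\<^sub>R x + a *\<^sub>R y" "(a + b) *\<^sub>R x = a *\<^sub>R x + b *\<^sub>R x"
    "a *\<^sub>R b *\<^sub>R x = (a * b) *\<^sub>R x" "1 *\<^sub>R x = x" for a b and x y :: "'a cstar_product"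
    by (rule cstar_product_eqI; simp add: comp_simps comp_carrier unital_cstar_algebra.smult_add_left_C
          unital_cstar_algebra.smult_add_right_C unital_cstar_algebra.smult_smult_C
          unital_cstar_algebra.one_smult_C)+
  show "a *\<^sub>R (x + y) = a *\<^sub>R x + a *\<^sub>R y" "(a + b) *\<^sub>R x = a *\<^sub>R x + b *\<^sub>R x"
    "a *\<^sub>R b *\<^sub>R x = (a * b) *\<^sub>R x" "1 *\<^sub>R x = x"
    by (rule scaleR)+
  show "a *\<^sub>R x * y = a *\<^sub>R (x * y)" "x * a *\<^sub>R y = a *\<^sub>R (x * y)"
    by (rule cstar_product_eqI; simp add: comp_simps comp_carrier unital_cstar_algebra.smult_mult_left
          unital_cstar_algebra.smult_mult_right)+
  show "dist x y = norm (x - y)" by (rule dist_cstar_product_def)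
  show "sgn x = inverse (norm x) *\<^sub>R x" by (rule sgn_cstar_product_def)
  show "uniformity = (INF e\<in>{0<..}. principal {(x :: 'a cstar_product, y). dist x y < e})"
    by (rule uniformity_cstar_product_def)
  show "open U = (\<forall>x\<in>U. \<forall>\<^sub>F (x', y) in uniformity. x' = x \<longrightarrow> y \<in> U)" for U :: "'a cstar_product set"
    by (rule open_cstar_product_def)
  show norm0: "norm x = 0 \<longleftrightarrow> x = 0"
  proof
    assume "norm x = 0"
    show "x = 0"
    proof (rule cstar_product_eqI)
      fix A :: "'a normed_star_algebra" assume A: "unital_cstar_algebra A"
      then interpret unital_cstar_algebra A .
      show "comp x A = comp 0 A"
        using anorm_comp_le[OF A, of x] \<open>norm x = 0\<close> anorm_nonneg[OF comp_carrier[OF A, of x]]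
          anorm_eq_0_iff[OF comp_carrier[OF A, of x]] by (simp add: comp_zero[OF A])
    qed
  next
    assume "x = 0"
    then have "norm x \<le> 0"
      by (intro norm_cstar_product_le) (auto simp: comp_zero unital_cstar_algebra.anorm_zero)
    then show "norm x = 0" using norm_cstar_product_nonneg[of x] by simp
  qed
  show "norm (x + y) \<le> norm x + norm y"
  proof (rule norm_cstar_product_le)
    fix A :: "'a normed_star_algebra" assume A: "unital_cstar_algebra A"
    then show "anorm A (comp (x + y) A) \<le> norm x + norm y"
      using unital_cstar_algebra.anorm_triangle[OF A comp_carrier[OF A] comp_carrier[OF A], of x y]
        anorm_comp_le[OF A, of x] anorm_comp_le[OF A, of y] by (simp add: comp_add)
  qed (simp add: norm_cstar_product_nonneg)
  have smult_le: "norm (a *\<^sub>R x) \<le> \<bar>a\<bar> * norm x" for a and x :: "'a cstar_product"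
  proof (rule norm_cstar_product_le)
    fix A :: "'a normed_star_algebra" assume A: "unital_cstar_algebra A"
    then show "anorm A (comp (a *\<^sub>R x) A) \<le> \<bar>a\<bar> * norm x"
      using anorm_comp_le[OF A, of x]
      by (simp add: comp_scaleR unital_cstar_algebra.anorm_smult comp_carrier mult_left_mono)
  qed (simp add: norm_cstar_product_nonneg)
  show "norm (a *\<^sub>R x) = \<bar>a\<bar> * norm x"
  proof (cases "a = 0")
    case True
    then show ?thesis using smult_le[of a x] norm_cstar_product_nonneg[of "a *\<^sub>R x"] by simp
  next
    case False
    have "x = inverse a *\<^sub>R a *\<^sub>R x" using False by (simp add: scaleR)
    then have "norm x \<le> \<bar>inverse a\<bar> * norm (a *\<^sub>R x)" using smult_le[of "inverse a" "a *\<^sub>R x"] by simp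
    then have "\<bar>a\<bar> * norm x \<le> norm (a *\<^sub>R x)" using False by (simp add: field_simps)
    then show ?thesis using smult_le[of a x] by simp
  qed
  show "norm (x * y) \<le> norm x * norm y"
  proof (rule norm_cstar_product_le)
    fix A :: "'a normed_star_algebra" assume A: "unital_cstar_algebra A"
    then interpret unital_cstar_algebra A .
    have "anorm A (comp x A) * anorm A (comp y A) \<le> norm x * norm y"
      using anorm_comp_le[OF A] A by (intro mult_mono)
        (simp_all add: comp_carrier anorm_nonneg norm_cstar_product_nonneg)
    then show "anorm A (comp (x * y) A) \<le> norm x * norm y"
      using anorm_mult[OF comp_carrier[OF A] comp_carrier[OF A], of x y] by (simp add: comp_mult[OF A])
  qed (simp add: norm_cstar_product_nonneg)
qed

end

text \<open>Limits \<open>L\<close> are taken in each component by completeness of the summands; the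
  Cauchy condition holds uniformly in the components, so the limits form a bounded family and the
  convergence is uniform.\<close>

instance cstar_product :: (type) banach
proof
  fix X :: "nat \<Rightarrow> 'a cstar_product"
  assume "Cauchy X"
  then have cauchy: "\<exists>M. \<forall>m\<ge>M. \<forall>n\<ge>M. norm (X m - X n) < e" if "e > 0" for e
    using that unfolding Cauchy_def dist_norm by blast
  have "\<exists>l\<in>carrier A. limitin (Metric_space.mtopology (carrier A) (alg_dist A)) (\<lambda>n. comp (X n) A) l sequentially"
    if A: "unital_cstar_algebra A" for A :: "'a normed_star_algebra"
  proof -
    interpret unital_cstar_algebra A by (rule A)
    have "met.MCauchy (\<lambda>n. comp (X n) A)"
      unfolding met.MCauchy_def
    proof (intro conjI allI impI)
      show "range (\<lambda>n. comp (X n) A) \<subseteq> carrier A" using comp_carrier[OF A] by auto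
      fix e :: real assume "e > 0"
      then obtain M where M: "\<And>m n. m \<ge> M \<Longrightarrow> n \<ge> M \<Longrightarrow> norm (X m - X n) < e" using cauchy by blast
      have "alg_dist A (comp (X m) A) (comp (X n) A) < e" if "M \<le> m" "M \<le> n" for m n
        using M[OF that] anorm_comp_le[OF A, of "X m - X n"]
        by (simp add: norm_dist_def comp_carrier[OF A] comp_minus[OF A])
      then show "\<exists>N. \<forall>n n'. N \<le> n \<longrightarrow> N \<le> n' \<longrightarrow> alg_dist A (comp (X n) A) (comp (X n') A) < e" by blast
    qed
    then obtain l where l: "limitin met.mtopology (\<lambda>n. comp (X n) A) l sequentially"
      using complete by (auto simp: met.mcomplete_def)
    then have "l \<in> carrier A" by (simp add: met.limitin_metric)
    then show ?thesis using l by blast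
  qed
  then obtain L where L: "\<And>A :: 'a normed_star_algebra. unital_cstar_algebra A \<Longrightarrow> L A \<in> carrier A"
    and lim: "\<And>A :: 'a normed_star_algebra. unital_cstar_algebra A \<Longrightarrow>
      limitin (Metric_space.mtopology (carrier A) (alg_dist A)) (\<lambda>n. comp (X n) A) (L A) sequentially"
    by metis
  \<comment> \<open>The Cauchy estimate passes to the limit in the second index. The bound
    \<open>e\<close> does not depend on \<open>A\<close>; this serves both for the boundedness of
    \<open>L\<close> and for the convergence.\<close>
  have close: "anorm A (comp (X m) A \<ominus>\<^bsub>A\<^esub> L A) \<le> e"
    if A: "unital_cstar_algebra A" and M: "\<And>n. n \<ge> m \<Longrightarrow> norm (X m - X n) < e" for A :: "'a normed_star_algebra" and m e
  proof -
    interpret unital_cstar_algebra A by (rule A)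
    have c: "comp (X n) A \<in> carrier A" for n by (rule comp_carrier[OF A])
    show ?thesis
    proof (rule field_le_epsilon)
      fix \<delta> :: real assume "\<delta> > 0"
      then obtain n where n: "n \<ge> m" "alg_dist A (comp (X n) A) (L A) < \<delta>"
        using lim[OF A] unfolding met.limitin_metric eventually_sequentially
        by (metis max.cobounded1 max.cobounded2)
      have "anorm A (comp (X m) A \<ominus>\<^bsub>A\<^esub> L A) = alg_dist A (comp (X m) A) (L A)"
        using L[OF A] c by (simp add: norm_dist_def)
      also have "\<dots> \<le> alg_dist A (comp (X m) A) (comp (X n) A) + alg_dist A (comp (X n) A) (L A)"
        using L[OF A] c by (intro met.triangle) simp_all
      also have "alg_dist A (comp (X m) A) (comp (X n) A) \<le> norm (X m - X n)"
        using anorm_comp_le[OF A, of "X m - X n"] c by (simp add: norm_dist_def comp_minus[OF A])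
      finally show "anorm A (comp (X m) A \<ominus>\<^bsub>A\<^esub> L A) \<le> e + \<delta>" using M[OF n(1)] n(2) by simp
    qed
  qed
  obtain M where M: "\<And>n. n \<ge> M \<Longrightarrow> norm (X M - X n) < 1" using cauchy[of 1] by fastforce
  define l where "l = mk_family L"
  have lcomp: "comp l A = L A" if A: "unital_cstar_algebra A" for A
    unfolding l_def
  proof (rule comp_mk_family[where C = "norm (X M) + 1"])
    fix A :: "'a normed_star_algebra" assume A: "unital_cstar_algebra A"
    then interpret unital_cstar_algebra A .
    have c: "comp (X M) A \<in> carrier A" by (rule comp_carrier[OF A])
    have "L A = comp (X M) A \<oplus>\<^bsub>A\<^esub> (\<ominus>\<^bsub>A\<^esub> (comp (X M) A \<ominus>\<^bsub>A\<^esub> L A))"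
      using c L[OF A] by (simp add: alg.minus_eq alg.minus_add alg.r_neg2 alg.r_neg1)
    then have "anorm A (L A) \<le> anorm A (comp (X M) A) + anorm A (comp (X M) A \<ominus>\<^bsub>A\<^esub> L A)"
      using anorm_triangle[OF c, of "\<ominus>\<^bsub>A\<^esub> (comp (X M) A \<ominus>\<^bsub>A\<^esub> L A)"] c L[OF A] by (simp add: anorm_minus)
    then show "anorm A (L A) \<le> norm (X M) + 1"
      using close[OF A M] anorm_comp_le[OF A, of "X M"] by simp
  qed (use L that in simp_all)
  have "X \<longlonglongrightarrow> l"
  proof (rule metric_LIMSEQ_I)
    fix e :: real assume e: "e > 0"
    then obtain M where M: "\<And>m n. m \<ge> M \<Longrightarrow> n \<ge> M \<Longrightarrow> norm (X m - X n) < e / 2" using cauchy[of "e / 2"] by auto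
    have "norm (X m - l) \<le> e / 2" if m: "m \<ge> M" for m
    proof (rule norm_cstar_product_le)
      fix A :: "'a normed_star_algebra" assume A: "unital_cstar_algebra A"
      show "anorm A (comp (X m - l) A) \<le> e / 2"
        using close[OF A, of m "e / 2"] M[OF m] m by (simp add: comp_minus[OF A] lcomp[OF A])
    qed (use e in simp)
    then show "\<exists>M. \<forall>m\<ge>M. dist (X m) l < e"
      using e unfolding dist_norm by (intro exI[of _ M]) (force intro: le_less_trans)
  qed
  then show "convergent X" by (auto simp: convergent_def)
qed

instantiation cstar_product :: (type) cstar_algebra
begin

definition "c *\<^sub>C x = mk_family (\<lambda>A. c \<odot>\<^bsub>A\<^esub> comp x A)"
definition "adj x = mk_family (\<lambda>A. star A (comp x A))"

lemma comp_scaleC: "unital_cstar_algebra B \<Longrightarrow> comp (c *\<^sub>C x) B = c \<odot>\<^bsub>B\<^esub> comp x B"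
  by (simp add: scaleC_cstar_product_def comp_mk_family_smult)

lemma comp_adj: "unital_cstar_algebra B \<Longrightarrow> comp (adj x) B = star B (comp x B)"
  by (simp add: adj_cstar_product_def comp_mk_family_star)

instance
proof
  fix x y z :: "'a cstar_product" and a :: real and c d :: complex
  show "c *\<^sub>C (x + y) = c *\<^sub>C x + c *\<^sub>C y" "(c + d) *\<^sub>C x = c *\<^sub>C x + d *\<^sub>C x"
    "c *\<^sub>C d *\<^sub>C x = (c * d) *\<^sub>C x" "a *\<^sub>R x = complex_of_real a *\<^sub>C x"
    by (rule cstar_product_eqI; simp add: comp_simps comp_scaleC comp_carrier
          unital_cstar_algebra.smult_add_left_C unital_cstar_algebra.smult_add_right_C
          unital_cstar_algebra.smult_smult_C)+
  show "(c *\<^sub>C x) * y = c *\<^sub>C (x * y)" "x * (c *\<^sub>C y) = c *\<^sub>C (x * y)"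
    by (rule cstar_product_eqI; simp add: comp_simps comp_scaleC comp_carrier
          unital_cstar_algebra.smult_mult_left unital_cstar_algebra.smult_mult_right)+
  show "adj (adj x) = x" "adj (x + y) = adj x + adj y" "adj (c *\<^sub>C x) = cnj c *\<^sub>C adj x"
    "adj (x * y) = adj y * adj x"
    by (rule cstar_product_eqI; simp add: comp_simps comp_scaleC comp_adj comp_carrier
          unital_cstar_algebra.star_star unital_cstar_algebra.star_add
          unital_cstar_algebra.star_smult unital_cstar_algebra.star_mult)+
  show "norm (adj x * x) = (norm x)\<^sup>2"
  proof (rule antisym)
    show "norm (adj x * x) \<le> (norm x)\<^sup>2"
    proof (rule norm_cstar_product_le)
      fix A :: "'a normed_star_algebra" assume A: "unital_cstar_algebra A"
      then interpret unital_cstar_algebra A .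
      show "anorm A (comp (adj x * x) A) \<le> (norm x)\<^sup>2"
        using anorm_comp_le[OF A, of x] A
        by (simp add: comp_mult comp_adj cstar_identity comp_carrier power_mono anorm_nonneg)
    qed simp
    have "norm x \<le> sqrt (norm (adj x * x))"
    proof (rule norm_cstar_product_le)
      fix A :: "'a normed_star_algebra" assume A: "unital_cstar_algebra A"
      then interpret unital_cstar_algebra A .
      have "(anorm A (comp x A))\<^sup>2 \<le> norm (adj x * x)"
        using anorm_comp_le[OF A, of "adj x * x"] A by (simp add: comp_mult comp_adj cstar_identity comp_carrier)
      then show "anorm A (comp x A) \<le> sqrt (norm (adj x * x))" by (rule real_le_rsqrt)
    qed (simp add: norm_cstar_product_nonneg)
    then show "(norm x)\<^sup>2 \<le> norm (adj x * x)"
      using power_mono[of "norm x" "sqrt (norm (adj x * x))" 2] by simp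
  qed
qed

end

section \<open>Bounded operators on a Hilbert space with adjoints\<close>

lemma bounded_operators_simps:
  "carrier (bounded_operators H) = {T \<in> module_hom class_ring H H \<inter> extensional (carrier H).
      \<exists>C. \<forall>x \<in> carrier H. hnorm H (T x) \<le> C * hnorm H x}"
  "S \<otimes>\<^bsub>bounded_operators H\<^esub> T = (\<lambda>x \<in> carrier H. S (T x))"
  "\<one>\<^bsub>bounded_operators H\<^esub> = (\<lambda>x \<in> carrier H. x)"
  "\<zero>\<^bsub>bounded_operators H\<^esub> = (\<lambda>x \<in> carrier H. \<zero>\<^bsub>H\<^esub>)"
  "S \<oplus>\<^bsub>bounded_operators H\<^esub> T = (\<lambda>x \<in> carrier H. S x \<oplus>\<^bsub>H\<^esub> T x)"
  "c \<odot>\<^bsub>bounded_operators H\<^esub> T = (\<lambda>x \<in> carrier H. c \<odot>\<^bsub>H\<^esub> T x)"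
  "star (bounded_operators H) = adjoint_op H"
  "anorm (bounded_operators H) T = (SUP x \<in> {x \<in> carrier H. hnorm H x \<le> 1}. hnorm H (T x))"
  by (simp_all add: bounded_operators_def)

text \<open>Adjoints enter as an assumption; for \<open>cvec_space\<close> the conjugate transpose
  provides them.\<close>

locale hilbert_space_with_adjoints = hilbert_space +
  assumes adjoint_exists: "\<lbrakk>T \<in> carrier (bounded_operators H); x \<in> carrier H\<rbrakk> \<Longrightarrow>
    \<exists>z\<in>carrier H. \<forall>y\<in>carrier H. ip H (T y) x = ip H y z"
begin

abbreviation "B \<equiv> bounded_operators H"

lemma bounded_opI:
  assumes "T \<in> extensional (carrier H)" "\<And>x. x \<in> carrier H \<Longrightarrow> T x \<in> carrier H"
    and "\<And>x y. x \<in> carrier H \<Longrightarrow> y \<in> carrier H \<Longrightarrow> T (x \<oplus> y) = T x \<oplus> T y"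
    and "\<And>c x. x \<in> carrier H \<Longrightarrow> T (c \<odot> x) = c \<odot> T x"
    and "\<And>x. x \<in> carrier H \<Longrightarrow> hnorm H (T x) \<le> C * hnorm H x"
  shows "T \<in> carrier B"
  unfolding bounded_operators_simps(1)
proof (intro CollectI conjI IntI exI[of _ C] ballI module_homI)
qed (use assms in simp_all)

lemma bounded_opD:
  assumes "T \<in> carrier B"
  shows "T \<in> extensional (carrier H)" "\<And>x. x \<in> carrier H \<Longrightarrow> T x \<in> carrier H"
    and "\<And>x y. x \<in> carrier H \<Longrightarrow> y \<in> carrier H \<Longrightarrow> T (x \<oplus> y) = T x \<oplus> T y"
    and "\<And>c x. x \<in> carrier H \<Longrightarrow> T (c \<odot> x) = c \<odot> T x"
    and "\<exists>C. \<forall>x\<in>carrier H. hnorm H (T x) \<le> C * hnorm H x"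
  using assms by (auto simp: bounded_operators_simps module_hom_def)

lemma hnorm_zero: "hnorm H \<zero> = 0"
  using hnorm_eq_0_iff[of \<zero>] by simp

lemma op_zero:
  assumes "T \<in> carrier B" shows "T \<zero> = \<zero>"
  using bounded_opD(4)[OF assms, of \<zero> 0] bounded_opD(2)[OF assms, of \<zero>]
  by (simp add: zero_smult)

lemma op_bdd_above: "T \<in> carrier B \<Longrightarrow> bdd_above ((\<lambda>x. hnorm H (T x)) ` {x \<in> carrier H. hnorm H x \<le> 1})"
proof -
  assume T: "T \<in> carrier B"
  obtain C where C: "\<And>x. x \<in> carrier H \<Longrightarrow> hnorm H (T x) \<le> C * hnorm H x"
    using bounded_opD(5)[OF T] by blast
  have "hnorm H (T x) \<le> \<bar>C\<bar>" if "x \<in> carrier H" "hnorm H x \<le> 1" for x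
  proof -
    have "hnorm H (T x) \<le> \<bar>C\<bar> * hnorm H x"
      using C[OF that(1)] hnorm_nonneg[OF that(1)] by (meson abs_ge_self mult_right_mono order_trans)
    also have "\<dots> \<le> \<bar>C\<bar> * 1" using that(2) by (intro mult_left_mono) auto
    finally show ?thesis by simp
  qed
  then show ?thesis by (intro bdd_aboveI2) auto
qed

lemma anorm_nonneg: assumes T: "T \<in> carrier B" shows "0 \<le> anorm B T"
proof -
  have "hnorm H (T \<zero>) \<le> anorm B T"
    unfolding bounded_operators_simps by (rule cSUP_upper[OF _ op_bdd_above[OF T]]) (simp add: hnorm_zero)
  then show ?thesis by (simp add: op_zero[OF T] hnorm_zero)
qed

lemma hnorm_op_le:
  assumes T: "T \<in> carrier B" and x: "x \<in> carrier H"
  shows "hnorm H (T x) \<le> anorm B T * hnorm H x"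
proof (cases "hnorm H x = 0")
  case True
  then show ?thesis using x hnorm_eq_0_iff[OF x] by (simp add: op_zero[OF T] hnorm_zero)
next
  case False
  then have pos: "hnorm H x > 0" using hnorm_nonneg[OF x] by simp
  define r where "r = 1 / hnorm H x"
  have y: "complex_of_real r \<odot> x \<in> carrier H" using x by simp
  have "hnorm H (complex_of_real r \<odot> x) = 1"
    unfolding hnorm_smult[OF x] using pos by (simp add: r_def norm_divide)
  then have "hnorm H (T (complex_of_real r \<odot> x)) \<le> anorm B T"
    unfolding bounded_operators_simps using y by (intro cSUP_upper[OF _ op_bdd_above[OF T]]) simp
  then have "r * hnorm H (T x) \<le> anorm B T"
    using bounded_opD(2)[OF T x] pos by (simp add: bounded_opD(4)[OF T x] hnorm_smult r_def norm_divide)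
  then show ?thesis using pos by (simp add: r_def field_simps)
qed

lemma anorm_le:
  assumes C: "C \<ge> 0" and T: "\<And>x. x \<in> carrier H \<Longrightarrow> hnorm H (T x) \<le> C * hnorm H x"
  shows "anorm B T \<le> C"
  unfolding bounded_operators_simps
proof (rule cSUP_least)
  show "{x \<in> carrier H. hnorm H x \<le> 1} \<noteq> {}" using hnorm_zero by (intro ex_in_conv[THEN iffD1] exI[of _ \<zero>]) simp
  fix x assume "x \<in> {x \<in> carrier H. hnorm H x \<le> 1}"
  then show "hnorm H (T x) \<le> C"
    using T[of x] C mult_left_mono[of "hnorm H x" 1 C] by auto
qed

lemma op_eqI:
  assumes "S \<in> carrier B" "T \<in> carrier B" "\<And>x. x \<in> carrier H \<Longrightarrow> S x = T x"
  shows "S = T"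
  using bounded_opD(1)[OF assms(1)] bounded_opD(1)[OF assms(2)] assms(3) by (rule extensionalityI)

lemma op_mult_closed:
  assumes S: "S \<in> carrier B" and T: "T \<in> carrier B"
  shows "S \<otimes>\<^bsub>B\<^esub> T \<in> carrier B"
    and "\<And>x. x \<in> carrier H \<Longrightarrow> hnorm H ((S \<otimes>\<^bsub>B\<^esub> T) x) \<le> anorm B S * anorm B T * hnorm H x"
proof -
  show b: "hnorm H ((S \<otimes>\<^bsub>B\<^esub> T) x) \<le> anorm B S * anorm B T * hnorm H x" if x: "x \<in> carrier H" for x
    using hnorm_op_le[OF S bounded_opD(2)[OF T x]]
      mult_left_mono[OF hnorm_op_le[OF T x] anorm_nonneg[OF S]] x
    by (simp add: bounded_operators_simps(2) mult.assoc)
  show "S \<otimes>\<^bsub>B\<^esub> T \<in> carrier B"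
  proof (rule bounded_opI[OF _ _ _ _ b])
    show "S \<otimes>\<^bsub>B\<^esub> T \<in> extensional (carrier H)"
      unfolding bounded_operators_simps(2) by (rule restrict_extensional)
  qed (simp_all add: bounded_operators_simps(2) bounded_opD(2,3,4)[OF S] bounded_opD(2,3,4)[OF T])
qed

lemma op_add_closed:
  assumes S: "S \<in> carrier B" and T: "T \<in> carrier B"
  shows "S \<oplus>\<^bsub>B\<^esub> T \<in> carrier B"
    and "\<And>x. x \<in> carrier H \<Longrightarrow> hnorm H ((S \<oplus>\<^bsub>B\<^esub> T) x) \<le> (anorm B S + anorm B T) * hnorm H x"
proof -
  show b: "hnorm H ((S \<oplus>\<^bsub>B\<^esub> T) x) \<le> (anorm B S + anorm B T) * hnorm H x" if x: "x \<in> carrier H" for x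
    using hnorm_triangle[OF bounded_opD(2)[OF S x] bounded_opD(2)[OF T x]]
      hnorm_op_le[OF S x] hnorm_op_le[OF T x] x
    by (simp add: bounded_operators_simps(5) distrib_right)
  show "S \<oplus>\<^bsub>B\<^esub> T \<in> carrier B"
  proof (rule bounded_opI[OF _ _ _ _ b])
    show "S \<oplus>\<^bsub>B\<^esub> T \<in> extensional (carrier H)"
      unfolding bounded_operators_simps(5) by (rule restrict_extensional)
  qed (simp_all add: bounded_operators_simps(5) bounded_opD(2,3,4)[OF S] bounded_opD(2,3,4)[OF T]
          M.a_ac smult_r_distr)
qed

lemma op_smult_closed:
  assumes T: "T \<in> carrier B"
  shows "c \<odot>\<^bsub>B\<^esub> T \<in> carrier B"
    and "\<And>x. x \<in> carrier H \<Longrightarrow> hnorm H ((c \<odot>\<^bsub>B\<^esub> T) x) \<le> (cmod c * anorm B T) * hnorm H x"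
proof -
  show b: "hnorm H ((c \<odot>\<^bsub>B\<^esub> T) x) \<le> (cmod c * anorm B T) * hnorm H x" if x: "x \<in> carrier H" for x
    using mult_left_mono[OF hnorm_op_le[OF T x], of "cmod c"] x bounded_opD(2)[OF T x]
    by (simp add: bounded_operators_simps(6) hnorm_smult mult.assoc)
  show "c \<odot>\<^bsub>B\<^esub> T \<in> carrier B"
  proof (rule bounded_opI[OF _ _ _ _ b])
    show "c \<odot>\<^bsub>B\<^esub> T \<in> extensional (carrier H)"
      unfolding bounded_operators_simps(6) by (rule restrict_extensional)
  qed (simp_all add: bounded_operators_simps(6) bounded_opD(2,3,4)[OF T] smult_r_distr smult_smult mult.commute)
qed

lemma op_zero_closed: "\<zero>\<^bsub>B\<^esub> \<in> carrier B"
  by (rule bounded_opI[where C = 0])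
     (simp_all add: bounded_operators_simps(4) hnorm_zero smult_r_null)

lemma op_one_closed: "\<one>\<^bsub>B\<^esub> \<in> carrier B"
  by (rule bounded_opI[where C = 1]) (simp_all add: bounded_operators_simps(3))

lemma adjoint_op:
  assumes T: "T \<in> carrier B" and x: "x \<in> carrier H"
  shows "adjoint_op H T x \<in> carrier H" "\<And>y. y \<in> carrier H \<Longrightarrow> ip H (T y) x = ip H y (adjoint_op H T x)"
    and "\<And>z. z \<in> carrier H \<Longrightarrow> (\<And>y. y \<in> carrier H \<Longrightarrow> ip H (T y) x = ip H y z) \<Longrightarrow> adjoint_op H T x = z"
proof -
  let ?P = "\<lambda>z. z \<in> carrier H \<and> (\<forall>y\<in>carrier H. ip H (T y) x = ip H y z)"
  have uniq: "z = z'" if "?P z" "?P z'" for z z'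
  proof -
    have "ip H (z \<oplus> (-1) \<odot> z') (z \<oplus> (-1) \<odot> z') = 0"
      using that by (simp add: ip_add_right ip_smult_right)
    moreover have "z \<oplus> (-1) \<odot> z' \<in> carrier H" using that by simp
    ultimately have "z \<oplus> (-1) \<odot> z' = \<zero>" by (intro ip_definite)
    then show ?thesis using that eq_if_add_smult_neg[of z z'] by blast
  qed
  obtain z where z: "?P z" using adjoint_exists[OF T x] by blast
  have eq: "adjoint_op H T x = z'" if "?P z'" for z'
  proof -
    have "adjoint_op H T x = (THE z. ?P z)" using x by (simp add: adjoint_op_def)
    also have "\<dots> = z'" by (rule the_equality) (use that in simp, rule uniq[OF _ that])
    finally show ?thesis .
  qed
  show "adjoint_op H T x \<in> carrier H" "\<And>y. y \<in> carrier H \<Longrightarrow> ip H (T y) x = ip H y (adjoint_op H T x)"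
    using z eq[OF z] by auto
  show "adjoint_op H T x = z" if "z \<in> carrier H" "\<And>y. y \<in> carrier H \<Longrightarrow> ip H (T y) x = ip H y z" for z
    using that by (intro eq) blast
qed

text \<open>With S the adjoint of T, |S x|^2 = <T S x, x> <= norm(T) |S x| |x| by Cauchy-Schwarz,
  and one factor |S x| cancels.\<close>

lemma adjoint_op_closed:
  assumes T: "T \<in> carrier B"
  shows "adjoint_op H T \<in> carrier B"
    and "\<And>x. x \<in> carrier H \<Longrightarrow> hnorm H (adjoint_op H T x) \<le> anorm B T * hnorm H x"
proof -
  let ?S = "adjoint_op H T"
  note S = adjoint_op[OF T]
  show b: "hnorm H (?S x) \<le> anorm B T * hnorm H x" if x: "x \<in> carrier H" for x
  proof (cases "hnorm H (?S x) = 0")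
    case True
    then show ?thesis using anorm_nonneg[OF T] hnorm_nonneg[OF x] by simp
  next
    case False
    then have pos: "hnorm H (?S x) > 0" using hnorm_nonneg[OF S(1)[OF x]] by simp
    have "(hnorm H (?S x))\<^sup>2 = Re (ip H (T (?S x)) x)"
      using S(1)[OF x] S(2)[OF x S(1)[OF x]] by (simp add: hnorm_power2)
    also have "\<dots> \<le> hnorm H (T (?S x)) * hnorm H x"
      using Cauchy_Schwarz[OF bounded_opD(2)[OF T S(1)[OF x]] x] complex_Re_le_cmod order_trans by blast
    also have "\<dots> \<le> (anorm B T * hnorm H (?S x)) * hnorm H x"
      using hnorm_op_le[OF T S(1)[OF x]] hnorm_nonneg[OF x] by (rule mult_right_mono)
    finally have "hnorm H (?S x) * hnorm H (?S x) \<le> hnorm H (?S x) * (anorm B T * hnorm H x)"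
      by (simp add: power2_eq_square mult_ac)
    then show ?thesis using pos by simp
  qed
  show "?S \<in> carrier B"
  proof (rule bounded_opI[OF _ _ _ _ b])
    show "?S \<in> extensional (carrier H)" by (simp add: adjoint_op_def)
    show "?S (x \<oplus> y) = ?S x \<oplus> ?S y" if xy: "x \<in> carrier H" "y \<in> carrier H" for x y
      by (rule S(3)) (use xy S(1) S(2)[OF xy(1)] S(2)[OF xy(2)] bounded_opD(2)[OF T] in \<open>simp_all add: ip_add_right\<close>)
    show "?S (c \<odot> x) = c \<odot> ?S x" if x: "x \<in> carrier H" for c x
      by (rule S(3)) (use x S(1) S(2)[OF x] bounded_opD(2)[OF T] in \<open>simp_all add: ip_smult_right\<close>)
  qed (rule S(1))
qed

lemma op_minus:
  assumes S: "S \<in> carrier B" and T: "T \<in> carrier B" and grp: "abelian_group B" and x: "x \<in> carrier H"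
  shows "(S \<ominus>\<^bsub>B\<^esub> T) x = S x \<ominus> T x"
proof -
  interpret G: abelian_group B by (rule grp)
  have "\<ominus>\<^bsub>B\<^esub> T = (-1) \<odot>\<^bsub>B\<^esub> T"
  proof (rule G.minus_equality)
    show "(-1) \<odot>\<^bsub>B\<^esub> T \<oplus>\<^bsub>B\<^esub> T = \<zero>\<^bsub>B\<^esub>"
    proof (rule op_eqI)
      fix x assume x: "x \<in> carrier H"
      then show "((-1) \<odot>\<^bsub>B\<^esub> T \<oplus>\<^bsub>B\<^esub> T) x = \<zero>\<^bsub>B\<^esub> x"
        using add_smult_neg[OF bounded_opD(2)[OF T x]] bounded_opD(2)[OF T x]
        by (simp add: bounded_operators_simps(4,5,6) M.a_comm)
    qed (intro op_add_closed(1) op_smult_closed(1) op_zero_closed T)+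
  qed (intro op_smult_closed(1) T)+
  then show ?thesis
    using x bounded_opD(2)[OF T x] bounded_opD(2)[OF S x]
    by (simp add: a_minus_def[of B] bounded_operators_simps(5,6) minus_eq_smult)
qed

lemma abelian_group_ops: "abelian_group B"
proof (rule abelian_groupI)
  fix S T R assume S: "S \<in> carrier B" and T: "T \<in> carrier B" and R: "R \<in> carrier B"
  note c = bounded_opD(2)[OF S] bounded_opD(2)[OF T] bounded_opD(2)[OF R]
  show "S \<oplus>\<^bsub>B\<^esub> T \<in> carrier B" using S T by (rule op_add_closed)
  show "S \<oplus>\<^bsub>B\<^esub> T \<oplus>\<^bsub>B\<^esub> R = S \<oplus>\<^bsub>B\<^esub> (T \<oplus>\<^bsub>B\<^esub> R)"
    unfolding bounded_operators_simps(5) by (rule restrict_ext) (simp add: c M.a_assoc)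
  show "S \<oplus>\<^bsub>B\<^esub> T = T \<oplus>\<^bsub>B\<^esub> S"
    unfolding bounded_operators_simps(5) by (rule restrict_ext) (simp add: c M.a_comm)
  show "\<zero>\<^bsub>B\<^esub> \<oplus>\<^bsub>B\<^esub> S = S"
    by (rule op_eqI[OF op_add_closed(1)[OF op_zero_closed S] S]) (simp add: c bounded_operators_simps(4,5))
  show "\<exists>T\<in>carrier B. T \<oplus>\<^bsub>B\<^esub> S = \<zero>\<^bsub>B\<^esub>"
  proof (intro bexI[of _ "(-1) \<odot>\<^bsub>B\<^esub> S"])
    show "(-1) \<odot>\<^bsub>B\<^esub> S \<oplus>\<^bsub>B\<^esub> S = \<zero>\<^bsub>B\<^esub>"
      unfolding bounded_operators_simps(4,5,6)
    proof (rule restrict_ext)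
      fix x assume x: "x \<in> carrier H"
      have "(-1) \<odot> S x \<oplus> S x = S x \<oplus> (-1) \<odot> S x" using c(1)[OF x] by (intro M.a_comm) simp_all
      then show "(\<lambda>x\<in>carrier H. (-1) \<odot> S x) x \<oplus> S x = \<zero>" using x add_smult_neg[OF c(1)[OF x]] by simp
    qed
  qed (rule op_smult_closed(1)[OF S])
qed (rule op_zero_closed)

lemma ring_ops: "ring B"
proof (rule ringI[OF abelian_group_ops])
  show "monoid B"
  proof (rule monoidI)
    fix S T R assume S: "S \<in> carrier B" and T: "T \<in> carrier B" and R: "R \<in> carrier B"
    note c = bounded_opD(2)[OF S] bounded_opD(2)[OF T] bounded_opD(2)[OF R]
    show "S \<otimes>\<^bsub>B\<^esub> T \<in> carrier B" using S T by (rule op_mult_closed)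
    show "S \<otimes>\<^bsub>B\<^esub> T \<otimes>\<^bsub>B\<^esub> R = S \<otimes>\<^bsub>B\<^esub> (T \<otimes>\<^bsub>B\<^esub> R)"
      unfolding bounded_operators_simps(2) by (rule restrict_ext) (simp add: c)
    show "\<one>\<^bsub>B\<^esub> \<otimes>\<^bsub>B\<^esub> S = S" "S \<otimes>\<^bsub>B\<^esub> \<one>\<^bsub>B\<^esub> = S"
      by (rule op_eqI, intro op_mult_closed(1) op_one_closed S, rule S, simp add: c bounded_operators_simps(2,3))+
  qed (rule op_one_closed)
  fix S T R assume S: "S \<in> carrier B" and T: "T \<in> carrier B" and R: "R \<in> carrier B"
  note c = bounded_opD(2)[OF S] bounded_opD(2)[OF T] bounded_opD(2)[OF R]
  show "(S \<oplus>\<^bsub>B\<^esub> T) \<otimes>\<^bsub>B\<^esub> R = S \<otimes>\<^bsub>B\<^esub> R \<oplus>\<^bsub>B\<^esub> T \<otimes>\<^bsub>B\<^esub> R"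
    unfolding bounded_operators_simps(2,5) by (rule restrict_ext) (simp add: c)
  show "R \<otimes>\<^bsub>B\<^esub> (S \<oplus>\<^bsub>B\<^esub> T) = R \<otimes>\<^bsub>B\<^esub> S \<oplus>\<^bsub>B\<^esub> R \<otimes>\<^bsub>B\<^esub> T"
    unfolding bounded_operators_simps(2,5) by (rule restrict_ext) (simp add: c bounded_opD(3)[OF R])
qed

lemma vectorspace_ops: "vectorspace class_ring B"
proof -
  have "module class_ring B"
  proof (rule moduleI[OF class_cring.cring_axioms abelian_group_ops])
    fix a b :: complex and S T assume S: "S \<in> carrier B" and T: "T \<in> carrier B"
    note c = bounded_opD(2)[OF S] bounded_opD(2)[OF T]
    show "a \<odot>\<^bsub>B\<^esub> S \<in> carrier B" by (rule op_smult_closed(1)[OF S])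
    show "(a \<oplus>\<^bsub>class_ring\<^esub> b) \<odot>\<^bsub>B\<^esub> S = a \<odot>\<^bsub>B\<^esub> S \<oplus>\<^bsub>B\<^esub> b \<odot>\<^bsub>B\<^esub> S"
      unfolding bounded_operators_simps(5,6)
      by (rule restrict_ext) (use smult_l_distr[of a b] in \<open>simp add: c class_ring_simps\<close>)
    show "a \<odot>\<^bsub>B\<^esub> (S \<oplus>\<^bsub>B\<^esub> T) = a \<odot>\<^bsub>B\<^esub> S \<oplus>\<^bsub>B\<^esub> a \<odot>\<^bsub>B\<^esub> T"
      unfolding bounded_operators_simps(5,6) by (rule restrict_ext) (simp add: c smult_r_distr)
    show "(a \<otimes>\<^bsub>class_ring\<^esub> b) \<odot>\<^bsub>B\<^esub> S = a \<odot>\<^bsub>B\<^esub> (b \<odot>\<^bsub>B\<^esub> S)"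
      unfolding bounded_operators_simps(6) by (rule restrict_ext) (simp add: c smult_smult class_ring_simps)
    show "\<one>\<^bsub>class_ring\<^esub> \<odot>\<^bsub>B\<^esub> S = S"
      by (rule op_eqI[OF op_smult_closed(1)[OF S] S]) (simp add: c bounded_operators_simps(6) one_smult class_ring_simps)
  qed
  then show ?thesis using class_field by (simp add: vectorspace_def)
qed

section \<open>The operator norm\<close>

lemma op_norm_triangle:
  "S \<in> carrier B \<Longrightarrow> T \<in> carrier B \<Longrightarrow> anorm B (S \<oplus>\<^bsub>B\<^esub> T) \<le> anorm B S + anorm B T"
  by (rule anorm_le[OF _ op_add_closed(2)]) (simp_all add: anorm_nonneg)

lemma op_norm_mult:
  "S \<in> carrier B \<Longrightarrow> T \<in> carrier B \<Longrightarrow> anorm B (S \<otimes>\<^bsub>B\<^esub> T) \<le> anorm B S * anorm B T"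
  by (rule anorm_le[OF _ op_mult_closed(2)]) (simp_all add: anorm_nonneg)

lemma op_norm_eq_0_iff:
  assumes T: "T \<in> carrier B" shows "anorm B T = 0 \<longleftrightarrow> T = \<zero>\<^bsub>B\<^esub>"
proof
  assume 0: "anorm B T = 0"
  show "T = \<zero>\<^bsub>B\<^esub>"
  proof (rule op_eqI[OF T op_zero_closed])
    fix x assume x: "x \<in> carrier H"
    have "hnorm H (T x) = 0"
      using hnorm_op_le[OF T x] hnorm_nonneg[OF bounded_opD(2)[OF T x]] by (simp add: 0)
    then show "T x = \<zero>\<^bsub>B\<^esub> x"
      using hnorm_eq_0_iff[OF bounded_opD(2)[OF T x]] x by (simp add: bounded_operators_simps(4))
  qed
next
  assume "T = \<zero>\<^bsub>B\<^esub>"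
  then have "anorm B T \<le> 0" by (intro anorm_le) (simp_all add: bounded_operators_simps(4) hnorm_zero)
  then show "anorm B T = 0" using anorm_nonneg[OF T] by simp
qed

lemma op_norm_smult:
  assumes T: "T \<in> carrier B" shows "anorm B (c \<odot>\<^bsub>B\<^esub> T) = cmod c * anorm B T"
proof (rule antisym)
  show "anorm B (c \<odot>\<^bsub>B\<^esub> T) \<le> cmod c * anorm B T"
    by (rule anorm_le[OF _ op_smult_closed(2)]) (use T in \<open>simp_all add: anorm_nonneg\<close>)
  show "cmod c * anorm B T \<le> anorm B (c \<odot>\<^bsub>B\<^esub> T)"
  proof (cases "c = 0")
    case True
    then show ?thesis using anorm_nonneg[OF op_smult_closed(1)[OF T, of c]] by simp
  next
    case False
    have "anorm B T \<le> anorm B (c \<odot>\<^bsub>B\<^esub> T) / cmod c"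
    proof (rule anorm_le)
      fix x assume x: "x \<in> carrier H"
      have "cmod c * hnorm H (T x) \<le> anorm B (c \<odot>\<^bsub>B\<^esub> T) * hnorm H x"
        using hnorm_op_le[OF op_smult_closed(1)[OF T, of c] x] x bounded_opD(2)[OF T x]
        by (simp add: bounded_operators_simps(6) hnorm_smult)
      then show "hnorm H (T x) \<le> anorm B (c \<odot>\<^bsub>B\<^esub> T) / cmod c * hnorm H x"
        using False by (simp add: field_simps)
    qed (simp add: anorm_nonneg op_smult_closed T)
    then show ?thesis using False by (simp add: field_simps)
  qed
qed

lemma op_cstar_identity:
  assumes T: "T \<in> carrier B"
  shows "anorm B (adjoint_op H T \<otimes>\<^bsub>B\<^esub> T) = (anorm B T)\<^sup>2"
proof (rule antisym)
  note aT = adjoint_op_closed(1)[OF T]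
  have "anorm B (adjoint_op H T) \<le> anorm B T"
    by (rule anorm_le[OF anorm_nonneg[OF T] adjoint_op_closed(2)[OF T]])
  then have "anorm B (adjoint_op H T) * anorm B T \<le> anorm B T * anorm B T"
    by (rule mult_right_mono) (rule anorm_nonneg[OF T])
  then show "anorm B (adjoint_op H T \<otimes>\<^bsub>B\<^esub> T) \<le> (anorm B T)\<^sup>2"
    using op_norm_mult[OF aT T] by (simp add: power2_eq_square)
  let ?N = "anorm B (adjoint_op H T \<otimes>\<^bsub>B\<^esub> T)"
  have N: "?N \<ge> 0" by (intro anorm_nonneg op_mult_closed aT T)
  have "anorm B T \<le> sqrt ?N"
  proof (rule anorm_le)
    fix x assume x: "x \<in> carrier H"
    note Tx = bounded_opD(2)[OF T x]
    have "(hnorm H (T x))\<^sup>2 = Re (ip H x (adjoint_op H T (T x)))"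
      using adjoint_op(2)[OF T Tx x] Tx by (simp add: hnorm_power2)
    also have "\<dots> \<le> hnorm H x * hnorm H (adjoint_op H T (T x))"
      using Cauchy_Schwarz[OF x adjoint_op(1)[OF T Tx]] complex_Re_le_cmod order_trans by blast
    also have "\<dots> \<le> hnorm H x * (?N * hnorm H x)"
      using hnorm_op_le[OF op_mult_closed(1)[OF aT T] x] hnorm_nonneg[OF x] x
      by (intro mult_left_mono) (simp_all add: bounded_operators_simps(2))
    also have "\<dots> = (sqrt ?N * hnorm H x)\<^sup>2" using N by (simp add: power_mult_distrib power2_eq_square)
    finally show "hnorm H (T x) \<le> sqrt ?N * hnorm H x"
      by (rule power2_le_imp_le) (use N hnorm_nonneg[OF x] in simp)
  qed (simp add: N)
  then show "(anorm B T)\<^sup>2 \<le> ?N"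
    using power_mono[of "anorm B T" "sqrt ?N" 2] anorm_nonneg[OF T] N by simp
qed

text \<open>A Cauchy sequence of operators converges pointwise to some \<open>L\<close>. The
  estimate \<open>uniform\<close>, with a constant times the norm of \<open>x\<close>, makes
  \<open>L\<close> bounded and turns pointwise convergence into norm convergence.\<close>

lemma mcomplete_ops: "Metric_space.mcomplete (carrier B) (alg_dist B)"
proof -
  interpret bm: Metric_space "carrier B" "alg_dist B"
    by (rule Metric_space_norm_dist[OF vectorspace_ops])
       (simp_all only: anorm_nonneg op_norm_eq_0_iff op_norm_triangle op_norm_smult)
  interpret G: abelian_group B by (rule abelian_group_ops)
  have dB: "alg_dist B S T = anorm B (S \<ominus>\<^bsub>B\<^esub> T)" if "S \<in> carrier B" "T \<in> carrier B" for S T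
    using that by (simp add: norm_dist_def)
  have dH: "norm_dist H (hnorm H) x y = hnorm H (x \<ominus> y)" if "x \<in> carrier H" "y \<in> carrier H" for x y
    using that by (simp add: norm_dist_def)
  show ?thesis
    unfolding bm.mcomplete_def
  proof (intro allI impI)
    fix T assume cauchy: "bm.MCauchy T"
    have T: "T n \<in> carrier B" for n using cauchy by (auto simp: bm.MCauchy_def)
    note Tc = bounded_opD(2)[OF T]
    have diff_le: "norm_dist H (hnorm H) (T m x) (T n x) \<le> alg_dist B (T m) (T n) * hnorm H x"
      if x: "x \<in> carrier H" for m n x
      using hnorm_op_le[OF G.minus_closed[OF T T] x, of m n] x
      by (simp add: dB T dH Tc op_minus[OF T T abelian_group_ops])
    have ev: "\<exists>N. \<forall>m n. N \<le> m \<longrightarrow> N \<le> n \<longrightarrow> alg_dist B (T m) (T n) < e" if "e > 0" for e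
      using cauchy that unfolding bm.MCauchy_def by blast
    have "\<exists>l. limitin met.mtopology (\<lambda>n. T n x) l sequentially" if x: "x \<in> carrier H" for x
    proof -
      have "met.MCauchy (\<lambda>n. T n x)"
        unfolding met.MCauchy_def
      proof (intro conjI allI impI)
        show "range (\<lambda>n. T n x) \<subseteq> carrier H" using Tc[OF x] by auto
        fix e :: real assume e: "e > 0"
        have h: "hnorm H x + 1 > 0" using hnorm_nonneg[OF x] by simp
        then obtain N where N: "\<And>m n. N \<le> m \<Longrightarrow> N \<le> n \<Longrightarrow> alg_dist B (T m) (T n) < e / (hnorm H x + 1)"
          using ev[of "e / (hnorm H x + 1)"] e by auto
        have "norm_dist H (hnorm H) (T m x) (T n x) < e" if "N \<le> m" "N \<le> n" for m n
        proof -
          have "alg_dist B (T m) (T n) * hnorm H x \<le> alg_dist B (T m) (T n) * (hnorm H x + 1)"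
            by (intro mult_left_mono) simp_all
          also have "\<dots> < e" using N[OF that] h by (simp add: field_simps)
          finally show ?thesis using diff_le[OF x, of m n] by simp
        qed
        then show "\<exists>N. \<forall>n n'. N \<le> n \<longrightarrow> N \<le> n' \<longrightarrow> norm_dist H (hnorm H) (T n x) (T n' x) < e" by blast
      qed
      then show ?thesis using complete by (auto simp: met.mcomplete_def)
    qed
    then obtain L where L: "\<And>x. x \<in> carrier H \<Longrightarrow> limitin met.mtopology (\<lambda>n. T n x) (L x) sequentially" by metis
    have Lc: "L x \<in> carrier H" if "x \<in> carrier H" for x using L[OF that] by (simp add: met.limitin_metric)
    have Lt: "(\<lambda>n. norm_dist H (hnorm H) (T n x) (L x)) \<longlonglongrightarrow> 0" if "x \<in> carrier H" for x
      using L[OF that] by (simp add: met.limitin_metric_dist_null)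
    have uniform: "norm_dist H (hnorm H) (T m x) (L x) \<le> e * hnorm H x"
      if x: "x \<in> carrier H" and m: "\<And>n. n \<ge> m \<Longrightarrow> alg_dist B (T m) (T n) < e" for m x e
    proof (rule LIMSEQ_le_const)
      show "(\<lambda>n. e * hnorm H x + norm_dist H (hnorm H) (T n x) (L x)) \<longlonglongrightarrow> e * hnorm H x"
        using tendsto_add[OF tendsto_const Lt[OF x]] by simp
      show "\<exists>N. \<forall>n\<ge>N. norm_dist H (hnorm H) (T m x) (L x) \<le> e * hnorm H x + norm_dist H (hnorm H) (T n x) (L x)"
      proof (intro exI allI impI)
        fix n assume n: "n \<ge> m"
        have "norm_dist H (hnorm H) (T m x) (L x) \<le> norm_dist H (hnorm H) (T m x) (T n x) + norm_dist H (hnorm H) (T n x) (L x)"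
          by (rule met.triangle[OF Tc[OF x] Tc[OF x] Lc[OF x]])
        moreover have "alg_dist B (T m) (T n) * hnorm H x \<le> e * hnorm H x"
          using m[OF n] hnorm_nonneg[OF x] by (intro mult_right_mono) simp_all
        ultimately show "norm_dist H (hnorm H) (T m x) (L x) \<le> e * hnorm H x + norm_dist H (hnorm H) (T n x) (L x)"
          using diff_le[OF x, of m n] by linarith
      qed
    qed
    \<comment> \<open>Linearity of the limit is obtained by bounding the distance of the two sides
      by sequences that tend to 0.\<close>
    have unique: "y = z" if "y \<in> carrier H" "z \<in> carrier H"
      "\<And>n. norm_dist H (hnorm H) y z \<le> f n" "f \<longlonglongrightarrow> 0" for y z and f :: "nat \<Rightarrow> real"
    proof -
      have "norm_dist H (hnorm H) y z \<le> 0"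
        using that(3) by (intro LIMSEQ_le_const[OF that(4)]) blast
      then show ?thesis using met.nonneg[of y z] met.zero[OF that(1,2)] by simp
    qed
    have L_add: "L (x \<oplus> y) = L x \<oplus> L y" if x: "x \<in> carrier H" and y: "y \<in> carrier H" for x y
    proof (rule unique)
      let ?d = "norm_dist H (hnorm H)"
      fix n
      have "?d (T n x \<oplus> T n y) (L x \<oplus> L y) \<le> ?d (T n x) (L x) + ?d (T n y) (L y)"
      proof -
        have "(T n x \<oplus> T n y) \<ominus> (L x \<oplus> L y) = (T n x \<ominus> L x) \<oplus> (T n y \<ominus> L y)"
          using Tc[OF x] Tc[OF y] Lc[OF x] Lc[OF y] by (simp add: M.minus_eq M.minus_add M.a_ac)
        then show ?thesis
          using hnorm_triangle[of "T n x \<ominus> L x" "T n y \<ominus> L y"] Tc[OF x] Tc[OF y] Lc[OF x] Lc[OF y]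
          by (simp add: dH)
      qed
      then show "?d (L (x \<oplus> y)) (L x \<oplus> L y)
          \<le> ?d (T n (x \<oplus> y)) (L (x \<oplus> y)) + (?d (T n x) (L x) + ?d (T n y) (L y))"
        using met.triangle[of "L (x \<oplus> y)" "T n (x \<oplus> y)" "L x \<oplus> L y"] x y Lc Tc
        by (simp add: bounded_opD(3)[OF T x y] met.commute)
    next
      show "(\<lambda>n. norm_dist H (hnorm H) (T n (x \<oplus> y)) (L (x \<oplus> y)) +
          (norm_dist H (hnorm H) (T n x) (L x) + norm_dist H (hnorm H) (T n y) (L y))) \<longlonglongrightarrow> 0"
        using x y by (auto intro!: tendsto_eq_intros Lt)
    qed (use x y Lc in simp_all)
    have L_sm: "L (c \<odot> x) = c \<odot> L x" if x: "x \<in> carrier H" for c x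
    proof (rule unique)
      let ?d = "norm_dist H (hnorm H)"
      fix n
      have "?d (c \<odot> T n x) (c \<odot> L x) = cmod c * ?d (T n x) (L x)"
      proof -
        have "c \<odot> T n x \<ominus> c \<odot> L x = c \<odot> (T n x \<ominus> L x)"
          using Tc[OF x] Lc[OF x] by (simp add: minus_eq_smult smult_r_distr smult_smult mult.commute)
        then show ?thesis using Tc[OF x] Lc[OF x] by (simp add: dH hnorm_smult)
      qed
      then show "?d (L (c \<odot> x)) (c \<odot> L x) \<le> ?d (T n (c \<odot> x)) (L (c \<odot> x)) + cmod c * ?d (T n x) (L x)"
        using met.triangle[of "L (c \<odot> x)" "T n (c \<odot> x)" "c \<odot> L x"] x Lc Tc
        by (simp add: bounded_opD(4)[OF T x] met.commute)
    next
      show "(\<lambda>n. norm_dist H (hnorm H) (T n (c \<odot> x)) (L (c \<odot> x)) +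
          cmod c * norm_dist H (hnorm H) (T n x) (L x)) \<longlonglongrightarrow> 0"
        using x by (auto intro!: tendsto_eq_intros Lt)
    qed (use x Lc in simp_all)
    define S where "S = restrict L (carrier H)"
    have Sx: "S x = L x" if "x \<in> carrier H" for x using that by (simp add: S_def)
    obtain N where N: "\<And>n. n \<ge> N \<Longrightarrow> alg_dist B (T N) (T n) < 1" using ev[of 1] by auto
    have S: "S \<in> carrier B"
    proof (rule bounded_opI[where C = "anorm B (T N) + 1"])
      fix x assume x: "x \<in> carrier H"
      have "S x = T N x \<oplus> (-1) \<odot> (T N x \<ominus> L x)"
      proof -
        have "(-1) \<odot> (T N x \<ominus> L x) = (-1) \<odot> T N x \<oplus> L x"
          using Tc[OF x] Lc[OF x] by (simp add: minus_eq_smult smult_r_distr smult_smult one_smult)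
        moreover have "T N x \<oplus> ((-1) \<odot> T N x \<oplus> L x) = (T N x \<oplus> (-1) \<odot> T N x) \<oplus> L x"
          using Tc[OF x] Lc[OF x] by (simp add: M.a_assoc)
        ultimately show ?thesis using Tc[OF x] Lc[OF x] by (simp add: Sx x add_smult_neg)
      qed
      then have "hnorm H (S x) \<le> hnorm H (T N x) + hnorm H (T N x \<ominus> L x)"
        using hnorm_triangle[of "T N x" "(-1) \<odot> (T N x \<ominus> L x)"] Tc[OF x] Lc[OF x] by (simp add: hnorm_smult)
      also have "hnorm H (T N x \<ominus> L x) \<le> 1 * hnorm H x"
        using uniform[OF x N] Tc[OF x] Lc[OF x] by (simp add: dH)
      finally show "hnorm H (S x) \<le> (anorm B (T N) + 1) * hnorm H x"
        using hnorm_op_le[OF T x, of N] by (simp add: distrib_right)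
    qed (simp_all add: Sx L_add L_sm Lc, simp add: S_def)
    have "(\<lambda>n. alg_dist B (T n) S) \<longlonglongrightarrow> 0"
    proof (rule LIMSEQ_I)
      fix e :: real assume e: "e > 0"
      obtain K where K: "\<And>m n. m \<ge> K \<Longrightarrow> n \<ge> K \<Longrightarrow> alg_dist B (T m) (T n) < e / 2" using ev[of "e / 2"] e by auto
      have "alg_dist B (T n) S \<le> e / 2" if n: "n \<ge> K" for n
        unfolding dB[OF T S]
      proof (rule anorm_le)
        fix x assume x: "x \<in> carrier H"
        have "norm_dist H (hnorm H) (T n x) (L x) \<le> e / 2 * hnorm H x"
          using K n by (intro uniform[OF x]) auto
        then show "hnorm H ((T n \<ominus>\<^bsub>B\<^esub> S) x) \<le> e / 2 * hnorm H x"
          by (simp add: op_minus[OF T S abelian_group_ops x] Sx x dH Tc Lc)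
      qed (use e in simp)
      then show "\<exists>K. \<forall>n\<ge>K. norm (alg_dist B (T n) S - 0) < e"
        using e by (intro exI[of _ K]) (force intro: le_less_trans)
    qed
    then show "\<exists>S. limitin bm.mtopology T S sequentially"
      using S T by (intro exI[of _ S]) (simp add: bm.limitin_metric_dist_null)
  qed
qed

theorem unital_cstar_algebra_ops: "unital_cstar_algebra B"
proof (rule unital_cstar_algebra.intro)
  show "ring B" by (rule ring_ops)
  show "vectorspace class_ring B" by (rule vectorspace_ops)
  show "Metric_space.mcomplete (carrier B) (alg_dist B)" by (rule mcomplete_ops)
  fix S T and c :: complex assume S: "S \<in> carrier B" and T: "T \<in> carrier B"
  note s = bounded_opD(2)[OF S] bounded_opD(2)[OF T]
  note aS = adjoint_op(1,2)[OF S] and aT = adjoint_op(1,2)[OF T]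
  show "(c \<odot>\<^bsub>B\<^esub> S) \<otimes>\<^bsub>B\<^esub> T = c \<odot>\<^bsub>B\<^esub> (S \<otimes>\<^bsub>B\<^esub> T)"
    unfolding bounded_operators_simps(2,6) by (rule restrict_ext) (simp add: s)
  show "S \<otimes>\<^bsub>B\<^esub> (c \<odot>\<^bsub>B\<^esub> T) = c \<odot>\<^bsub>B\<^esub> (S \<otimes>\<^bsub>B\<^esub> T)"
    unfolding bounded_operators_simps(2,6) by (rule restrict_ext) (simp add: s bounded_opD(4)[OF S])
  have star: "star B = adjoint_op H" by (rule bounded_operators_simps)
  note closed = adjoint_op_closed(1) op_add_closed(1) op_mult_closed(1) op_smult_closed(1)
  show "star B S \<in> carrier B" unfolding star by (rule adjoint_op_closed(1)[OF S])
  show "star B (star B S) = S"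
    unfolding star
  proof (rule op_eqI)
    fix x assume x: "x \<in> carrier H"
    show "adjoint_op H (adjoint_op H S) x = S x"
    proof (rule adjoint_op(3)[OF adjoint_op_closed(1)[OF S] x])
      fix y assume y: "y \<in> carrier H"
      have "ip H (adjoint_op H S y) x = cnj (ip H x (adjoint_op H S y))"
        by (rule ip_commute[OF x aS(1)[OF y]])
      also have "\<dots> = cnj (ip H (S x) y)" by (simp only: aS(2)[OF y x])
      also have "\<dots> = ip H y (S x)" by (rule ip_commute[OF s(1)[OF x] y, symmetric])
      finally show "ip H (adjoint_op H S y) x = ip H y (S x)" .
    qed (rule s(1)[OF x])
  qed (intro closed S)+
  show "star B (S \<oplus>\<^bsub>B\<^esub> T) = star B S \<oplus>\<^bsub>B\<^esub> star B T"
    unfolding star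
  proof (rule op_eqI)
    fix x assume x: "x \<in> carrier H"
    show "adjoint_op H (S \<oplus>\<^bsub>B\<^esub> T) x = (adjoint_op H S \<oplus>\<^bsub>B\<^esub> adjoint_op H T) x"
      by (rule adjoint_op(3)[OF op_add_closed(1)[OF S T] x])
         (use x s aS aT in \<open>simp_all add: bounded_operators_simps(5) ip_add_left ip_add_right\<close>)
  qed (intro closed S T)+
  show "star B (c \<odot>\<^bsub>B\<^esub> S) = cnj c \<odot>\<^bsub>B\<^esub> star B S"
    unfolding star
  proof (rule op_eqI)
    fix x assume x: "x \<in> carrier H"
    show "adjoint_op H (c \<odot>\<^bsub>B\<^esub> S) x = (cnj c \<odot>\<^bsub>B\<^esub> adjoint_op H S) x"
      by (rule adjoint_op(3)[OF op_smult_closed(1)[OF S] x])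
         (use x s aS in \<open>simp_all add: bounded_operators_simps(6) ip_smult_left ip_smult_right\<close>)
  qed (intro closed S)+
  show "star B (S \<otimes>\<^bsub>B\<^esub> T) = star B T \<otimes>\<^bsub>B\<^esub> star B S"
    unfolding star
  proof (rule op_eqI)
    fix x assume x: "x \<in> carrier H"
    show "adjoint_op H (S \<otimes>\<^bsub>B\<^esub> T) x = (adjoint_op H T \<otimes>\<^bsub>B\<^esub> adjoint_op H S) x"
      by (rule adjoint_op(3)[OF op_mult_closed(1)[OF S T] x])
         (use x s aS aT in \<open>simp_all add: bounded_operators_simps(2)\<close>)
  qed (intro closed S T)+
  show "0 \<le> anorm B S" by (rule anorm_nonneg[OF S])
  show "anorm B S = 0 \<longleftrightarrow> S = \<zero>\<^bsub>B\<^esub>" by (rule op_norm_eq_0_iff[OF S])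
  show "anorm B (S \<oplus>\<^bsub>B\<^esub> T) \<le> anorm B S + anorm B T" by (rule op_norm_triangle[OF S T])
  show "anorm B (c \<odot>\<^bsub>B\<^esub> S) = cmod c * anorm B S" by (rule op_norm_smult[OF S])
  show "anorm B (S \<otimes>\<^bsub>B\<^esub> T) \<le> anorm B S * anorm B T" by (rule op_norm_mult[OF S T])
  show "anorm B (star B S \<otimes>\<^bsub>B\<^esub> S) = (anorm B S)\<^sup>2" unfolding star by (rule op_cstar_identity[OF S])
qed

text \<open>Preservation of the inner product says that the adjoint is a left inverse; surjectivity
  makes it a right inverse as well.\<close>

lemma unitary_of_isometry:
  assumes T: "isometry_op H T" and surj: "\<And>y. y \<in> carrier H \<Longrightarrow> \<exists>x\<in>carrier H. T x = y"
  shows "unitary_in B (restrict T (carrier H))"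
proof -
  let ?U = "restrict T (carrier H)"
  have Tc: "T x \<in> carrier H" if "x \<in> carrier H" for x by (rule isometry_opD(1)[OF T that])
  have U: "?U \<in> carrier B"
    by (rule bounded_opI[where C = 1])
       (simp_all add: isometry_opD[OF T] isometry_op_hnorm[OF T])
  have adj: "adjoint_op H ?U (T x) = x" if x: "x \<in> carrier H" for x
    by (rule adjoint_op(3)[OF U Tc[OF x]]) (use x in \<open>simp_all add: isometry_opD(4)[OF T]\<close>)
  have "adjoint_op H ?U \<otimes>\<^bsub>B\<^esub> ?U = \<one>\<^bsub>B\<^esub>"
    unfolding bounded_operators_simps(2,3) by (rule restrict_ext) (simp add: adj Tc)
  moreover have "?U \<otimes>\<^bsub>B\<^esub> adjoint_op H ?U = \<one>\<^bsub>B\<^esub>"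
    unfolding bounded_operators_simps(2,3)
  proof (rule restrict_ext)
    fix y assume "y \<in> carrier H"
    then obtain x where x: "x \<in> carrier H" "y = T x" using surj by blast
    then show "?U (adjoint_op H ?U y) = y" by (simp add: adj)
  qed
  ultimately show ?thesis using U by (simp add: unitary_in_def bounded_operators_simps(7))
qed

end

lemma hilbert_space_with_adjoints_cvec_space: "hilbert_space_with_adjoints (cvec_space n)"
proof -
  interpret hilbert_space "cvec_space n" by (rule hilbert_space_cvec_space)
  show ?thesis
  proof (unfold_locales)
    fix T x assume T: "T \<in> carrier (bounded_operators (cvec_space n))" and x: "x \<in> carrier (cvec_space n)"
    define A where "A = mat n n (\<lambda>(i, j). T (unit_vec n j) $ i)"
    have A: "A \<in> carrier_mat n n" by (simp add: A_def)
    have TA: "T y = A *\<^sub>v y" if "y \<in> carrier_vec n" for y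
      unfolding A_def by (rule cvec_hom_eq_mat[OF _ that]) (use T in \<open>simp add: bounded_operators_simps(1)\<close>)
    \<comment> \<open>The conjugate transpose of the matrix applied to \<open>x\<close>.\<close>
    define z where "z = vec n (\<lambda>j. cnj (\<Sum>i<n. A $$ (i, j) * cnj (x $ i)))"
    have "ip (cvec_space n) (T y) x = ip (cvec_space n) y z" if y: "y \<in> carrier_vec n" for y
    proof -
      have "ip (cvec_space n) (T y) x = (\<Sum>i<n. (\<Sum>j<n. A $$ (i, j) * y $ j) * cnj (x $ i))"
        using y A by (simp add: ip_cvec_space TA scalar_prod_def lessThan_atLeast0)
      also have "\<dots> = (\<Sum>j<n. \<Sum>i<n. A $$ (i, j) * y $ j * cnj (x $ i))"
        unfolding sum_distrib_right by (rule sum.swap)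
      also have "\<dots> = ip (cvec_space n) y z"
        by (simp add: ip_cvec_space z_def sum_distrib_left mult_ac)
      finally show ?thesis .
    qed
    then show "\<exists>z\<in>carrier (cvec_space n). \<forall>y\<in>carrier (cvec_space n).
        ip (cvec_space n) (T y) x = ip (cvec_space n) y z"
      by (intro bexI[of _ z]) (simp_all add: z_def)
  qed
qed

lemma isometry_surjective_cvec_space:
  assumes T: "isometry_op (cvec_space n) T" and y: "y \<in> carrier_vec n"
  shows "\<exists>x\<in>carrier_vec n. T x = y"
proof -
  interpret hilbert_space "cvec_space n" by (rule hilbert_space_cvec_space)
  show ?thesis
  proof (rule injective_imp_surjective_cvec_space[OF _ _ y])
    show "T \<in> module_hom class_ring (cvec_space n) (cvec_space n)" using T by (simp add: isometry_op_def)
    show "x = 0\<^sub>v n" if x: "x \<in> carrier_vec n" "T x = 0\<^sub>v n" for x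
      using hnorm_eq_0_iff[of x] hnorm_eq_0_iff[of "0\<^sub>v n"] isometry_op_hnorm[OF T, of x] x by simp
  qed
qed

section \<open>Transport of structure\<close>

text \<open>Copies an algebra along a map \<open>g\<close>, injective on its carrier in all uses.
  The universal property speaks only of algebras on the type \<open>'d\<close>, so operator algebras
  have to be moved there first.\<close>

definition transport :: "('a \<Rightarrow> 'd) \<Rightarrow> 'a normed_star_algebra \<Rightarrow> 'd normed_star_algebra" where
  "transport g A = (let h = inv_into (carrier A) g in
    \<lparr>carrier = g ` carrier A,
     mult = (\<lambda>x y. g (h x \<otimes>\<^bsub>A\<^esub> h y)),
     one = g \<one>\<^bsub>A\<^esub>,
     zero = g \<zero>\<^bsub>A\<^esub>,
     add = (\<lambda>x y. g (h x \<oplus>\<^bsub>A\<^esub> h y)),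
     smult = (\<lambda>c x. g (c \<odot>\<^bsub>A\<^esub> h x)),
     star = (\<lambda>x. g (star A (h x))),
     anorm = (\<lambda>x. anorm A (h x))\<rparr>)"

locale transported_cstar_algebra = unital_cstar_algebra A for A :: "'a normed_star_algebra" (structure) +
  fixes g :: "'a \<Rightarrow> 'd"
  assumes inj: "inj_on g (carrier A)"
begin

abbreviation "D \<equiv> transport g A"

lemma inv_g: "x \<in> carrier A \<Longrightarrow> inv_into (carrier A) g (g x) = x"
  by (rule inv_into_f_f[OF inj])

lemma transport_simps:
  "carrier D = g ` carrier A" "\<one>\<^bsub>D\<^esub> = g \<one>" "\<zero>\<^bsub>D\<^esub> = g \<zero>"
  "x \<in> carrier A \<Longrightarrow> y \<in> carrier A \<Longrightarrow> g x \<otimes>\<^bsub>D\<^esub> g y = g (x \<otimes> y)"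
  "x \<in> carrier A \<Longrightarrow> y \<in> carrier A \<Longrightarrow> g x \<oplus>\<^bsub>D\<^esub> g y = g (x \<oplus> y)"
  "x \<in> carrier A \<Longrightarrow> c \<odot>\<^bsub>D\<^esub> g x = g (c \<odot> x)"
  "x \<in> carrier A \<Longrightarrow> star D (g x) = g (star A x)"
  "x \<in> carrier A \<Longrightarrow> anorm D (g x) = anorm A x"
  by (simp_all add: transport_def Let_def inv_g)

lemma g_eq_iff: "x \<in> carrier A \<Longrightarrow> y \<in> carrier A \<Longrightarrow> g x = g y \<longleftrightarrow> x = y"
  using inj by (rule inj_on_eq_iff)

lemma transport_elim:
  assumes "x \<in> carrier D" obtains a where "a \<in> carrier A" "x = g a"
  using assms by (auto simp: transport_simps(1))

lemma abelian_group_transport: "abelian_group D"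
proof (rule abelian_groupI)
  show "\<exists>y\<in>carrier D. y \<oplus>\<^bsub>D\<^esub> x = \<zero>\<^bsub>D\<^esub>" if x: "x \<in> carrier D" for x
  proof -
    obtain a where a: "a \<in> carrier A" "x = g a" using x by (rule transport_elim)
    show ?thesis
      by (intro bexI[of _ "g (\<ominus> a)"]) (use a in \<open>simp_all add: transport_simps alg.l_neg\<close>)
  qed
qed (auto simp: transport_simps alg.a_ac)

lemma minus_transport:
  assumes "x \<in> carrier A" "y \<in> carrier A"
  shows "g x \<ominus>\<^bsub>D\<^esub> g y = g (x \<ominus> y)"
proof -
  interpret G: abelian_group D by (rule abelian_group_transport)
  have "\<ominus>\<^bsub>D\<^esub> g y = g (\<ominus> y)"
    by (rule G.minus_equality) (use assms in \<open>simp_all add: transport_simps alg.l_neg\<close>)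
  then show ?thesis using assms by (simp add: a_minus_def transport_simps)
qed

theorem unital_cstar_algebra_transport: "unital_cstar_algebra D"
proof (rule unital_cstar_algebra.intro)
  note closed = star_closed smult_closed_C
  show "ring D"
  proof (rule ringI[OF abelian_group_transport])
    show "monoid D" by (rule monoidI) (auto simp: transport_simps alg.m_assoc)
  qed (auto simp: transport_simps alg.l_distr alg.r_distr)
  have "module class_ring D"
    by (rule moduleI[OF class_cring.cring_axioms abelian_group_transport])
       (auto simp: transport_simps class_ring_simps closed smult_add_left_C smult_add_right_C
          smult_smult_C one_smult_C)
  then show V: "vectorspace class_ring D" using class_field by (simp add: vectorspace_def)
  show "c \<odot>\<^bsub>D\<^esub> x \<otimes>\<^bsub>D\<^esub> y = c \<odot>\<^bsub>D\<^esub> (x \<otimes>\<^bsub>D\<^esub> y)" "x \<otimes>\<^bsub>D\<^esub> (c \<odot>\<^bsub>D\<^esub> y) = c \<odot>\<^bsub>D\<^esub> (x \<otimes>\<^bsub>D\<^esub> y)"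
    "star D (x \<oplus>\<^bsub>D\<^esub> y) = star D x \<oplus>\<^bsub>D\<^esub> star D y" "star D (x \<otimes>\<^bsub>D\<^esub> y) = star D y \<otimes>\<^bsub>D\<^esub> star D x"
    "anorm D (x \<oplus>\<^bsub>D\<^esub> y) \<le> anorm D x + anorm D y" "anorm D (x \<otimes>\<^bsub>D\<^esub> y) \<le> anorm D x * anorm D y"
    if xy: "x \<in> carrier D" "y \<in> carrier D" for x y c
  proof -
    obtain a where a: "a \<in> carrier A" "x = g a" using xy(1) by (rule transport_elim)
    obtain b where b: "b \<in> carrier A" "y = g b" using xy(2) by (rule transport_elim)
    show "c \<odot>\<^bsub>D\<^esub> x \<otimes>\<^bsub>D\<^esub> y = c \<odot>\<^bsub>D\<^esub> (x \<otimes>\<^bsub>D\<^esub> y)" "x \<otimes>\<^bsub>D\<^esub> (c \<odot>\<^bsub>D\<^esub> y) = c \<odot>\<^bsub>D\<^esub> (x \<otimes>\<^bsub>D\<^esub> y)"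
      "star D (x \<oplus>\<^bsub>D\<^esub> y) = star D x \<oplus>\<^bsub>D\<^esub> star D y" "star D (x \<otimes>\<^bsub>D\<^esub> y) = star D y \<otimes>\<^bsub>D\<^esub> star D x"
      "anorm D (x \<oplus>\<^bsub>D\<^esub> y) \<le> anorm D x + anorm D y" "anorm D (x \<otimes>\<^bsub>D\<^esub> y) \<le> anorm D x * anorm D y"
      using a b by (simp_all add: transport_simps closed smult_mult_left smult_mult_right star_add star_mult
          anorm_triangle anorm_mult)
  qed
  show "star D x \<in> carrier D" "star D (star D x) = x" "star D (c \<odot>\<^bsub>D\<^esub> x) = cnj c \<odot>\<^bsub>D\<^esub> star D x"
    "0 \<le> anorm D x" "anorm D x = 0 \<longleftrightarrow> x = \<zero>\<^bsub>D\<^esub>" "anorm D (c \<odot>\<^bsub>D\<^esub> x) = cmod c * anorm D x"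
    "anorm D (star D x \<otimes>\<^bsub>D\<^esub> x) = (anorm D x)\<^sup>2"
    if x: "x \<in> carrier D" for x c
  proof -
    obtain a where a: "a \<in> carrier A" "x = g a" using x by (rule transport_elim)
    show "star D x \<in> carrier D" "star D (star D x) = x" "star D (c \<odot>\<^bsub>D\<^esub> x) = cnj c \<odot>\<^bsub>D\<^esub> star D x"
      "0 \<le> anorm D x" "anorm D x = 0 \<longleftrightarrow> x = \<zero>\<^bsub>D\<^esub>" "anorm D (c \<odot>\<^bsub>D\<^esub> x) = cmod c * anorm D x"
      "anorm D (star D x \<otimes>\<^bsub>D\<^esub> x) = (anorm D x)\<^sup>2"
      using a by (simp_all add: transport_simps closed star_star star_smult anorm_nonneg anorm_eq_0_iff
          anorm_smult cstar_identity g_eq_iff)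
  qed
  note facts = this
  have dist: "alg_dist D (g x) (g y) = alg_dist A x y" if "x \<in> carrier A" "y \<in> carrier A" for x y
    using that by (simp add: norm_dist_def minus_transport transport_simps)
  interpret dm: Metric_space "carrier D" "alg_dist D"
  proof
    show "0 \<le> alg_dist D x y" for x y by (simp add: norm_dist_def facts(4) abelian_group.minus_closed[OF abelian_group_transport])
    show "alg_dist D x y = alg_dist D y x" for x y
    proof (cases "x \<in> carrier D \<and> y \<in> carrier D")
      case True
      then show ?thesis by (auto simp: transport_simps(1) dist met.commute)
    qed (auto simp: norm_dist_def)
    show "alg_dist D x y = 0 \<longleftrightarrow> x = y" if "x \<in> carrier D" "y \<in> carrier D" for x y
      using that by (auto simp: transport_simps(1) dist g_eq_iff)
    show "alg_dist D x z \<le> alg_dist D x y + alg_dist D y z"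
      if "x \<in> carrier D" "y \<in> carrier D" "z \<in> carrier D" for x y z
      using that by (auto simp: transport_simps(1) dist met.triangle)
  qed
  show "dm.mcomplete"
    unfolding dm.mcomplete_def
  proof (intro allI impI)
    fix \<sigma> assume \<sigma>: "dm.MCauchy \<sigma>"
    then have "range \<sigma> \<subseteq> g ` carrier A" unfolding dm.MCauchy_def by (simp add: transport_simps(1))
    then have "\<sigma> n \<in> g ` carrier A" for n by blast
    then have "\<forall>n. \<exists>a. a \<in> carrier A \<and> \<sigma> n = g a" unfolding image_iff Bex_def by blast
    then obtain a where a: "\<And>n. a n \<in> carrier A" "\<And>n. \<sigma> n = g (a n)" by metis
    have "met.MCauchy a"
      using \<sigma> a(1) unfolding dm.MCauchy_def met.MCauchy_def by (auto simp: a(2) dist)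
    then obtain l where l: "limitin met.mtopology a l sequentially"
      using complete by (auto simp: met.mcomplete_def)
    then have lA: "l \<in> carrier A" by (simp add: met.limitin_metric)
    have "limitin dm.mtopology \<sigma> (g l) sequentially"
      using l a(1) lA unfolding dm.limitin_metric_dist_null met.limitin_metric_dist_null
      by (simp add: a(2) dist transport_simps(1))
    then show "\<exists>x. limitin dm.mtopology \<sigma> x sequentially" by blast
  qed
qed

end

section \<open>The cardinality of matrix algebras\<close>

lemma times_lepoll_infinite:
  assumes "infinite A"
  shows "A \<times> A \<lesssim> A"
proof -
  have "\<exists>f. bij_betw f (A \<times> A) A"
    unfolding card_of_ordIso by (rule card_of_Times_same_infinite[OF assms])
  then show ?thesis unfolding lepoll_def bij_betw_def by blast
qed

lemma length_lists_lepoll: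
  assumes "infinite A"
  shows "{xs. length xs = m \<and> set xs \<subseteq> A} \<lesssim> A"
proof (induction m)
  case 0
  have "{xs. length xs = 0 \<and> set xs \<subseteq> A} \<subseteq> {[]}" by auto
  then have "finite {xs. length xs = 0 \<and> set xs \<subseteq> A}" by (rule finite_subset) simp
  then show ?case by (rule finite_lepoll_infinite[OF assms])
next
  case (Suc m)
  have "{xs. length xs = Suc m \<and> set xs \<subseteq> A}
      \<subseteq> (\<lambda>(a, xs). a # xs) ` (A \<times> {xs. length xs = m \<and> set xs \<subseteq> A})"
  proof (rule subsetI)
    fix xs assume "xs \<in> {xs. length xs = Suc m \<and> set xs \<subseteq> A}"
    then show "xs \<in> (\<lambda>(a, xs). a # xs) ` (A \<times> {xs. length xs = m \<and> set xs \<subseteq> A})"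
      by (cases xs) (simp_all add: image_iff)
  qed
  then have "{xs. length xs = Suc m \<and> set xs \<subseteq> A} \<lesssim> A \<times> {xs. length xs = m \<and> set xs \<subseteq> A}"
    unfolding lepoll_iff by blast
  also have "\<dots> \<lesssim> A \<times> A" by (intro times_lepoll_mono Suc) simp
  also have "\<dots> \<lesssim> A" by (rule times_lepoll_infinite[OF assms])
  finally show ?case .
qed

lemma complex_lepoll_real: "(UNIV :: complex set) \<lesssim> (UNIV :: real set)"
proof -
  have "(UNIV :: complex set) \<lesssim> (UNIV :: real set) \<times> (UNIV :: real set)"
    unfolding lepoll_def by (intro exI[of _ "\<lambda>z. (Re z, Im z)"]) (auto simp: inj_on_def complex_eq_iff)
  also have "\<dots> \<lesssim> (UNIV :: real set)" by (rule times_lepoll_infinite) (rule infinite_UNIV_char_0)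
  finally show ?thesis .
qed

text \<open>An operator is determined by the list of its n * n matrix entries. Hence the operators
  inject into every type with at least continuum many elements, in particular into
  \<open>'d\<close>.\<close>

lemma bounded_operators_cvec_space_lepoll:
  "carrier (bounded_operators (cvec_space n)) \<lesssim> (UNIV :: real set)"
proof -
  define code where "code = (\<lambda>T :: complex vec \<Rightarrow> complex vec.
    map (\<lambda>m. T (unit_vec n (m div n)) $ (m mod n)) [0..<n * n])"
  have "inj_on code (carrier (bounded_operators (cvec_space n)))"
  proof (rule inj_onI)
    fix S T assume S: "S \<in> carrier (bounded_operators (cvec_space n))"
      and T: "T \<in> carrier (bounded_operators (cvec_space n))" and eq: "code S = code T"
    have entry: "S (unit_vec n j) $ i = T (unit_vec n j) $ i" if "i < n" "j < n" for i j
    proof -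
      have m: "j * n + i < n * n" using block_index_less[OF that(2,1)] .
      have "code S ! (j * n + i) = code T ! (j * n + i)" using eq by simp
      then show ?thesis using m that by (simp add: code_def)
    qed
    have "S x = T x" if x: "x \<in> carrier_vec n" for x
    proof -
      have "mat n n (\<lambda>(i, j). S (unit_vec n j) $ i) = mat n n (\<lambda>(i, j). T (unit_vec n j) $ i)"
        by (intro eq_matI) (simp_all add: entry)
      then show ?thesis
        using cvec_hom_eq_mat[OF _ x, of S] cvec_hom_eq_mat[OF _ x, of T] S T
        by (simp add: bounded_operators_simps(1))
    qed
    then show "S = T"
      using S T by (intro extensionalityI[of S "carrier_vec n" T]) (simp_all add: bounded_operators_simps(1))
  qed
  then have "carrier (bounded_operators (cvec_space n)) \<lesssim> {xs :: complex list. length xs = n * n \<and> set xs \<subseteq> UNIV}"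
    unfolding lepoll_def by (intro exI[of _ code]) (auto simp: code_def)
  also have "\<dots> \<lesssim> (UNIV :: complex set)" by (rule length_lists_lepoll) (rule infinite_UNIV_char_0)
  also have "\<dots> \<lesssim> (UNIV :: real set)" by (rule complex_lepoll_real)
  finally show ?thesis .
qed

section \<open>Embedding a C*-algebra into the product\<close>

text \<open>The inclusion of the summand \<open>A\<close>; it respects sums, products and scalars
  but not the unit.\<close>

definition at_index :: "'a normed_star_algebra \<Rightarrow> 'a \<Rightarrow> 'a cstar_product" where
  "at_index A x = mk_family (\<lambda>B. if B = A then x else \<zero>\<^bsub>B\<^esub>)"

text \<open>Filled up with ones instead of zeros, so that unitaries stay unitary and commutators
  vanish in all other components. On the summand \<open>A\<close> it acts by left multiplication, as
  \<open>at_index\<close> would.\<close>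

definition at_index_one :: "'a normed_star_algebra \<Rightarrow> 'a \<Rightarrow> 'a cstar_product" where
  "at_index_one A x = mk_family (\<lambda>B. if B = A then x else \<one>\<^bsub>B\<^esub>)"

context unital_cstar_algebra
begin

lemma comp_at_index:
  assumes x: "x \<in> carrier A" and B: "unital_cstar_algebra B"
  shows "comp (at_index A x) B = (if B = A then x else \<zero>\<^bsub>B\<^esub>)"
  unfolding at_index_def
proof (rule comp_mk_family[where C = "anorm A x", OF _ _ B])
  fix C :: "'a normed_star_algebra" assume C: "unital_cstar_algebra C"
  then interpret C: unital_cstar_algebra C .
  show "(if C = A then x else \<zero>\<^bsub>C\<^esub>) \<in> carrier C" using x by simp
  show "anorm C (if C = A then x else \<zero>\<^bsub>C\<^esub>) \<le> anorm A x" using anorm_nonneg[OF x] by (simp add: C.anorm_zero)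
qed

lemma comp_at_index_one:
  assumes x: "x \<in> carrier A" and B: "unital_cstar_algebra B"
  shows "comp (at_index_one A x) B = (if B = A then x else \<one>\<^bsub>B\<^esub>)"
  unfolding at_index_one_def
proof (rule comp_mk_family[where C = "max 1 (anorm A x)", OF _ _ B])
  fix C :: "'a normed_star_algebra" assume C: "unital_cstar_algebra C"
  then interpret C: unital_cstar_algebra C .
  show "(if C = A then x else \<one>\<^bsub>C\<^esub>) \<in> carrier C" using x by simp
  show "anorm C (if C = A then x else \<one>\<^bsub>C\<^esub>) \<le> max 1 (anorm A x)" using C.anorm_one_le by auto
qed

lemma at_index_add:
  assumes "x \<in> carrier A" "y \<in> carrier A"
  shows "at_index A (x \<oplus> y) = at_index A x + at_index A y"
proof (rule cstar_product_eqI)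
  fix B :: "'a normed_star_algebra" assume B: "unital_cstar_algebra B"
  then interpret B: unital_cstar_algebra B .
  show "comp (at_index A (x \<oplus> y)) B = comp (at_index A x + at_index A y) B"
    using assms B by (simp add: comp_at_index comp_add)
qed

lemma at_index_smult:
  assumes "x \<in> carrier A"
  shows "at_index A (c \<odot> x) = c *\<^sub>C at_index A x"
proof (rule cstar_product_eqI)
  fix B :: "'a normed_star_algebra" assume B: "unital_cstar_algebra B"
  then interpret B: unital_cstar_algebra B .
  show "comp (at_index A (c \<odot> x)) B = comp (c *\<^sub>C at_index A x) B"
    using assms B B.vs.smult_r_null[of c] by (simp add: comp_at_index comp_scaleC smult_closed_C)
qed

lemma at_index_mult:
  assumes "x \<in> carrier A" "y \<in> carrier A"
  shows "at_index A (x \<otimes> y) = at_index A x * at_index A y"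
proof (rule cstar_product_eqI)
  fix B :: "'a normed_star_algebra" assume B: "unital_cstar_algebra B"
  then interpret B: unital_cstar_algebra B .
  show "comp (at_index A (x \<otimes> y)) B = comp (at_index A x * at_index A y) B"
    using assms B by (simp add: comp_at_index comp_mult)
qed

lemma at_index_one_mult:
  assumes "u \<in> carrier A" "y \<in> carrier A"
  shows "at_index_one A u * at_index A y = at_index A (u \<otimes> y)"
proof (rule cstar_product_eqI)
  fix B :: "'a normed_star_algebra" assume B: "unital_cstar_algebra B"
  then interpret B: unital_cstar_algebra B .
  show "comp (at_index_one A u * at_index A y) B = comp (at_index A (u \<otimes> y)) B"
    using assms B by (simp add: comp_at_index comp_at_index_one comp_mult)
qed

lemma comp_at_index_self: "x \<in> carrier A \<Longrightarrow> comp (at_index A x) A = x"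
  using comp_at_index[OF _ unital_cstar_algebra_axioms] by simp

lemma norm_at_index_le: assumes x: "x \<in> carrier A" shows "norm (at_index A x) \<le> anorm A x"
proof (rule norm_cstar_product_le)
  fix B :: "'a normed_star_algebra" assume B: "unital_cstar_algebra B"
  then interpret B: unital_cstar_algebra B .
  show "anorm B (comp (at_index A x) B) \<le> anorm A x"
    using x B anorm_nonneg[OF x] by (simp add: comp_at_index B.anorm_zero)
qed (rule anorm_nonneg[OF x])

lemma at_index_nonzero: "x \<in> carrier A \<Longrightarrow> x \<noteq> \<zero> \<Longrightarrow> at_index A x \<noteq> 0"
  using comp_at_index_self[of x] comp_zero[OF unital_cstar_algebra_axioms] by auto

lemma unitary_at_index_one:
  assumes "unitary_in A u"
  shows "unitary (at_index_one A u)"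
proof -
  have u: "u \<in> carrier A" "u \<otimes> star A u = \<one>" "star A u \<otimes> u = \<one>" using assms by (simp_all add: unitary_in_def)
  have "adj (at_index_one A u) * at_index_one A u = 1 \<and> at_index_one A u * adj (at_index_one A u) = 1"
  proof (intro conjI; rule cstar_product_eqI)
    fix B :: "'a normed_star_algebra" assume B: "unital_cstar_algebra B"
    then interpret B: unital_cstar_algebra B .
    show "comp (adj (at_index_one A u) * at_index_one A u) B = comp 1 B"
      "comp (at_index_one A u * adj (at_index_one A u)) B = comp 1 B"
      using u B by (simp_all add: comp_at_index_one comp_mult comp_adj comp_one B.star_one)
  qed
  then show ?thesis by (simp add: unitary_def)
qed

lemma norm_commutator_at_index_one:
  assumes "u \<in> carrier A" "v \<in> carrier A" "anorm A (u \<otimes> v \<ominus> v \<otimes> u) \<le> \<epsilon>"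
  shows "norm (at_index_one A u * at_index_one A v - at_index_one A v * at_index_one A u) \<le> \<epsilon>"
proof (rule norm_cstar_product_le)
  show "0 \<le> \<epsilon>" using assms anorm_nonneg[of "u \<otimes> v \<ominus> v \<otimes> u"] by simp
  fix B :: "'a normed_star_algebra" assume B: "unital_cstar_algebra B"
  then interpret B: unital_cstar_algebra B .
  show "anorm B (comp (at_index_one A u * at_index_one A v - at_index_one A v * at_index_one A u) B) \<le> \<epsilon>"
  proof (cases "B = A")
    case True
    then show ?thesis
      using assms unital_cstar_algebra_axioms by (simp add: comp_at_index_one comp_mult comp_minus)
  next
    case False
    then show ?thesis
      using assms B \<open>0 \<le> \<epsilon>\<close>
      by (simp add: comp_at_index_one comp_mult comp_minus B.anorm_zero B.alg.minus_eq B.alg.r_neg)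
  qed
qed

text \<open>A positive root of norm(x)^2 - x* x, found in the product and read off at the component
  \<open>A\<close>. It is what brings the square roots of the type class back to algebras on
  carriers.\<close>

lemma exists_sqrt_defect:
  assumes x: "x \<in> carrier A"
  shows "\<exists>r\<in>carrier A. star A r = r \<and>
    r \<otimes> r \<oplus> star A x \<otimes> x = complex_of_real ((anorm A x)\<^sup>2) \<odot> \<one>"
proof -
  let ?x = "at_index A x"
  have "norm (adj ?x * ?x) \<le> (anorm A x)\<^sup>2"
    using norm_at_index_le[OF x] by (simp add: norm_adj_mult_self power_mono)
  then have "pos ((anorm A x)\<^sup>2 *\<^sub>R 1 - adj ?x * ?x)"
    by (rule pos_diff_of_norm_le[OF sa_intros(7)])
  then obtain r where r: "pos r" "r * r = (anorm A x)\<^sup>2 *\<^sub>R 1 - adj ?x * ?x" using pos_sqrt by blast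
  have sum: "r * r + adj ?x * ?x = (anorm A x)\<^sup>2 *\<^sub>R 1" by (simp add: r(2))
  note A = unital_cstar_algebra_axioms
  show ?thesis
  proof (intro bexI conjI)
    show "comp r A \<in> carrier A" by (rule comp_carrier[OF A])
    show "star A (comp r A) = comp r A"
      using comp_adj[OF A, of r] pos_sa[OF r(1)] by (metis sa_def)
    have "comp (r * r + adj ?x * ?x) A = comp ((anorm A x)\<^sup>2 *\<^sub>R 1) A" by (simp only: sum)
    then show "comp r A \<otimes> comp r A \<oplus> star A x \<otimes> x = complex_of_real ((anorm A x)\<^sup>2) \<odot> \<one>"
      by (simp only: comp_add[OF A] comp_mult[OF A] comp_adj[OF A] comp_scaleR[OF A] comp_one[OF A]
          comp_at_index_self[OF x])
  qed
qed

end

section \<open>Residual finite dimensionality\<close>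

lemma star_homD:
  assumes "\<phi> \<in> star_hom A B"
  shows "\<And>x. x \<in> carrier A \<Longrightarrow> \<phi> x \<in> carrier B"
    and "\<And>x y. x \<in> carrier A \<Longrightarrow> y \<in> carrier A \<Longrightarrow> \<phi> (x \<oplus>\<^bsub>A\<^esub> y) = \<phi> x \<oplus>\<^bsub>B\<^esub> \<phi> y"
    and "\<And>c x. x \<in> carrier A \<Longrightarrow> \<phi> (c \<odot>\<^bsub>A\<^esub> x) = c \<odot>\<^bsub>B\<^esub> \<phi> x"
    and "\<And>x y. x \<in> carrier A \<Longrightarrow> y \<in> carrier A \<Longrightarrow> \<phi> (x \<otimes>\<^bsub>A\<^esub> y) = \<phi> x \<otimes>\<^bsub>B\<^esub> \<phi> y"
    and "\<And>x. x \<in> carrier A \<Longrightarrow> \<phi> (star A x) = star B (\<phi> x)"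
  using assms by (auto simp: star_hom_def module_hom_def)

context hilbert_space_with_adjoints
begin

text \<open>Applying \<open>\<pi>\<close> to r^2 + x* x = norm(x)^2 and pairing with
  \<open>h\<close> shows that |pi(r) h|^2 + |pi(x) h|^2 = norm(x)^2 |h|^2; the first term is
  dropped. Contractivity is later needed for norm limits.\<close>

lemma star_hom_contractive:
  assumes A: "unital_cstar_algebra A" and \<pi>: "\<pi> \<in> unital_star_hom A B"
    and x: "x \<in> carrier A" and h: "h \<in> carrier H"
  shows "hnorm H (\<pi> x h) \<le> anorm A x * hnorm H h"
proof -
  interpret A: unital_cstar_algebra A by (rule A)
  have \<pi>1: "\<pi> \<in> star_hom A B" "\<pi> \<one>\<^bsub>A\<^esub> = \<one>\<^bsub>B\<^esub>" using \<pi> by (simp_all add: unital_star_hom_def)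
  note hom = star_homD[OF \<pi>1(1)]
  obtain r where r: "r \<in> carrier A" "star A r = r"
    "r \<otimes>\<^bsub>A\<^esub> r \<oplus>\<^bsub>A\<^esub> star A x \<otimes>\<^bsub>A\<^esub> x = complex_of_real ((anorm A x)\<^sup>2) \<odot>\<^bsub>A\<^esub> \<one>\<^bsub>A\<^esub>"
    using A.exists_sqrt_defect[OF x] by blast
  note sx = A.star_closed[OF x]
  have sq: "ip H (\<pi> (star A y \<otimes>\<^bsub>A\<^esub> y) h) h = ip H (\<pi> y h) (\<pi> y h)" if y: "y \<in> carrier A" for y
  proof -
    have yB: "\<pi> y \<in> carrier B" by (rule hom(1)[OF y])
    have yh: "\<pi> y h \<in> carrier H" by (rule bounded_opD(2)[OF yB h])
    have "\<pi> (star A y \<otimes>\<^bsub>A\<^esub> y) h = adjoint_op H (\<pi> y) (\<pi> y h)"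
      using h by (simp add: hom(4)[OF A.star_closed[OF y] y] hom(5)[OF y] bounded_operators_simps(2,7))
    moreover have "ip H (\<pi> y h) (\<pi> y h) = ip H h (adjoint_op H (\<pi> y) (\<pi> y h))"
      by (rule adjoint_op(2)[OF yB yh h])
    moreover have "ip H (adjoint_op H (\<pi> y) (\<pi> y h)) h = cnj (ip H h (adjoint_op H (\<pi> y) (\<pi> y h)))"
      by (rule ip_commute[OF h adjoint_op(1)[OF yB yh]])
    moreover have "cnj (ip H (\<pi> y h) (\<pi> y h)) = ip H (\<pi> y h) (\<pi> y h)"
      using ip_commute[OF yh yh] by simp
    ultimately show ?thesis by simp
  qed
  have "\<pi> (r \<otimes>\<^bsub>A\<^esub> r \<oplus>\<^bsub>A\<^esub> star A x \<otimes>\<^bsub>A\<^esub> x) h = \<pi> (r \<otimes>\<^bsub>A\<^esub> r) h \<oplus> \<pi> (star A x \<otimes>\<^bsub>A\<^esub> x) h"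
    using h r(1) sx x by (simp add: hom(2) bounded_operators_simps(5))
  moreover have "\<pi> (complex_of_real ((anorm A x)\<^sup>2) \<odot>\<^bsub>A\<^esub> \<one>\<^bsub>A\<^esub>) h = complex_of_real ((anorm A x)\<^sup>2) \<odot> h"
    using h by (simp add: hom(3) \<pi>1(2) bounded_operators_simps(3,6))
  ultimately have "\<pi> (star A r \<otimes>\<^bsub>A\<^esub> r) h \<oplus> \<pi> (star A x \<otimes>\<^bsub>A\<^esub> x) h = complex_of_real ((anorm A x)\<^sup>2) \<odot> h"
    by (simp only: r(2) r(3))
  then have "ip H (\<pi> (star A r \<otimes>\<^bsub>A\<^esub> r) h \<oplus> \<pi> (star A x \<otimes>\<^bsub>A\<^esub> x) h) h = complex_of_real ((anorm A x)\<^sup>2) * ip H h h"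
    using h by (simp add: ip_smult_left)
  moreover have "\<pi> (star A y \<otimes>\<^bsub>A\<^esub> y) h \<in> carrier H" if "y \<in> carrier A" for y
    using that h by (intro bounded_opD(2)[OF hom(1)]) (simp_all add: A.star_closed)
  ultimately have "ip H (\<pi> r h) (\<pi> r h) + ip H (\<pi> x h) (\<pi> x h) = complex_of_real ((anorm A x)\<^sup>2) * ip H h h"
    using h r(1) x by (simp only: ip_add_left sq)
  from arg_cong[OF this, of Re]
  have "Re (ip H (\<pi> r h) (\<pi> r h)) + Re (ip H (\<pi> x h) (\<pi> x h)) = (anorm A x)\<^sup>2 * Re (ip H h h)"
    by (simp del: of_real_power)
  moreover have "0 \<le> Re (ip H (\<pi> r h) (\<pi> r h))"
    by (rule ip_nonneg[OF bounded_opD(2)[OF hom(1)[OF r(1)] h]])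
  ultimately have "(hnorm H (\<pi> x h))\<^sup>2 \<le> (anorm A x * hnorm H h)\<^sup>2"
    using hnorm_power2[OF bounded_opD(2)[OF hom(1)[OF x] h]] hnorm_power2[OF h]
    by (simp add: power_mult_distrib)
  then show ?thesis
    by (rule power2_le_imp_le) (use A.anorm_nonneg[OF x] hnorm_nonneg[OF h] in simp)
qed

end

text \<open>The operator algebra is copied into \<open>'d\<close> along an injection
  \<open>g\<close>, the universal property is applied to the copy, and the resulting homomorphism is
  composed with the inverse of \<open>g\<close>.\<close>

lemma exists_star_hom_to_operators:
  fixes A :: "'a normed_star_algebra"
  assumes card: "(UNIV :: real set) \<lesssim> (UNIV :: 'd set)"
    and univ: "universal_almost_commuting TYPE('d) \<epsilon> A u v"
    and U: "isometry_op (cvec_space n) U" and V: "isometry_op (cvec_space n) V"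
    and comm: "\<And>x. x \<in> carrier_vec n \<Longrightarrow>
        hnorm (cvec_space n) (U (V x) - V (U x)) \<le> \<epsilon> * hnorm (cvec_space n) x"
    and \<epsilon>: "\<epsilon> \<ge> 0"
  shows "\<exists>\<pi>\<in>unital_star_hom A (bounded_operators (cvec_space n)).
     \<pi> u = restrict U (carrier_vec n) \<and> \<pi> v = restrict V (carrier_vec n)"
proof -
  let ?H = "cvec_space n"
  interpret hilbert_space_with_adjoints ?H by (rule hilbert_space_with_adjoints_cvec_space)
  interpret A: unital_cstar_algebra A using univ by (simp add: universal_almost_commuting_def)
  obtain g :: "(complex vec \<Rightarrow> complex vec) \<Rightarrow> 'd" where inj: "inj_on g (carrier B)"
    using lepoll_trans[OF bounded_operators_cvec_space_lepoll card, of n] by (auto simp: lepoll_def)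
  interpret B: unital_cstar_algebra B by (rule unital_cstar_algebra_ops)
  interpret transported_cstar_algebra B g
    by unfold_locales (rule inj)
  let ?U = "restrict U (carrier_vec n)" and ?V = "restrict V (carrier_vec n)"
  have uni: "unitary_in B ?U" "unitary_in B ?V"
    using unitary_of_isometry[OF U] unitary_of_isometry[OF V]
      isometry_surjective_cvec_space[OF U] isometry_surjective_cvec_space[OF V] by simp_all
  then have UV: "?U \<in> carrier B" "?V \<in> carrier B" by (simp_all add: unitary_in_def)
  have "anorm B (?U \<otimes>\<^bsub>B\<^esub> ?V \<ominus>\<^bsub>B\<^esub> ?V \<otimes>\<^bsub>B\<^esub> ?U) \<le> \<epsilon>"
  proof (rule anorm_le[OF \<epsilon>])
    fix x assume x: "x \<in> carrier ?H"
    have "U x \<in> carrier_vec n" "V x \<in> carrier_vec n" "U (V x) \<in> carrier_vec n" "V (U x) \<in> carrier_vec n"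
      using isometry_opD(1)[OF U] isometry_opD(1)[OF V] x by simp_all
    then have "(?U \<otimes>\<^bsub>B\<^esub> ?V \<ominus>\<^bsub>B\<^esub> ?V \<otimes>\<^bsub>B\<^esub> ?U) x = U (V x) - V (U x)"
      using x UV by (simp add: op_minus abelian_group_ops op_mult_closed(1) minus_cvec_space)
        (simp add: bounded_operators_simps(2) minus_cvec_space)
    then show "hnorm ?H ((?U \<otimes>\<^bsub>B\<^esub> ?V \<ominus>\<^bsub>B\<^esub> ?V \<otimes>\<^bsub>B\<^esub> ?U) x) \<le> \<epsilon> * hnorm ?H x"
      using comm[of x] x by simp
  qed
  then have "almost_commuting_unitaries \<epsilon> D (g ?U) (g ?V)"
    using uni UV by (simp add: almost_commuting_unitaries_def unitary_in_def transport_simps B.star_closed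
        minus_transport)
  then obtain \<phi> where \<phi>: "\<phi> \<in> unital_star_hom A D" "\<phi> u = g ?U" "\<phi> v = g ?V"
    using univ unital_cstar_algebra_transport unfolding universal_almost_commuting_def by blast
  then have \<phi>s: "\<phi> \<in> star_hom A D" and \<phi>1: "\<phi> \<one>\<^bsub>A\<^esub> = \<one>\<^bsub>D\<^esub>" by (simp_all add: unital_star_hom_def)
  note hom = star_homD[OF \<phi>s]
  define \<pi> where "\<pi> = (\<lambda>x. inv_into (carrier B) g (\<phi> x))"
  have \<pi>: "\<pi> x \<in> carrier B \<and> \<phi> x = g (\<pi> x)" if x: "x \<in> carrier A" for x
  proof -
    obtain b where "b \<in> carrier B" "\<phi> x = g b" using hom(1)[OF x] by (rule transport_elim)
    then show ?thesis by (simp add: \<pi>_def inv_g)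
  qed
  have eq: "\<pi> x = b" if "\<phi> x = g b" "b \<in> carrier B" for x b
    using that by (simp add: \<pi>_def inv_g)
  have "\<pi> \<in> unital_star_hom A B"
    unfolding unital_star_hom_def star_hom_def
  proof (intro CollectI conjI ballI module_homI)
    fix x y c assume x: "x \<in> carrier A" and y: "y \<in> carrier A"
    note p = \<pi>[OF x] \<pi>[OF y]
    show "\<pi> x \<in> carrier B" using p by simp
    show "\<pi> (x \<oplus>\<^bsub>A\<^esub> y) = \<pi> x \<oplus>\<^bsub>B\<^esub> \<pi> y"
      by (rule eq) (use p in \<open>simp_all add: hom(2)[OF x y] transport_simps\<close>)
    show "\<pi> (x \<otimes>\<^bsub>A\<^esub> y) = \<pi> x \<otimes>\<^bsub>B\<^esub> \<pi> y"
      by (rule eq) (use p in \<open>simp_all add: hom(4)[OF x y] transport_simps\<close>)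
    show "\<pi> (star A x) = star B (\<pi> x)"
      by (rule eq) (use p in \<open>simp_all add: hom(5)[OF x] transport_simps B.star_closed\<close>)
    show "\<pi> (c \<odot>\<^bsub>A\<^esub> x) = c \<odot>\<^bsub>B\<^esub> \<pi> x"
      by (rule eq) (use p in \<open>simp_all add: hom(3)[OF x] transport_simps B.smult_closed_C\<close>)
  next
    show "\<pi> \<one>\<^bsub>A\<^esub> = \<one>\<^bsub>B\<^esub>"
      by (rule eq) (simp_all add: \<phi>1 transport_simps)
  qed
  moreover have "\<pi> u = ?U" "\<pi> v = ?V" using \<phi>(2,3) UV by (simp_all add: eq)
  ultimately show ?thesis by blast
qed

text \<open>
  The data produced by the approximation for a finite set \<open>E\<close> and a length \<open>M\<close>; \<open>q\<close> is the square of
  the seminorm of the chosen positive functional.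
\<close>

definition approximating ::
  "'a normed_star_algebra \<Rightarrow> 'a \<Rightarrow> 'a \<Rightarrow> ('a \<Rightarrow> real) \<Rightarrow> 'a set \<Rightarrow> nat \<Rightarrow>
    nat \<times> ('a \<Rightarrow> complex vec) \<times> ('a \<Rightarrow> complex vec \<Rightarrow> complex vec) \<Rightarrow> bool" where
  "approximating A u v q E M = (\<lambda>(k, J, \<pi>).
     \<pi> \<in> unital_star_hom A (bounded_operators (cvec_space k)) \<and>
     J \<in> module_hom class_ring A (cvec_space k) \<and>
     (\<forall>x\<in>carrier A. (hnorm (cvec_space k) (J x))\<^sup>2 \<le> q x) \<and>
     (\<forall>x\<in>E. (hnorm (cvec_space k) (J x))\<^sup>2 = q x \<and> \<pi> u (J x) = J (u \<otimes>\<^bsub>A\<^esub> x)) \<and>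
     (\<forall>x\<in>carrier A. (hnorm (cvec_space k) (\<pi> v (J x) - J (v \<otimes>\<^bsub>A\<^esub> x)))\<^sup>2 \<le> 2 / real M * q x))"

text \<open>The approximation is carried out in the product, for the unitaries
  \<open>at_index_one\<close> of \<open>u\<close> and \<open>v\<close> and for the image of
  \<open>E\<close>; its embedding is then restricted to the summand \<open>A\<close>. The matrices
  obey the relation, so \<open>\<pi>\<close> exists.\<close>

lemma exists_approximating:
  fixes A :: "'a normed_star_algebra"
  assumes card: "(UNIV :: real set) \<lesssim> (UNIV :: 'd set)"
    and univ: "universal_almost_commuting TYPE('d) \<epsilon> A u v"
    and \<Phi>: "positive_functional \<Phi>"
    and E: "finite E" "E \<subseteq> carrier A" and M: "M > 0"
  shows "\<exists>s. approximating A u v (\<lambda>x. positive_functional.sq \<Phi> (at_index A x)) E M s"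
proof -
  interpret positive_functional \<Phi> by (rule \<Phi>)
  interpret A: unital_cstar_algebra A using univ by (simp add: universal_almost_commuting_def)
  have uv: "unitary_in A u" "unitary_in A v" "anorm A (u \<otimes>\<^bsub>A\<^esub> v \<ominus>\<^bsub>A\<^esub> v \<otimes>\<^bsub>A\<^esub> u) \<le> \<epsilon>"
    using univ by (simp_all add: universal_almost_commuting_def almost_commuting_unitaries_def)
  then have uvA: "u \<in> carrier A" "v \<in> carrier A" by (simp_all add: unitary_in_def)
  then have \<epsilon>: "\<epsilon> \<ge> 0" using uv(3) A.anorm_nonneg[of "u \<otimes>\<^bsub>A\<^esub> v \<ominus>\<^bsub>A\<^esub> v \<otimes>\<^bsub>A\<^esub> u"] by simp
  define E' where "E' = at_index A ` E"
  have "finite E'" using E(1) by (simp add: E'_def)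
  obtain k J Ut Vt where iso: "isometry_op (cvec_space k) Ut" "isometry_op (cvec_space k) Vt"
    and comm: "\<And>x. x \<in> carrier_vec k \<Longrightarrow> hnorm (cvec_space k) (Ut (Vt x) - Vt (Ut x)) \<le> \<epsilon> * hnorm (cvec_space k) x"
    and J: "\<And>x. J x \<in> carrier_vec k" "\<And>x y. J (x + y) = J x + J y" "\<And>c x. J (c *\<^sub>C x) = c \<cdot>\<^sub>v J x"
      "\<And>x. (hnorm (cvec_space k) (J x))\<^sup>2 \<le> sq x"
      "\<And>x. x \<in> E' \<Longrightarrow> (hnorm (cvec_space k) (J x))\<^sup>2 = sq x"
      "\<And>x. x \<in> E' \<Longrightarrow> Ut (J x) = J (at_index_one A u * x)"
      "\<And>x. (hnorm (cvec_space k) (Vt (J x) - J (at_index_one A v * x)))\<^sup>2 \<le> 2 / real M * sq x"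
    using finite_dimensional_approximation[OF A.unitary_at_index_one[OF uv(1)] A.unitary_at_index_one[OF uv(2)]
        A.norm_commutator_at_index_one[OF uvA uv(3)] \<open>finite E'\<close> M]
    apply (elim exE conjE)
    subgoal for k J Ut Vt by (rule that[of k Ut Vt J]) simp_all
    done
  obtain \<pi> where \<pi>: "\<pi> \<in> unital_star_hom A (bounded_operators (cvec_space k))"
    "\<pi> u = restrict Ut (carrier_vec k)" "\<pi> v = restrict Vt (carrier_vec k)"
    using exists_star_hom_to_operators[OF card univ iso comm \<epsilon>] by blast
  have "approximating A u v (\<lambda>x. sq (at_index A x)) E M (k, \<lambda>x. J (at_index A x), \<pi>)"
    unfolding approximating_def split_conv
  proof (intro conjI ballI module_homI)
    show "\<pi> \<in> unital_star_hom A (bounded_operators (cvec_space k))" by (rule \<pi>(1))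
    fix x assume "x \<in> E"
    then show "(hnorm (cvec_space k) (J (at_index A x)))\<^sup>2 = sq (at_index A x)"
      "\<pi> u (J (at_index A x)) = J (at_index A (u \<otimes>\<^bsub>A\<^esub> x))"
      using J(1,5,6) E(2) uvA A.at_index_one_mult[of u x] by (auto simp: \<pi>(2) E'_def)
  qed (use J(1,4,7) uvA in \<open>simp_all add: A.at_index_add A.at_index_smult J(2,3) \<pi>(3) A.at_index_one_mult[symmetric]\<close>)
  then show ?thesis by blast
qed

text \<open>
  The elements \<open>x\<close> with \<open>\<pi> x (J y) - J (x \<otimes> y) \<longrightarrow> 0\<close> for all \<open>y\<close>, along the net of approximations,
  form a norm closed algebra; it is everything since it contains \<open>u\<close>, \<open>v\<close> and their adjoints.
\<close>

locale approximation_net = unital_cstar_algebra A for A :: "'a normed_star_algebra" (structure) +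
  fixes u v :: 'a and q :: "'a \<Rightarrow> real" and
    s :: "'a set \<times> nat \<Rightarrow> nat \<times> ('a \<Rightarrow> complex vec) \<times> ('a \<Rightarrow> complex vec \<Rightarrow> complex vec)"
  assumes unitary_u: "unitary_in A u" and unitary_v: "unitary_in A v"
    and gen: "generates_cstar A {u, v}"
    and q_mult: "\<And>x y. x \<in> carrier A \<Longrightarrow> y \<in> carrier A \<Longrightarrow> q (x \<otimes> y) \<le> (anorm A x)\<^sup>2 * q y"
    and q_nonneg: "\<And>x. 0 \<le> q x"
    and approx: "\<And>E M. finite E \<Longrightarrow> E \<subseteq> carrier A \<Longrightarrow> M > 0 \<Longrightarrow> approximating A u v q E M (s (E, M))"
begin

definition K :: "'a set \<times> nat \<Rightarrow> complex vec inner_space" where "K i = cvec_space (fst (s i))"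
definition J :: "'a set \<times> nat \<Rightarrow> 'a \<Rightarrow> complex vec" where "J i = fst (snd (s i))"
definition \<pi> :: "'a set \<times> nat \<Rightarrow> 'a \<Rightarrow> complex vec \<Rightarrow> complex vec" where "\<pi> i = snd (snd (s i))"

text \<open>The filter of large finite subsets together with large \<open>M\<close>; using it, no
  countable dense subset has to be enumerated.\<close>

definition net :: "('a set \<times> nat) filter" where
  "net = finite_subsets_at_top (carrier A) \<times>\<^sub>F sequentially"

definition valid :: "'a set \<times> nat \<Rightarrow> bool" where
  "valid i \<longleftrightarrow> finite (fst i) \<and> fst i \<subseteq> carrier A \<and> snd i > 0"

lemma eventually_net:
  assumes "finite E" "E \<subseteq> carrier A"
  shows "eventually (\<lambda>i. valid i \<and> E \<subseteq> fst i \<and> M \<le> snd i) net"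
proof -
  have "eventually (\<lambda>F. finite F \<and> E \<subseteq> F \<and> F \<subseteq> carrier A) (finite_subsets_at_top (carrier A))"
    using assms by (auto simp: eventually_finite_subsets_at_top)
  moreover have "eventually (\<lambda>n. max 1 M \<le> n) sequentially" by (rule eventually_ge_at_top)
  ultimately have "eventually (\<lambda>i. (finite (fst i) \<and> E \<subseteq> fst i \<and> fst i \<subseteq> carrier A) \<and> max 1 M \<le> snd i) net"
    unfolding net_def by (rule eventually_prodI)
  then show ?thesis by (rule eventually_mono) (auto simp: valid_def)
qed

lemma net_nontrivial: "net \<noteq> bot"
  by (simp add: net_def prod_filter_eq_bot)

lemma valid_approx: "valid i \<Longrightarrow> approximating A u v q (fst i) (snd i) (fst (s i), J i, \<pi> i)"
  using approx[of "fst i" "snd i"] by (simp add: valid_def J_def \<pi>_def)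

section \<open>How far \<open>J\<close> is from intertwining the representations with left
  multiplication\<close>

definition err :: "'a set \<times> nat \<Rightarrow> 'a \<Rightarrow> 'a \<Rightarrow> real" where
  "err i x y = hnorm (K i) (\<pi> i x (J i y) \<ominus>\<^bsub>K i\<^esub> J i (x \<otimes> y))"

sublocale H: hilbert_space_with_adjoints "K i" for i
  unfolding K_def by (rule hilbert_space_with_adjoints_cvec_space)

lemma \<pi>_hom:
  assumes "valid i"
  shows "\<pi> i \<in> unital_star_hom A (bounded_operators (K i))"
    and "\<pi> i \<in> star_hom A (bounded_operators (K i))"
  using valid_approx[OF assms] by (simp_all add: approximating_def K_def unital_star_hom_def)

lemma \<pi>_closed: "valid i \<Longrightarrow> x \<in> carrier A \<Longrightarrow> h \<in> carrier (K i) \<Longrightarrow> \<pi> i x h \<in> carrier (K i)"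
  by (rule H.bounded_opD(2)[OF star_homD(1)[OF \<pi>_hom(2)]])

lemma \<pi>_simps:
  assumes i: "valid i" and h: "h \<in> carrier (K i)" and x: "x \<in> carrier A"
  shows "\<pi> i \<one> h = h"
    and "y \<in> carrier A \<Longrightarrow> \<pi> i (x \<oplus> y) h = \<pi> i x h \<oplus>\<^bsub>K i\<^esub> \<pi> i y h"
    and "y \<in> carrier A \<Longrightarrow> \<pi> i (x \<otimes> y) h = \<pi> i x (\<pi> i y h)"
    and "\<pi> i (c \<odot> x) h = c \<odot>\<^bsub>K i\<^esub> \<pi> i x h"
    and "hnorm (K i) (\<pi> i x h) \<le> anorm A x * hnorm (K i) h"
    and "h' \<in> carrier (K i) \<Longrightarrow> \<pi> i x (h \<ominus>\<^bsub>K i\<^esub> h') = \<pi> i x h \<ominus>\<^bsub>K i\<^esub> \<pi> i x h'"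
proof -
  note hom = star_homD[OF \<pi>_hom(2)[OF i]]
  show "\<pi> i \<one> h = h"
    using \<pi>_hom(1)[OF i] h by (simp add: unital_star_hom_def bounded_operators_simps(3))
  show "y \<in> carrier A \<Longrightarrow> \<pi> i (x \<oplus> y) h = \<pi> i x h \<oplus>\<^bsub>K i\<^esub> \<pi> i y h"
    using x h by (simp add: hom(2) bounded_operators_simps(5))
  show "y \<in> carrier A \<Longrightarrow> \<pi> i (x \<otimes> y) h = \<pi> i x (\<pi> i y h)"
    using x h by (simp add: hom(4) bounded_operators_simps(2))
  show "\<pi> i (c \<odot> x) h = c \<odot>\<^bsub>K i\<^esub> \<pi> i x h"
    using x h by (simp add: hom(3) bounded_operators_simps(6))
  show "hnorm (K i) (\<pi> i x h) \<le> anorm A x * hnorm (K i) h"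
    by (rule H.star_hom_contractive[OF unital_cstar_algebra_axioms \<pi>_hom(1)[OF i] x h])
  show "\<pi> i x (h \<ominus>\<^bsub>K i\<^esub> h') = \<pi> i x h \<ominus>\<^bsub>K i\<^esub> \<pi> i x h'" if h': "h' \<in> carrier (K i)"
    using h h' x \<pi>_closed[OF i x h] \<pi>_closed[OF i x h']
      H.bounded_opD(3)[OF hom(1)[OF x]] H.bounded_opD(4)[OF hom(1)[OF x]]
    by (simp add: H.minus_eq_smult)
qed

lemma J_simps:
  assumes i: "valid i" and x: "x \<in> carrier A"
  shows "J i x \<in> carrier (K i)"
    and "y \<in> carrier A \<Longrightarrow> J i (x \<oplus> y) = J i x \<oplus>\<^bsub>K i\<^esub> J i y"
    and "J i (c \<odot> x) = c \<odot>\<^bsub>K i\<^esub> J i x"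
    and "hnorm (K i) (J i x) \<le> sqrt (q x)"
    and "x \<in> fst i \<Longrightarrow> hnorm (K i) (J i x) = sqrt (q x)"
    and "x \<in> fst i \<Longrightarrow> \<pi> i u (J i x) = J i (u \<otimes> x)"
proof -
  have a: "J i \<in> module_hom class_ring A (K i)" "(hnorm (K i) (J i x))\<^sup>2 \<le> q x"
    "x \<in> fst i \<Longrightarrow> (hnorm (K i) (J i x))\<^sup>2 = q x" "x \<in> fst i \<Longrightarrow> \<pi> i u (J i x) = J i (u \<otimes> x)"
    using valid_approx[OF i] x by (simp_all add: approximating_def K_def)
  show c: "J i x \<in> carrier (K i)" by (rule module_homD(1)[OF a(1) x])
  show "y \<in> carrier A \<Longrightarrow> J i (x \<oplus> y) = J i x \<oplus>\<^bsub>K i\<^esub> J i y" by (rule module_homD(2)[OF a(1) x])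
  show "J i (c \<odot> x) = c \<odot>\<^bsub>K i\<^esub> J i x" by (rule module_homD(3)[OF a(1) _ x]) simp
  show "hnorm (K i) (J i x) \<le> sqrt (q x)" by (rule real_le_rsqrt[OF a(2)])
  show "x \<in> fst i \<Longrightarrow> hnorm (K i) (J i x) = sqrt (q x)"
    using a(3) H.hnorm_nonneg[OF c] by (metis real_sqrt_abs abs_of_nonneg)
  show "x \<in> fst i \<Longrightarrow> \<pi> i u (J i x) = J i (u \<otimes> x)" by (rule a(4))
qed

lemma err_nonneg: "valid i \<Longrightarrow> x \<in> carrier A \<Longrightarrow> y \<in> carrier A \<Longrightarrow> 0 \<le> err i x y"
  unfolding err_def by (intro H.hnorm_nonneg H.M.minus_closed \<pi>_closed J_simps(1)) simp_all

lemma u_carrier: "u \<in> carrier A" and v_carrier: "v \<in> carrier A"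
  using unitary_u unitary_v by (simp_all add: unitary_in_def)

lemma err_v:
  assumes i: "valid i" and y: "y \<in> carrier A"
  shows "err i v y \<le> sqrt (2 / real (snd i) * q y)"
proof (rule real_le_rsqrt)
  have "(hnorm (K i) (\<pi> i v (J i y) - J i (v \<otimes> y)))\<^sup>2 \<le> 2 / real (snd i) * q y"
    using valid_approx[OF i] y by (simp add: approximating_def K_def)
  moreover have "\<pi> i v (J i y) \<in> carrier (K i)" "J i (v \<otimes> y) \<in> carrier (K i)"
    using i y v_carrier by (simp_all add: \<pi>_closed J_simps(1))
  ultimately show "(err i v y)\<^sup>2 \<le> 2 / real (snd i) * q y"
    by (simp add: err_def K_def minus_cvec_space)
qed

lemma hnorm_minus_triangle:
  assumes "a \<in> carrier (K i)" "b \<in> carrier (K i)" "c \<in> carrier (K i)"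
  shows "hnorm (K i) (a \<ominus>\<^bsub>K i\<^esub> c) \<le> hnorm (K i) (a \<ominus>\<^bsub>K i\<^esub> b) + hnorm (K i) (b \<ominus>\<^bsub>K i\<^esub> c)"
  using H.met.triangle[of a i b c] assms by (simp add: norm_dist_def)

lemma err_add:
  assumes i: "valid i" and x: "x \<in> carrier A" "x' \<in> carrier A" and y: "y \<in> carrier A"
  shows "err i (x \<oplus> x') y \<le> err i x y + err i x' y"
proof -
  note c = \<pi>_closed[OF i x(1) J_simps(1)[OF i y]] \<pi>_closed[OF i x(2) J_simps(1)[OF i y]]
    J_simps(1)[OF i alg.m_closed[OF x(1) y]] J_simps(1)[OF i alg.m_closed[OF x(2) y]]
  have "\<pi> i (x \<oplus> x') (J i y) \<ominus>\<^bsub>K i\<^esub> J i ((x \<oplus> x') \<otimes> y)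
      = (\<pi> i x (J i y) \<ominus>\<^bsub>K i\<^esub> J i (x \<otimes> y)) \<oplus>\<^bsub>K i\<^esub> (\<pi> i x' (J i y) \<ominus>\<^bsub>K i\<^esub> J i (x' \<otimes> y))"
    using x y c by (simp add: \<pi>_simps(2)[OF i J_simps(1)[OF i y]] alg.l_distr J_simps(2)[OF i]
        H.M.minus_eq H.M.minus_add H.M.a_ac)
  then show ?thesis unfolding err_def using c by (simp add: H.hnorm_triangle)
qed

lemma err_smult:
  assumes i: "valid i" and x: "x \<in> carrier A" and y: "y \<in> carrier A"
  shows "err i (c \<odot> x) y = cmod c * err i x y"
proof -
  note cl = \<pi>_closed[OF i x J_simps(1)[OF i y]] J_simps(1)[OF i alg.m_closed[OF x y]]
  have "\<pi> i (c \<odot> x) (J i y) \<ominus>\<^bsub>K i\<^esub> J i ((c \<odot> x) \<otimes> y) = c \<odot>\<^bsub>K i\<^esub> (\<pi> i x (J i y) \<ominus>\<^bsub>K i\<^esub> J i (x \<otimes> y))"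
    using x y cl by (simp add: \<pi>_simps(4)[OF i J_simps(1)[OF i y]] smult_mult_left J_simps(3)[OF i]
        H.minus_eq_smult H.smult_r_distr H.smult_smult mult.commute)
  then show ?thesis unfolding err_def using cl by (simp add: H.hnorm_smult)
qed

text \<open>Insert \<open>\<pi>\<close> of \<open>x\<close> applied to J (x' y) and use
  contractivity. The second error is tested at x' y instead of \<open>y\<close>, which is why
  smallness is demanded at all vectors.\<close>

lemma err_mult:
  assumes i: "valid i" and x: "x \<in> carrier A" "x' \<in> carrier A" and y: "y \<in> carrier A"
  shows "err i (x \<otimes> x') y \<le> anorm A x * err i x' y + err i x (x' \<otimes> y)"
proof -
  note Jy = J_simps(1)[OF i y]
  note c1 = \<pi>_closed[OF i x(2) Jy] and c2 = J_simps(1)[OF i alg.m_closed[OF x(2) y]]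
  note c = \<pi>_closed[OF i x(1) c1] \<pi>_closed[OF i x(1) c2]
    J_simps(1)[OF i alg.m_closed[OF x(1) alg.m_closed[OF x(2) y]]]
  have "err i (x \<otimes> x') y = hnorm (K i) (\<pi> i x (\<pi> i x' (J i y)) \<ominus>\<^bsub>K i\<^esub> J i (x \<otimes> (x' \<otimes> y)))"
    using x y by (simp add: err_def \<pi>_simps(3)[OF i Jy] alg.m_assoc)
  also have "\<dots> \<le> hnorm (K i) (\<pi> i x (\<pi> i x' (J i y)) \<ominus>\<^bsub>K i\<^esub> \<pi> i x (J i (x' \<otimes> y))) + err i x (x' \<otimes> y)"
    unfolding err_def by (rule hnorm_minus_triangle[OF c])
  also have "\<pi> i x (\<pi> i x' (J i y)) \<ominus>\<^bsub>K i\<^esub> \<pi> i x (J i (x' \<otimes> y)) = \<pi> i x (\<pi> i x' (J i y) \<ominus>\<^bsub>K i\<^esub> J i (x' \<otimes> y))"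
    by (rule \<pi>_simps(6)[OF i c1 x(1) c2, symmetric])
  also have "hnorm (K i) \<dots> \<le> anorm A x * err i x' y"
    unfolding err_def by (rule \<pi>_simps(5)[OF i H.M.minus_closed[OF c1 c2] x(1)])
  finally show ?thesis by simp
qed

text \<open>A bound independent of the index, which makes the set of elements with vanishing error
  norm closed. One summand comes from contractivity of \<open>\<pi>\<close>, the other from
  \<open>q_mult\<close>.\<close>

lemma err_le:
  assumes i: "valid i" and x: "x \<in> carrier A" and y: "y \<in> carrier A"
  shows "err i x y \<le> 2 * anorm A x * sqrt (q y)"
proof -
  note Jy = J_simps(1)[OF i y] and Jxy = J_simps(1)[OF i alg.m_closed[OF x y]]
  note c = \<pi>_closed[OF i x Jy]
  have "err i x y \<le> hnorm (K i) (\<pi> i x (J i y)) + hnorm (K i) (J i (x \<otimes> y))"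
    using H.hnorm_triangle[OF c H.smult_closed[OF _ Jxy], of "-1"] H.hnorm_smult[OF Jxy, of "-1"]
    by (simp add: err_def H.minus_eq_smult[OF c Jxy])
  moreover have "hnorm (K i) (\<pi> i x (J i y)) \<le> anorm A x * sqrt (q y)"
    using \<pi>_simps(5)[OF i Jy x] mult_left_mono[OF J_simps(4)[OF i y] anorm_nonneg[OF x]] by linarith
  moreover have "hnorm (K i) (J i (x \<otimes> y)) \<le> anorm A x * sqrt (q y)"
  proof -
    have "sqrt (q (x \<otimes> y)) \<le> sqrt ((anorm A x)\<^sup>2 * q y)" using q_mult[OF x y] by simp
    then show ?thesis using J_simps(4)[OF i alg.m_closed[OF x y]] anorm_nonneg[OF x]
      by (simp add: real_sqrt_mult)
  qed
  ultimately show ?thesis by simp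
qed

text \<open>For a unitary \<open>w\<close> we have \<open>\<pi> w* (J y) - J (w* y) = \<pi> w* (J (w w* y) - \<pi> w (J (w* y)))\<close>.\<close>

lemma err_star_unitary:
  assumes i: "valid i" and w: "unitary_in A w" and y: "y \<in> carrier A"
  shows "err i (star A w) y \<le> anorm A (star A w) * err i w (star A w \<otimes> y)"
proof -
  have wc: "w \<in> carrier A" "w \<otimes> star A w = \<one>" "star A w \<otimes> w = \<one>" using w by (simp_all add: unitary_in_def)
  note sw = star_closed[OF wc(1)]
  define z where "z = star A w \<otimes> y"
  have z: "z \<in> carrier A" "w \<otimes> z = y"
    using sw wc y alg.m_assoc[of w "star A w" y] by (simp_all add: z_def)
  note Jz = J_simps(1)[OF i z(1)] and Jy = J_simps(1)[OF i y]
  note c = \<pi>_closed[OF i wc(1) Jz]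
  have "\<pi> i (star A w) (\<pi> i w (J i z)) = J i z"
    using \<pi>_simps(3)[OF i Jz sw wc(1)] \<pi>_simps(1)[OF i Jz sw] by (simp add: wc)
  then have "\<pi> i (star A w) (J i y) \<ominus>\<^bsub>K i\<^esub> J i z = \<pi> i (star A w) (J i y \<ominus>\<^bsub>K i\<^esub> \<pi> i w (J i z))"
    using \<pi>_simps(6)[OF i Jy sw c] by simp
  then have "err i (star A w) y = hnorm (K i) (\<pi> i (star A w) (J i y \<ominus>\<^bsub>K i\<^esub> \<pi> i w (J i z)))"
    by (simp add: err_def z_def)
  also have "\<dots> \<le> anorm A (star A w) * hnorm (K i) (J i y \<ominus>\<^bsub>K i\<^esub> \<pi> i w (J i z))"
    by (rule \<pi>_simps(5)[OF i H.M.minus_closed[OF Jy c] sw])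
  also have "hnorm (K i) (J i y \<ominus>\<^bsub>K i\<^esub> \<pi> i w (J i z)) = err i w z"
    using H.met.commute[of i "J i y" "\<pi> i w (J i z)"] Jy c by (simp add: err_def z norm_dist_def)
  finally show ?thesis by (simp add: z_def)
qed

section \<open>Elements intertwined in the limit\<close>

definition good :: "'a set" where
  "good = {x \<in> carrier A. \<forall>y\<in>carrier A. ((\<lambda>i. err i x y) \<longlongrightarrow> 0) net}"

text \<open>The estimate need only hold for indices whose finite set contains \<open>E\<close>,
  since these are eventually all of them; this is how the exact relation for \<open>u\<close> on a
  finite set is used.\<close>

lemma goodI:
  assumes x: "x \<in> carrier A"
    and bound: "\<And>y. y \<in> carrier A \<Longrightarrow> \<exists>f. (f \<longlongrightarrow> 0) net \<and> (\<exists>E. finite E \<and> E \<subseteq> carrier A \<and>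
      (\<forall>i. valid i \<longrightarrow> E \<subseteq> fst i \<longrightarrow> err i x y \<le> f i))"
  shows "x \<in> good"
  unfolding good_def
proof (intro CollectI conjI ballI x)
  fix y assume y: "y \<in> carrier A"
  obtain f E where f: "(f \<longlongrightarrow> 0) net" and E: "finite E" "E \<subseteq> carrier A"
    and le: "\<And>i. valid i \<Longrightarrow> E \<subseteq> fst i \<Longrightarrow> err i x y \<le> f i"
    using bound[OF y] by blast
  show "((\<lambda>i. err i x y) \<longlongrightarrow> 0) net"
  proof (rule tendsto_sandwich[OF _ _ tendsto_const f])
    show "eventually (\<lambda>i. 0 \<le> err i x y) net" "eventually (\<lambda>i. err i x y \<le> f i) net"
      using eventually_net[OF E, of 0] by (auto elim!: eventually_mono simp: err_nonneg x y le)
  qed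
qed

lemma good_carrier: "x \<in> good \<Longrightarrow> x \<in> carrier A"
  by (simp add: good_def)

lemma goodD: "x \<in> good \<Longrightarrow> y \<in> carrier A \<Longrightarrow> ((\<lambda>i. err i x y) \<longlongrightarrow> 0) net"
  by (simp add: good_def)

lemma good_one: "\<one> \<in> good"
proof (rule goodI)
  fix y assume y: "y \<in> carrier A"
  have "err i \<one> y = 0" if i: "valid i" for i
    using y J_simps(1)[OF i y] by (simp add: err_def \<pi>_simps(1)[OF i _ alg.one_closed] H.M.minus_eq H.M.r_neg H.hnorm_zero)
  then show "\<exists>f. (f \<longlongrightarrow> 0) net \<and> (\<exists>E. finite E \<and> E \<subseteq> carrier A \<and>
      (\<forall>i. valid i \<longrightarrow> E \<subseteq> fst i \<longrightarrow> err i \<one> y \<le> f i))"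
    by (intro exI[of _ "\<lambda>_. 0"] conjI exI[of _ "{}"]) auto
qed simp

lemma good_add: assumes "x \<in> good" "x' \<in> good" shows "x \<oplus> x' \<in> good"
proof (rule goodI)
  note c = assms[THEN good_carrier]
  show "x \<oplus> x' \<in> carrier A" using c by simp
  fix y assume y: "y \<in> carrier A"
  have "((\<lambda>i. err i x y + err i x' y) \<longlongrightarrow> 0) net"
    using tendsto_add[OF goodD[OF assms(1) y] goodD[OF assms(2) y]] by simp
  then show "\<exists>f. (f \<longlongrightarrow> 0) net \<and> (\<exists>E. finite E \<and> E \<subseteq> carrier A \<and>
      (\<forall>i. valid i \<longrightarrow> E \<subseteq> fst i \<longrightarrow> err i (x \<oplus> x') y \<le> f i))"
    using err_add[OF _ c y] by (intro exI[of _ "\<lambda>i. err i x y + err i x' y"] conjI exI[of _ "{}"]) auto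
qed

lemma good_smult: assumes "x \<in> good" shows "c \<odot> x \<in> good"
proof (rule goodI)
  note x = assms[THEN good_carrier]
  show "c \<odot> x \<in> carrier A" using x by (rule smult_closed_C)
  fix y assume y: "y \<in> carrier A"
  have "((\<lambda>i. cmod c * err i x y) \<longlongrightarrow> 0) net"
    using tendsto_mult[OF tendsto_const goodD[OF assms y], of "cmod c"] by simp
  then show "\<exists>f. (f \<longlongrightarrow> 0) net \<and> (\<exists>E. finite E \<and> E \<subseteq> carrier A \<and>
      (\<forall>i. valid i \<longrightarrow> E \<subseteq> fst i \<longrightarrow> err i (c \<odot> x) y \<le> f i))"
    using err_smult[OF _ x y] by (intro exI[of _ "\<lambda>i. cmod c * err i x y"] conjI exI[of _ "{}"]) auto
qed

lemma good_mult: assumes "x \<in> good" "x' \<in> good" shows "x \<otimes> x' \<in> good"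
proof (rule goodI)
  note c = assms[THEN good_carrier]
  show "x \<otimes> x' \<in> carrier A" using c by simp
  fix y assume y: "y \<in> carrier A"
  have "((\<lambda>i. anorm A x * err i x' y + err i x (x' \<otimes> y)) \<longlongrightarrow> 0) net"
    using tendsto_add[OF tendsto_mult[OF tendsto_const goodD[OF assms(2) y], of "anorm A x"]
        goodD[OF assms(1) alg.m_closed[OF c(2) y]]] by simp
  then show "\<exists>f. (f \<longlongrightarrow> 0) net \<and> (\<exists>E. finite E \<and> E \<subseteq> carrier A \<and>
      (\<forall>i. valid i \<longrightarrow> E \<subseteq> fst i \<longrightarrow> err i (x \<otimes> x') y \<le> f i))"
    using err_mult[OF _ c y]
    by (intro exI[of _ "\<lambda>i. anorm A x * err i x' y + err i x (x' \<otimes> y)"] conjI exI[of _ "{}"]) auto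
qed

lemma good_u: "u \<in> good"
proof (rule goodI[OF u_carrier])
  fix y assume y: "y \<in> carrier A"
  have "err i u y = 0" if i: "valid i" "y \<in> fst i" for i
    using J_simps(1)[OF i(1) alg.m_closed[OF u_carrier y]]
    by (simp add: err_def J_simps(6)[OF i(1) y i(2)] H.M.minus_eq H.M.r_neg H.hnorm_zero)
  then show "\<exists>f. (f \<longlongrightarrow> 0) net \<and> (\<exists>E. finite E \<and> E \<subseteq> carrier A \<and>
      (\<forall>i. valid i \<longrightarrow> E \<subseteq> fst i \<longrightarrow> err i u y \<le> f i))"
    using y by (intro exI[of _ "\<lambda>_. 0"] conjI exI[of _ "{y}"]) auto
qed

lemma good_v: "v \<in> good"
proof (rule goodI[OF v_carrier])
  fix y assume y: "y \<in> carrier A"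
  have "((\<lambda>n. 2 / real n) \<longlongrightarrow> 0) sequentially" by real_asymp
  from tendsto_real_sqrt[OF tendsto_mult_left_zero[OF this, of "q y"]]
  have "((\<lambda>n. sqrt (2 / real n * q y)) \<longlongrightarrow> 0) sequentially" by simp
  moreover have "filterlim snd sequentially net"
    unfolding net_def by (rule filterlim_snd)
  ultimately have "((\<lambda>i. sqrt (2 / real (snd i) * q y)) \<longlongrightarrow> 0) net"
    by (rule filterlim_compose)
  then show "\<exists>f. (f \<longlongrightarrow> 0) net \<and> (\<exists>E. finite E \<and> E \<subseteq> carrier A \<and>
      (\<forall>i. valid i \<longrightarrow> E \<subseteq> fst i \<longrightarrow> err i v y \<le> f i))"
    using err_v[OF _ y] by (intro exI[of _ "\<lambda>i. sqrt (2 / real (snd i) * q y)"] conjI exI[of _ "{}"]) auto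
qed

lemma good_star_unitary:
  assumes w: "unitary_in A w" and good: "w \<in> good"
  shows "star A w \<in> good"
proof (rule goodI)
  note sw = star_closed[OF good_carrier[OF good]]
  then show "star A w \<in> carrier A" .
  fix y assume y: "y \<in> carrier A"
  have "((\<lambda>i. anorm A (star A w) * err i w (star A w \<otimes> y)) \<longlongrightarrow> 0) net"
    using tendsto_mult[OF tendsto_const goodD[OF good alg.m_closed[OF sw y]], of "anorm A (star A w)"] by simp
  then show "\<exists>f. (f \<longlongrightarrow> 0) net \<and> (\<exists>E. finite E \<and> E \<subseteq> carrier A \<and>
      (\<forall>i. valid i \<longrightarrow> E \<subseteq> fst i \<longrightarrow> err i (star A w) y \<le> f i))"
    using err_star_unitary[OF _ w y]
    by (intro exI[of _ "\<lambda>i. anorm A (star A w) * err i w (star A w \<otimes> y)"] conjI exI[of _ "{}"]) auto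
qed

lemma good_closed:
  assumes x: "x \<in> carrier A" and approx: "\<And>r. r > 0 \<Longrightarrow> \<exists>x'\<in>good. anorm A (x \<ominus> x') < r"
  shows "x \<in> good"
  unfolding good_def
proof (intro CollectI conjI ballI x tendstoI)
  fix y and \<delta> :: real assume y: "y \<in> carrier A" and \<delta>: "\<delta> > 0"
  \<comment> \<open>The summand 1 keeps the division by \<open>C\<close> meaningful when
    \<open>q y\<close> is 0.\<close>
  define C where "C = 2 * sqrt (q y) + 1"
  have C: "C > 0" using q_nonneg[of y] by (simp add: C_def add_nonneg_pos)
  obtain x' where x': "x' \<in> good" "anorm A (x \<ominus> x') < \<delta> / (2 * C)"
    using approx[of "\<delta> / (2 * C)"] \<delta> C by auto
  note x'c = good_carrier[OF x'(1)]
  have d: "x \<ominus> x' \<in> carrier A" using x x'c by simp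
  have xx: "x' \<oplus> (x \<ominus> x') = x"
    using x x'c by (simp add: alg.minus_eq alg.a_lcomm[of x' x] alg.r_neg)
  have small: "2 * anorm A (x \<ominus> x') * sqrt (q y) \<le> \<delta> / 2"
  proof -
    have "2 * anorm A (x \<ominus> x') * sqrt (q y) \<le> anorm A (x \<ominus> x') * C"
      using anorm_nonneg[OF d] by (simp add: C_def algebra_simps)
    also have "\<dots> \<le> \<delta> / (2 * C) * C" using x'(2) C by (intro mult_right_mono) simp_all
    finally show ?thesis using C by simp
  qed
  have "eventually (\<lambda>i. err i x' y < \<delta> / 2) net"
    using order_tendstoD(2)[OF goodD[OF x'(1) y], of "\<delta> / 2"] \<delta> by simp
  then show "eventually (\<lambda>i. dist (err i x y) 0 < \<delta>) net"
    using eventually_net[of "{}" 0, simplified]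
  proof eventually_elim
    case (elim i)
    then have i: "valid i" by simp
    have "err i x y \<le> err i x' y + err i (x \<ominus> x') y"
      using err_add[OF i x'c d y] by (simp add: xx)
    also have "err i (x \<ominus> x') y \<le> \<delta> / 2" using err_le[OF i d y] small by simp
    finally show ?case using elim err_nonneg[OF i x y] by simp
  qed
qed

lemma carrier_good: "carrier A \<subseteq> good"
proof -
  \<comment> \<open>Goodness does not visibly pass to adjoints, so closure under the star is built
    into \<open>S\<close>. For the generators it holds by \<open>good_star_unitary\<close>.\<close>
  define S where "S = {x \<in> good. star A x \<in> good}"
  have S_closed: "x \<in> S" if x: "x \<in> carrier A" and appr: "\<And>r. r > 0 \<Longrightarrow> \<exists>x'\<in>S. alg_dist A x x' < r" for x
  proof -
    have appr': "\<exists>x'\<in>S. anorm A (x \<ominus> x') < r" if "r > 0" for r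
      using appr[OF that] x good_carrier by (auto simp: norm_dist_def S_def)
    have "x \<in> good" by (rule good_closed[OF x]) (use appr' in \<open>auto simp: S_def\<close>)
    moreover have "star A x \<in> good"
    proof (rule good_closed[OF star_closed[OF x]])
      fix r :: real assume "r > 0"
      then obtain x' where x': "x' \<in> S" "anorm A (x \<ominus> x') < r" using appr' by blast
      then have x'c: "x' \<in> carrier A" using good_carrier by (simp add: S_def)
      have "star A x \<ominus> star A x' = star A (x \<ominus> x')"
        using x x'c star_smult[OF x'c, of "-1"]
        by (simp add: alg.minus_eq star_add minus_smult_C star_closed)
      then have "anorm A (star A x \<ominus> star A x') < r" using x' x x'c by (simp add: anorm_star)
      then show "\<exists>x'\<in>good. anorm A (star A x \<ominus> x') < r" using x' by (auto simp: S_def)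
    qed
    ultimately show ?thesis by (simp add: S_def)
  qed
  have SA: "S \<subseteq> carrier A" using good_carrier by (auto simp: S_def)
  have zero: "\<zero> \<in> S"
    using good_smult[OF good_one, of 0] by (simp add: zero_smult_C S_def star_zero)
  have "unital_cstar_subalgebra A S"
    unfolding unital_cstar_subalgebra_def
  proof (intro conjI ballI)
    show "submodule class_ring S A"
    proof (rule submodule.intro)
      show "x \<oplus> y \<in> S" if "x \<in> S" "y \<in> S" for x y
        using that good_add good_carrier by (simp add: S_def star_add)
      show "c \<odot> x \<in> S" if "x \<in> S" for c x
        using that good_smult good_carrier by (simp add: S_def star_smult)
      show "module class_ring A" by (rule vs.module_axioms)
    qed (use SA zero in auto)
    show "\<one> \<in> S" using good_one by (simp add: S_def star_one)
    show "x \<otimes> y \<in> S" if "x \<in> S" "y \<in> S" for x y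
      using that good_mult good_carrier by (simp add: S_def star_mult)
    show "star A x \<in> S" if "x \<in> S" for x
      using that good_carrier by (simp add: S_def star_star)
    show "closedin met.mtopology S"
      unfolding met.closedin_metric
    proof (intro conjI allI impI SA)
      fix x assume x: "x \<in> carrier A - S"
      then obtain r where r: "r > 0" "\<And>x'. x' \<in> S \<Longrightarrow> \<not> alg_dist A x x' < r" using S_closed[of x] by auto
      then show "\<exists>r>0. disjnt S (met.mball x r)"
        by (intro exI[of _ r]) (auto simp: disjnt_def met.mball_def)
    qed
  qed
  moreover have "{u, v} \<subseteq> S"
    using good_u good_v good_star_unitary unitary_u unitary_v by (simp add: S_def)
  ultimately have "unital_cstar_subalgebra A hull {u, v} \<subseteq> S" by (intro hull_minimal)
  then show ?thesis using gen by (auto simp: generates_cstar_def S_def)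
qed

text \<open>Evaluate the error of \<open>a\<close> at the unit: if \<open>\<pi>\<close> killed
  \<open>a\<close>, the error would be the norm of \<open>J a\<close>, which is exactly sqrt(q a)
  once \<open>a\<close> lies in the finite set. This contradicts convergence to 0.\<close>

theorem exists_nonvanishing:
  assumes a: "a \<in> carrier A" and qa: "q a > 0"
  shows "\<exists>k \<rho>. representation A (cvec_space k) \<rho> \<and> \<rho> a \<noteq> \<zero>\<^bsub>bounded_operators (cvec_space k)\<^esub>"
proof -
  have "((\<lambda>i. err i a \<one>) \<longlongrightarrow> 0) net" using carrier_good a by (intro goodD) auto
  then have "eventually (\<lambda>i. err i a \<one> < sqrt (q a)) net"
    by (rule order_tendstoD(2)) (rule real_sqrt_gt_zero[OF qa])
  then have "eventually (\<lambda>i. err i a \<one> < sqrt (q a) \<and> valid i \<and> {a} \<subseteq> fst i \<and> 0 \<le> snd i) net"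
    using a by (intro eventually_conj eventually_net) simp_all
  then obtain i where i: "err i a \<one> < sqrt (q a)" "valid i" "a \<in> fst i"
    using eventually_happens'[OF net_nontrivial] by blast
  have "\<pi> i a \<noteq> \<zero>\<^bsub>bounded_operators (K i)\<^esub>"
  proof
    assume zero: "\<pi> i a = \<zero>\<^bsub>bounded_operators (K i)\<^esub>"
    note Ja = J_simps(1)[OF i(2) a]
    have "\<pi> i a (J i \<one>) = \<zero>\<^bsub>K i\<^esub>"
      using J_simps(1)[OF i(2) alg.one_closed] by (simp add: zero bounded_operators_simps(4))
    then have "err i a \<one> = hnorm (K i) (\<zero>\<^bsub>K i\<^esub> \<ominus>\<^bsub>K i\<^esub> J i a)" using a by (simp add: err_def)
    also have "\<dots> = hnorm (K i) (J i a)"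
      using Ja H.hnorm_smult[OF Ja, of "-1"] by (simp add: H.minus_eq_smult)
    also have "\<dots> = sqrt (q a)" by (rule J_simps(5)[OF i(2) a i(3)])
    finally show False using i(1) by simp
  qed
  then show ?thesis
    using \<pi>_hom(2)[OF i(2)] hilbert_space_cvec_space unfolding representation_def K_def by blast
qed

end

theorem theorem4p1:
  fixes A :: "'a normed_star_algebra" and u v :: 'a and \<epsilon> :: real
  assumes "\<epsilon> > 0"
    and "(UNIV :: real set) \<lesssim> (UNIV :: 'd set)"
    and "universal_almost_commuting TYPE('d) \<epsilon> A u v"
  shows "residually_finite_dimensional A"
  unfolding residually_finite_dimensional_def
proof (intro ballI impI)
  fix a assume a: "a \<in> carrier A" "a \<noteq> \<zero>\<^bsub>A\<^esub>"
  interpret A: unital_cstar_algebra A using assms(3) by (simp add: universal_almost_commuting_def)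
  \<comment> \<open>The functional lives on the product, where \<open>a\<close> appears as a nonzero
    element; its seminorm is then pulled back to \<open>A\<close> as \<open>q\<close>.\<close>
  obtain \<Phi> where \<Phi>: "positive_functional \<Phi>" "0 < Re (\<Phi> (adj (at_index A a) * at_index A a))"
    using exists_positive_functional[OF A.at_index_nonzero[OF a]] by blast
  interpret positive_functional \<Phi> by (rule \<Phi>(1))
  define q where "q = (\<lambda>x. sq (at_index A x))"
  obtain s where s: "\<And>E M. finite E \<Longrightarrow> E \<subseteq> carrier A \<Longrightarrow> M > 0 \<Longrightarrow> approximating A u v q E M (s E M)"
    using exists_approximating[OF assms(2,3) \<Phi>(1)] unfolding q_def by metis
  interpret approximation_net A u v q "\<lambda>(E, M). s E M"
  proof
    show "unitary_in A u" "unitary_in A v" "generates_cstar A {u, v}"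
      using assms(3) by (simp_all add: universal_almost_commuting_def almost_commuting_unitaries_def)
    show "q (x \<otimes>\<^bsub>A\<^esub> y) \<le> (anorm A x)\<^sup>2 * q y" if x: "x \<in> carrier A" and y: "y \<in> carrier A" for x y
    proof -
      have "q (x \<otimes>\<^bsub>A\<^esub> y) \<le> (norm (at_index A x))\<^sup>2 * q y"
        unfolding q_def A.at_index_mult[OF x y] by (rule sq_mult_le)
      also have "\<dots> \<le> (anorm A x)\<^sup>2 * q y"
        using A.norm_at_index_le[OF x] by (intro mult_right_mono power_mono) (simp_all add: q_def sq_nonneg)
      finally show ?thesis .
    qed
    show "0 \<le> q x" for x by (simp add: q_def sq_nonneg)
  qed (use s in simp)
  have "q a > 0" using \<Phi>(2) by (simp add: q_def sq_def gns_def)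
  then show "\<exists>(H :: complex vec inner_space) \<pi>. representation A H \<pi> \<and>
      vectorspace.fin_dim class_ring H \<and> \<pi> a \<noteq> \<zero>\<^bsub>bounded_operators H\<^esub>"
    using exists_nonvanishing[OF a(1)] fin_dim_cvec_space by blast
qed

end
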